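(* For every fixed integer $d$, Connected $k$-Vertex Cover and Capacitated $k$-Vertex Cover, restricted to input graphs of twin-width at most $d$, each admit a kernel whose output graph has $O(k^2)$ vertices (the hidden constant depending only on $d$).
   Context: Connected $k$-Vertex Cover: given a graph $G$ and integer $k$ (parameter), decide whether $G$ has a vertex cover $S$ with $|S|\le k$ such that $G[S]$ is connected. Capacitated $k$-Vertex Cover: given a graph $G$, a capacity function $c:V(G)\to\mathbb N$ and an integer $k$ (parameter), decide whether $G$ has a capacitated vertex cover of size at most $k$, i.e. a vertex cover $X$ admitting a map $\rho:E(G)\to X$ assigning each edge to one of its endpoints in $X$ such that $|\rho^{-1}(x)|\le c(x)$ for all $x\in X$. A kernel is a polynomial-time algorithm mapping an instance $(x,k)$ to an equivalent instance of the same problem of size bounded by a function of $k$. Twin-width: a trigraph has black edges and red edges (disjoint); a graph is a trigraph with no red edges. Contracting two distinct vertices $u,v$ replaces them by a new vertex $z$; vertices adjacent (by any edge) to exactly one of $u,v$ become joined to $z$ by a red edge; a common neighbour $x$ is joined to $z$ by a black edge if $ux,vx$ are both black and by a red edge otherwise; other edges unchanged. A $d$-sequence of an $n$-vertex trigraph $G$ is a sequence $G=G_n,\dots,G_1$ of trigraphs, each obtained from the previous by one contraction, in which every trigraph has red degree at most $d$. The twin-width of $G$ is the least $d$ for which a $d$-sequence exists. *)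

theory Defs
  imports
    Complex_Main
    "HOL-Library.Discrete_Functions"
    "HOL-Library.Landau_Symbols"
    "HOL-Computational_Algebra.Polynomial"
begin

section \<open>Graphs, trigraphs and twin-width\<close>

record 'a trigraph =
  verts :: "'a set"
  black :: "'a set set"
  red :: "'a set set"

definition is_trigraph :: "'a trigraph \<Rightarrow> bool" where
  "is_trigraph T \<longleftrightarrow>
     finite (verts T) \<and>
     (\<forall>e \<in> black T \<union> red T. e \<subseteq> verts T \<and> card e = 2) \<and>
     black T \<inter> red T = {}"

definition is_graph :: "'a trigraph \<Rightarrow> bool" where
  "is_graph G \<longleftrightarrow> is_trigraph G \<and> red G = {}"

definition adjacent :: "'a trigraph \<Rightarrow> 'a \<Rightarrow> 'a \<Rightarrow> bool" where
  "adjacent T x y \<longleftrightarrow> {x, y} \<in> black T \<union> red T"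

definition contract :: "'a trigraph \<Rightarrow> 'a \<Rightarrow> 'a \<Rightarrow> 'a \<Rightarrow> 'a trigraph" where
  "contract T u v z =
     \<lparr> verts = insert z (verts T - {u, v}),
       black = {e \<in> black T. u \<notin> e \<and> v \<notin> e} \<union>
               {{x, z} | x. x \<in> verts T - {u, v} \<and> {u, x} \<in> black T \<and> {v, x} \<in> black T},
       red = {e \<in> red T. u \<notin> e \<and> v \<notin> e} \<union>
             {{x, z} | x. x \<in> verts T - {u, v} \<and>
                (adjacent T u x \<noteq> adjacent T v x \<or>
                 adjacent T u x \<and> adjacent T v x \<and>
                 \<not> ({u, x} \<in> black T \<and> {v, x} \<in> black T))} \<rparr>"

text \<open>The name \<open>z\<close> of the new vertex may be any one not used by a remaining vertex; it may
  be \<open>u\<close> or \<open>v\<close>, so that sequences of contractions exist over finite types as well.\<close>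

definition contraction :: "'a trigraph \<Rightarrow> 'a trigraph \<Rightarrow> bool" where
  "contraction T T' \<longleftrightarrow>
     (\<exists>u v z. u \<in> verts T \<and> v \<in> verts T \<and> u \<noteq> v \<and> z \<notin> verts T - {u, v} \<and>
              T' = contract T u v z)"

definition red_degree :: "'a trigraph \<Rightarrow> 'a \<Rightarrow> nat" where
  "red_degree T x = card {e \<in> red T. x \<in> e}"

text \<open>On a nonempty graph a sequence can only end in a single vertex; \<open>\<le> 1\<close> instead of
  \<open>= 1\<close> gives the graph without vertices twin-width 0.\<close>

definition d_sequence :: "nat \<Rightarrow> 'a trigraph \<Rightarrow> 'a trigraph list \<Rightarrow> bool" where
  "d_sequence d G Ts \<longleftrightarrow>
     Ts \<noteq> [] \<and> hd Ts = G \<and> card (verts (last Ts)) \<le> 1 \<and>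
     (\<forall>i. Suc i < length Ts \<longrightarrow> contraction (Ts ! i) (Ts ! Suc i)) \<and>
     (\<forall>T \<in> set Ts. \<forall>x \<in> verts T. red_degree T x \<le> d)"

definition twin_width :: "'a trigraph \<Rightarrow> nat" where
  "twin_width G = (LEAST d. \<exists>Ts. d_sequence d G Ts)"


section \<open>The two vertex cover problems\<close>

definition vertex_cover :: "'a trigraph \<Rightarrow> 'a set \<Rightarrow> bool" where
  "vertex_cover G S \<longleftrightarrow> S \<subseteq> verts G \<and> (\<forall>e \<in> black G. e \<inter> S \<noteq> {})"

definition induced :: "'a trigraph \<Rightarrow> 'a set \<Rightarrow> 'a trigraph" where
  "induced G S = \<lparr> verts = S, black = {e \<in> black G. e \<subseteq> S}, red = {e \<in> red G. e \<subseteq> S} \<rparr>"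

text \<open>The graph without vertices counts as connected; this only matters for edgeless graphs,
  for which the empty set is a connected vertex cover.\<close>

definition connected_graph :: "'a trigraph \<Rightarrow> bool" where
  "connected_graph G \<longleftrightarrow>
     (\<forall>x \<in> verts G. \<forall>y \<in> verts G. (x, y) \<in> {(a, b). {a, b} \<in> black G}\<^sup>*)"

definition connected_vertex_cover :: "'a trigraph \<Rightarrow> 'a set \<Rightarrow> bool" where
  "connected_vertex_cover G S \<longleftrightarrow> vertex_cover G S \<and> connected_graph (induced G S)"

definition capacitated_vertex_cover :: "'a trigraph \<Rightarrow> ('a \<Rightarrow> nat) \<Rightarrow> 'a set \<Rightarrow> bool" where
  "capacitated_vertex_cover G c X \<longleftrightarrow>
     vertex_cover G X \<and>
     (\<exists>\<rho>. (\<forall>e \<in> black G. \<rho> e \<in> e \<inter> X) \<and>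
          (\<forall>x \<in> X. card {e \<in> black G. \<rho> e = x} \<le> c x))"

text \<open>Instances are pairs of an object and the parameter \<open>k\<close>. The vertices of an input graph
  are numbered consecutively from 0, as usual for graphs given to an algorithm.\<close>

definition input_graphs :: "int \<Rightarrow> nat trigraph set" where
  "input_graphs d = {G. is_graph G \<and> (\<exists>n. verts G = {..<n}) \<and> int (twin_width G) \<le> d}"

definition connected_instances :: "int \<Rightarrow> (nat trigraph \<times> nat) set" where
  "connected_instances d = {(G, k). G \<in> input_graphs d}"

definition Connected_Vertex_Cover :: "(nat trigraph \<times> nat) set" where
  "Connected_Vertex_Cover = {(G, k). \<exists>S. connected_vertex_cover G S \<and> card S \<le> k}"

definition capacitated_instances :: "int \<Rightarrow> ((nat trigraph \<times> (nat \<Rightarrow> nat)) \<times> nat) set" where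
  "capacitated_instances d = {((G, c), k). G \<in> input_graphs d}"

definition Capacitated_Vertex_Cover :: "((nat trigraph \<times> (nat \<Rightarrow> nat)) \<times> nat) set" where
  "Capacitated_Vertex_Cover = {((G, c), k). \<exists>X. capacitated_vertex_cover G c X \<and> card X \<le> k}"


section \<open>Polynomial time\<close>

text \<open>
  The machine model is a random access machine with logarithmic cost (Aho, Hopcroft, Ullman),
  which simulates and is simulated by Turing machines with polynomial overhead. Programs are
  structured, and the memory consists of arrays \<open>0, 1, 2, \<dots>\<close> of natural numbers; a program
  accesses the finitely many arrays named in its text, at computed indices. Every number that
  is computed, used as an address or read is charged its length in binary.
\<close>

definition bits :: "nat \<Rightarrow> nat" where
  "bits n = Suc (floor_log n)"

type_synonym memory = "nat \<Rightarrow> nat \<Rightarrow> nat"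

datatype expr =
    Const nat
  | Read nat expr
  | Plus expr expr
  | Monus expr expr
  | Times expr expr

primrec val :: "memory \<Rightarrow> expr \<Rightarrow> nat" where
  "val s (Const m) = m"
| "val s (Read a e) = s a (val s e)"
| "val s (Plus e1 e2) = val s e1 + val s e2"
| "val s (Monus e1 e2) = val s e1 - val s e2"
| "val s (Times e1 e2) = val s e1 * val s e2"

primrec cost :: "memory \<Rightarrow> expr \<Rightarrow> nat" where
  "cost s (Const m) = bits m"
| "cost s (Read a e) = cost s e + bits (val s (Read a e))"
| "cost s (Plus e1 e2) = cost s e1 + cost s e2 + bits (val s (Plus e1 e2))"
| "cost s (Monus e1 e2) = cost s e1 + cost s e2 + bits (val s (Monus e1 e2))"
| "cost s (Times e1 e2) = cost s e1 + cost s e2 + bits (val s (Times e1 e2))"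

datatype prog =
    Skip
  | Write nat expr expr
  | Seq prog prog
  | Cond expr prog prog
  | While expr prog

text \<open>\<open>exec p s t s'\<close>: started in memory \<open>s\<close>, program \<open>p\<close> halts in memory \<open>s'\<close> at cost \<open>t\<close>.
  \<open>Write a e1 e2\<close> stores the value of \<open>e2\<close> in cell \<open>e1\<close> of array \<open>a\<close>; a condition holds if its
  value is nonzero.\<close>

inductive exec :: "prog \<Rightarrow> memory \<Rightarrow> nat \<Rightarrow> memory \<Rightarrow> bool" where
  Skip: "exec Skip s 1 s"
| Write: "exec (Write a e1 e2) s (cost s e1 + cost s e2) (s(a := (s a)(val s e1 := val s e2)))"
| Seq: "exec p1 s t1 s' \<Longrightarrow> exec p2 s' t2 s'' \<Longrightarrow> exec (Seq p1 p2) s (t1 + t2) s''"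
| CondTrue: "val s e \<noteq> 0 \<Longrightarrow> exec p1 s t s' \<Longrightarrow> exec (Cond e p1 p2) s (cost s e + t) s'"
| CondFalse: "val s e = 0 \<Longrightarrow> exec p2 s t s' \<Longrightarrow> exec (Cond e p1 p2) s (cost s e + t) s'"
| WhileTrue: "val s e \<noteq> 0 \<Longrightarrow> exec p s t s' \<Longrightarrow> exec (While e p) s' t' s'' \<Longrightarrow>
    exec (While e p) s (cost s e + t + t') s''"
| WhileFalse: "val s e = 0 \<Longrightarrow> exec (While e p) s (cost s e) s"

inductive_cases exec_SkipE: "exec Skip s t s'"
inductive_cases exec_WriteE: "exec (Write a e1 e2) s t s'"
inductive_cases exec_SeqE: "exec (Seq p1 p2) s t s'"
inductive_cases exec_CondE: "exec (Cond e p1 p2) s t s'"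
inductive_cases exec_WhileE: "exec (While e p) s t s'"

lemma exec_deterministic:
  "exec p s t s' \<Longrightarrow> exec p s u s'' \<Longrightarrow> t = u \<and> s' = s''"
proof (induction arbitrary: u s'' rule: exec.induct)
  case (Skip s)
  from Skip.prems show ?case by (rule exec_SkipE) simp
next
  case (Write a e1 e2 s)
  from Write.prems show ?case by (rule exec_WriteE) (rule conjI; rule sym; assumption)
next
  case (Seq p1 s t1 s1 p2 t2 s2)
  from Seq.prems obtain u1 r u2 where
    r: "exec p1 s u1 r" "exec p2 r u2 s''" and u: "u = u1 + u2"
    by (rule exec_SeqE)
  have 1: "t1 = u1 \<and> s1 = r" using r(1) by (rule Seq.IH(1))
  have "exec p2 s1 u2 s''" using r(2) 1 by simp
  then have "t2 = u2 \<and> s2 = s''" by (rule Seq.IH(2))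
  with 1 u show ?case by simp
next
  case (CondTrue s e p1 t s1 p2)
  obtain u1 where
    r: "exec p1 s u1 s''" and u: "u = cost s e + u1"
    using CondTrue.prems CondTrue.hyps(1) by (cases rule: exec_CondE) auto
  have "t = u1 \<and> s1 = s''" using r by (rule CondTrue.IH)
  with u show ?case by simp
next
  case (CondFalse s e p2 t s1 p1)
  obtain u1 where
    r: "exec p2 s u1 s''" and u: "u = cost s e + u1"
    using CondFalse.prems CondFalse.hyps(1) by (cases rule: exec_CondE) auto
  have "t = u1 \<and> s1 = s''" using r by (rule CondFalse.IH)
  with u show ?case by simp
next
  case (WhileTrue s e p t s1 t' s2)
  obtain u1 r u2 where
    r: "exec p s u1 r" "exec (While e p) r u2 s''" and u: "u = cost s e + u1 + u2"
    using WhileTrue.prems WhileTrue.hyps(1) by (cases rule: exec_WhileE) auto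
  have 1: "t = u1 \<and> s1 = r" using r(1) by (rule WhileTrue.IH(1))
  have "exec (While e p) s1 u2 s''" using r(2) 1 by simp
  then have "t' = u2 \<and> s2 = s''" by (rule WhileTrue.IH(2))
  with 1 u show ?case by simp
next
  case (WhileFalse s e p)
  from WhileFalse.prems WhileFalse.hyps(1) show ?case
    by (cases rule: exec_WhileE) auto
qed

definition list_size_bits :: "nat list \<Rightarrow> nat" where
  "list_size_bits xs = (\<Sum>x\<leftarrow>xs. bits x)"

definition array_holds :: "(nat \<Rightarrow> nat) \<Rightarrow> nat list \<Rightarrow> bool" where
  "array_holds f xs \<longleftrightarrow> f 0 = length xs \<and> (\<forall>i < length xs. f (Suc i) = xs ! i)"

text \<open>The input is placed in array 0, all other memory cells being 0, and the output is read off
  array 1. The running time includes the length of the output, since output cells holding 0 need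
  not have been written by the program.\<close>

definition input_memory :: "nat list \<Rightarrow> memory" where
  "input_memory xs = (\<lambda>a i. if a = 0 \<and> i \<le> length xs then (length xs # xs) ! i else 0)"

definition computes_in_time :: "prog \<Rightarrow> nat list \<Rightarrow> nat list \<Rightarrow> nat \<Rightarrow> bool" where
  "computes_in_time p xs ys t \<longleftrightarrow>
     (\<exists>u s. exec p (input_memory xs) u s \<and> array_holds (s 1) ys \<and> t = u + list_size_bits ys)"

definition polynomial_time_on :: "'i set \<Rightarrow> ('i \<Rightarrow> nat list) \<Rightarrow> ('i \<Rightarrow> 'i) \<Rightarrow> bool" where
  "polynomial_time_on I enc K \<longleftrightarrow>
     (\<exists>p. \<exists>q :: nat poly. \<forall>x \<in> I. \<exists>t.
        computes_in_time p (enc x) (enc (K x)) t \<and> t \<le> poly q (list_size_bits (enc x)))"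


section \<open>Kernels\<close>

text \<open>\<open>K\<close> is a kernel for the problem with yes-instances \<open>Y\<close>, restricted to the instances \<open>I\<close>.
  Its output is again an instance in \<open>I\<close>.\<close>

definition kernelization :: "('i \<times> nat) set \<Rightarrow> ('i \<times> nat) set \<Rightarrow> ('i \<times> nat \<Rightarrow> nat list) \<Rightarrow>
    ('i \<times> nat \<Rightarrow> 'i \<times> nat) \<Rightarrow> bool" where
  "kernelization I Y enc K \<longleftrightarrow>
     polynomial_time_on I enc K \<and>
     (\<forall>x \<in> I. K x \<in> I \<and> (K x \<in> Y \<longleftrightarrow> x \<in> Y)) \<and>
     (\<exists>h :: nat \<Rightarrow> nat. \<forall>x \<in> I. list_size_bits (enc (K x)) \<le> h (snd x))"

text \<open>A graph is encoded by its number of vertices and its adjacency matrix, row by row.\<close>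

definition encode_graph :: "nat trigraph \<Rightarrow> nat list" where
  "encode_graph G = (let n = card (verts G) in
     n # [if {i, j} \<in> black G then 1 else 0. i \<leftarrow> [0..<n], j \<leftarrow> [0..<n]])"

definition encode_connected :: "nat trigraph \<times> nat \<Rightarrow> nat list" where
  "encode_connected = (\<lambda>(G, k). k # encode_graph G)"

definition encode_capacitated :: "(nat trigraph \<times> (nat \<Rightarrow> nat)) \<times> nat \<Rightarrow> nat list" where
  "encode_capacitated = (\<lambda>((G, c), k). k # encode_graph G @ map c [0..<card (verts G)])"

end

theory Submission
  imports Defs "HOL-Combinatorics.Transposition" "HOL-Real_Asymp.Real_Asymp"
begin

text \<open>
  Call two vertices twins if they have the same neighbourhood. From each twin class the kernel keeps
  the \<open>k + 1\<close> vertices of largest capacity; a cover of size at most \<open>k\<close> can avoid one of them, so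
  it contains their whole neighbourhood, and exchanging twins moves it into the kept vertices. A
  deleted vertex lowers the capacity of its neighbours by 1. With all capacities 0 the same rule
  works for connected covers.

  A graph of twin-width \<open>d\<close> with a vertex cover \<open>S\<close> has \<open>O(|S|)\<close> twin classes: in a contraction
  sequence, stop when two vertices \<open>x, x'\<close> of \<open>S\<close> are merged for the first time. Only a bounded
  number of traces on \<open>S\<close> distinguish \<open>x\<close> from \<open>x'\<close>, and the other traces stay
  distinct when \<open>x\<close> is removed from \<open>S\<close>. Hence an instance that keeps too many vertices is a
  no-instance, and is replaced by a single edge with \<open>k = 0\<close>.
\<close>

section \<open>Neighbourhood complexity of graphs of bounded twin-width\<close>

text \<open>The contraction sequence occurs only in the analysis: the program never computes one,
  and \<open>d\<close> enters it only through the threshold \<open>C\<close>. Counting traces uses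
  both sides of the first contraction that merges two vertices of \<open>X\<close>. Before it, every
  part contains at most one vertex of \<open>X\<close>, so a part with at most \<open>d\<close> red
  neighbours shows at most \<open>2 ^ (d + 1)\<close> traces. After it, the merged part has at most
  \<open>d\<close> red neighbours, and only vertices in these or in the two merged parts can tell
  \<open>x\<close> from \<open>x'\<close>. Passing from \<open>X\<close> to \<open>X - {x}\<close>
  thus costs a constant, and \<open>O(k)\<close> twin classes with at most \<open>k + 1\<close> kept
  vertices each give \<open>O(k^2)\<close>. The kernel must also be bounded in bits and stay within
  the instance class. Capacities are therefore cut off at the number of kept vertices, beyond which
  they have no effect, and twin-width is shown to be monotone under induced subgraphs. Truncation at
  0 in the reduced capacity does no harm: each deleted neighbour of a vertex in a small cover has a
  kept twin outside the cover, whose edge already needs a unit of reduced capacity.\<close>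

inductive reducible :: "nat \<Rightarrow> 'a trigraph \<Rightarrow> bool" for d where
  small: "card (verts T) \<le> 1 \<Longrightarrow> \<forall>x \<in> verts T. red_degree T x \<le> d \<Longrightarrow> reducible d T"
| step: "\<forall>x \<in> verts T. red_degree T x \<le> d \<Longrightarrow> contraction T T' \<Longrightarrow> reducible d T' \<Longrightarrow>
    reducible d T"

lemma reducible_Cons:
  assumes "card (verts (last (T # Ts))) \<le> 1"
    and "\<forall>i. Suc i < length (T # Ts) \<longrightarrow> contraction ((T # Ts) ! i) ((T # Ts) ! Suc i)"
    and "\<forall>T' \<in> set (T # Ts). \<forall>x \<in> verts T'. red_degree T' x \<le> d"
  shows "reducible d T"
  using assms
proof (induction Ts arbitrary: T)
  case Nil
  then show ?case by (auto intro: reducible.small)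
next
  case (Cons T' Ts)
  have "contraction T T'" using Cons.prems(2)[rule_format, of 0] by simp
  moreover have "reducible d T'"
  proof (rule Cons.IH)
    show "\<forall>i. Suc i < length (T' # Ts) \<longrightarrow> contraction ((T' # Ts) ! i) ((T' # Ts) ! Suc i)"
      using Cons.prems(2) by fastforce
  qed (use Cons.prems in auto)
  ultimately show ?case using Cons.prems(3) by (auto intro: reducible.step)
qed

lemma d_sequence_Cons:
  assumes "d_sequence d T' Ts" "contraction T T'" "\<forall>x \<in> verts T. red_degree T x \<le> d"
  shows "d_sequence d T (T # Ts)"
proof -
  have "contraction ((T # Ts) ! i) ((T # Ts) ! Suc i)" if "Suc i < length (T # Ts)" for i
    using assms that by (cases i) (auto simp: d_sequence_def hd_conv_nth)
  then show ?thesis using assms by (auto simp: d_sequence_def)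
qed

text \<open>Replaces the indexed list of trigraphs by an inductive predicate, so that arguments
  along a contraction sequence become rule inductions.\<close>

lemma reducible_iff: "reducible d T \<longleftrightarrow> (\<exists>Ts. d_sequence d T Ts)"
proof
  assume "reducible d T"
  then show "\<exists>Ts. d_sequence d T Ts"
  proof induction
    case (small T)
    then have "d_sequence d T [T]" by (simp add: d_sequence_def)
    then show ?case ..
  next
    case (step T T')
    then show ?case by (blast intro: d_sequence_Cons)
  qed
next
  assume "\<exists>Ts. d_sequence d T Ts"
  then obtain Ts where "d_sequence d T Ts" ..
  then show "reducible d T"
    by (cases Ts) (auto simp: d_sequence_def intro!: reducible_Cons)
qed

lemma reducible_mono: "reducible d T \<Longrightarrow> d \<le> d' \<Longrightarrow> reducible d' T"
proof (induction rule: reducible.induct)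
  case (small T)
  then have "\<forall>x \<in> verts T. red_degree T x \<le> d'" by (blast intro: order_trans)
  with small show ?case by (blast intro: reducible.small)
next
  case (step T T')
  then have "\<forall>x \<in> verts T. red_degree T x \<le> d'" by (blast intro: order_trans)
  with step show ?case by (blast intro: reducible.step)
qed

lemma finite_edges: "is_trigraph T \<Longrightarrow> finite (black T) \<and> finite (red T)"
  by (rule conjI; rule finite_subset[of _ "Pow (verts T)"]) (auto simp: is_trigraph_def)

lemma edge_verts:
  assumes "is_trigraph T" "{x, y} \<in> black T \<or> {x, y} \<in> red T"
  shows "x \<in> verts T \<and> y \<in> verts T \<and> x \<noteq> y"
proof -
  have "{x, y} \<subseteq> verts T" "card {x, y} = 2"
    using assms unfolding is_trigraph_def by blast+
  then show ?thesis by (auto simp: card_2_iff doubleton_eq_iff)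
qed

lemma is_trigraph_contract:
  assumes T: "is_trigraph T" and z: "z \<notin> verts T - {u, v}"
  shows "is_trigraph (contract T u v z)"
proof -
  let ?C = "contract T u v z"
  have cases: "e \<in> black T \<union> red T \<and> u \<notin> e \<and> v \<notin> e \<or> (\<exists>x \<in> verts T - {u, v}. e = {x, z})"
    if "e \<in> black ?C \<union> red ?C" for e
    using that unfolding contract_def by auto
  have "e \<subseteq> verts ?C \<and> card e = 2" if e: "e \<in> black ?C \<union> red ?C" for e
  proof (rule disjE[OF cases[OF e]])
    assume e: "e \<in> black T \<union> red T \<and> u \<notin> e \<and> v \<notin> e"
    then have "e \<subseteq> verts T" "card e = 2" using T unfolding is_trigraph_def by blast+
    with e show ?thesis by (auto simp: contract_def)
  next
    assume "\<exists>x \<in> verts T - {u, v}. e = {x, z}"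
    then obtain x where "x \<in> verts T - {u, v}" "e = {x, z}" by blast
    moreover then have "x \<noteq> z" using z by blast
    ultimately show ?thesis by (simp add: contract_def)
  qed
  moreover have "black ?C \<inter> red ?C = {}"
  proof -
    have "e \<notin> red ?C" if e: "e \<in> black ?C" for e
    proof (cases "\<exists>x \<in> verts T - {u, v}. e = {x, z}")
      case True
      then obtain x where x: "x \<in> verts T - {u, v}" "e = {x, z}" by blast
      have eq: "{x, z} = {y, z} \<longleftrightarrow> x = y" for y by (auto simp: doubleton_eq_iff)
      \<comment> \<open>An old edge through \<open>z\<close> would make \<open>z\<close> a vertex of
        \<open>T\<close>, hence \<open>u\<close> or \<open>v\<close>. So no edge that survives the
        contraction meets \<open>z\<close>, and new edges cannot clash with old ones.\<close>
      have no: "e \<notin> black T \<and> e \<notin> red T \<or> u \<in> e \<or> v \<in> e"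
        using z x edge_verts[OF T, of x z] by blast
      show ?thesis
        using e no eq unfolding x(2) by (auto simp: contract_def adjacent_def)
    next
      case False
      then have "e \<in> black T" using e by (auto simp: contract_def)
      then have "e \<notin> red T" using T by (auto simp: is_trigraph_def)
      then show ?thesis using False by (auto simp: contract_def)
    qed
    then show ?thesis by blast
  qed
  moreover have "finite (verts ?C)"
    using T by (simp add: contract_def is_trigraph_def)
  ultimately show ?thesis unfolding is_trigraph_def by blast
qed

lemma is_trigraph_contraction: "is_trigraph T \<Longrightarrow> contraction T T' \<Longrightarrow> is_trigraph T'"
  by (auto simp: contraction_def is_trigraph_contract)

text \<open>\<open>twin_width\<close> is a \<open>LEAST\<close>, which says nothing without a
  witness. Contracting arbitrary pairs always comes to an end, and the number of red edges bounds
  every red degree on the way.\<close>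

lemma reducible_exists: "is_trigraph T \<Longrightarrow> \<exists>d. reducible d T"
proof (induction "card (verts T)" arbitrary: T rule: less_induct)
  case less
  have deg: "\<forall>x \<in> verts T. red_degree T x \<le> card (red T)"
    using finite_edges[OF less.prems] by (auto simp: red_degree_def intro: card_mono)
  have fin: "finite (verts T)" using less.prems by (simp add: is_trigraph_def)
  show ?case
  proof (cases "card (verts T) \<le> 1")
    case True
    then show ?thesis using deg by (blast intro: reducible.small)
  next
    case False
    then have "2 \<le> card (verts T)" by simp
    then obtain S where "S \<subseteq> verts T" "card S = 2"
      by (meson obtain_subset_with_card_n)
    then obtain u v where uv: "u \<in> verts T" "v \<in> verts T" "u \<noteq> v"
      by (auto simp: card_2_iff)
    \<comment> \<open>The merged vertex reuses the name \<open>u\<close>, so the type need not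
      contain a fresh name.\<close>
    define T' where "T' = contract T u v u"
    have c: "contraction T T'" using uv by (auto simp: contraction_def T'_def)
    have "verts T' \<subseteq> verts T - {v}" using uv by (auto simp: T'_def contract_def)
    then have "card (verts T') < card (verts T)"
      using fin uv by (intro psubset_card_mono) auto
    then obtain d where "reducible d T'"
      using less.hyps is_trigraph_contraction[OF less.prems c] by blast
    then have "reducible (max d (card (red T))) T'" by (rule reducible_mono) simp
    moreover have "\<forall>x \<in> verts T. red_degree T x \<le> max d (card (red T))"
      using deg by (auto simp: le_max_iff_disj)
    ultimately show ?thesis using c by (blast intro: reducible.step)
  qed
qed

lemma twin_width_le_iff:
  assumes "is_trigraph T"
  shows "twin_width T \<le> d \<longleftrightarrow> reducible d T"
proof
  assume "twin_width T \<le> d"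
  moreover have "reducible (twin_width T) T"
    unfolding twin_width_def reducible_iff[symmetric]
    using reducible_exists[OF assms] by (metis LeastI_ex)
  ultimately show "reducible d T" by (rule reducible_mono[rotated])
next
  assume "reducible d T"
  then show "twin_width T \<le> d"
    by (auto simp: twin_width_def reducible_iff[symmetric] intro: Least_le)
qed

section \<open>Coarser trigraphs and monotonicity of twin-width\<close>

text \<open>\<open>T\<close> is read as a quotient of \<open>S\<close>, with \<open>f\<close>
  sending each vertex to its part. A black edge or a non-edge of \<open>T\<close> is valid for all
  pairs across its two parts, a red edge promises nothing, and pairs inside one part are
  unconstrained. Injective maps cover induced subgraphs; maps composed of \<open>merge\<close>
  describe the stages of a contraction sequence.\<close>

definition trigraph_hom :: "('a \<Rightarrow> 'b) \<Rightarrow> 'a trigraph \<Rightarrow> 'b trigraph \<Rightarrow> bool" where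
  "trigraph_hom f S T \<longleftrightarrow> f ` verts S \<subseteq> verts T \<and>
     (\<forall>a \<in> verts S. \<forall>b \<in> verts S. f a \<noteq> f b \<longrightarrow>
        ({f a, f b} \<in> black T \<longrightarrow> {a, b} \<in> black S) \<and>
        ({f a, f b} \<notin> black T \<union> red T \<longrightarrow> {a, b} \<notin> black S \<union> red S))"

lemma edge_contract:
  assumes "is_trigraph T" "z \<notin> verts T - {u, v}" "x \<in> verts T - {u, v}"
  shows "{x, z} \<in> black (contract T u v z) \<longleftrightarrow> {u, x} \<in> black T \<and> {v, x} \<in> black T"
    and "{x, z} \<in> black (contract T u v z) \<union> red (contract T u v z) \<longleftrightarrow>
      adjacent T u x \<or> adjacent T v x"
proof -
  have eq: "{x, z} = {y, z} \<longleftrightarrow> x = y" for y by (auto simp: doubleton_eq_iff)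
  have no: "{x, z} \<notin> black T \<and> {x, z} \<notin> red T \<or> u \<in> {x, z} \<or> v \<in> {x, z}"
    using assms(2) edge_verts[OF assms(1), of x z] by blast
  show "{x, z} \<in> black (contract T u v z) \<longleftrightarrow> {u, x} \<in> black T \<and> {v, x} \<in> black T"
    using eq no assms(3) by (auto simp: contract_def)
  show "{x, z} \<in> black (contract T u v z) \<union> red (contract T u v z) \<longleftrightarrow>
      adjacent T u x \<or> adjacent T v x"
    using eq no assms(3) by (auto simp: contract_def adjacent_def)
qed

lemma edge_contract_other:
  assumes "z \<notin> verts T - {u, v}" "x \<in> verts T - {u, v}" "y \<in> verts T - {u, v}"
  shows "{x, y} \<in> black (contract T u v z) \<longleftrightarrow> {x, y} \<in> black T"
    and "{x, y} \<in> red (contract T u v z) \<longleftrightarrow> {x, y} \<in> red T"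
  using assms by (auto simp: contract_def doubleton_eq_iff)

lemma trigraph_hom_black:
  "trigraph_hom f S T \<Longrightarrow> {f a, f b} \<in> black T \<Longrightarrow> a \<in> verts S \<Longrightarrow> b \<in> verts S \<Longrightarrow> f a \<noteq> f b \<Longrightarrow>
    {a, b} \<in> black S"
  by (simp add: trigraph_hom_def)

lemma trigraph_hom_nonadjacent:
  "trigraph_hom f S T \<Longrightarrow> {f a, f b} \<notin> black T \<union> red T \<Longrightarrow> a \<in> verts S \<Longrightarrow> b \<in> verts S \<Longrightarrow>
    f a \<noteq> f b \<Longrightarrow> {a, b} \<notin> black S"
  by (simp add: trigraph_hom_def)

definition merge :: "'a \<Rightarrow> 'a \<Rightarrow> 'a \<Rightarrow> 'a \<Rightarrow> 'a" where
  "merge u v z x = (if x = u \<or> x = v then z else x)"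

text \<open>A contraction makes an edge at \<open>z\<close> black only if \<open>u\<close> and
  \<open>v\<close> both have it in black, and omits it only if both lack it. All disagreement
  becomes red, where nothing is claimed.\<close>

lemma trigraph_hom_merge:
  assumes "is_trigraph T" "z \<notin> verts T - {u, v}"
  shows "trigraph_hom (merge u v z) T (contract T u v z)"
proof -
  let ?m = "merge u v z"
  have z: "merge u v z x = z \<longleftrightarrow> x = u \<or> x = v" if "x \<in> verts T" for x
    using that assms(2) by (auto simp: merge_def)
  have "({?m a, ?m b} \<in> black (contract T u v z) \<longrightarrow> {a, b} \<in> black T) \<and>
      ({?m a, ?m b} \<notin> black (contract T u v z) \<union> red (contract T u v z) \<longrightarrow>
        {a, b} \<notin> black T \<union> red T)"
    if "a \<in> verts T" "b \<in> verts T" "?m a \<noteq> ?m b" for a b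
  proof -
    have "\<not> (a \<in> {u, v} \<and> b \<in> {u, v})" using \<open>?m a \<noteq> ?m b\<close> by (auto simp: merge_def)
    then consider "a \<notin> {u, v}" "b \<notin> {u, v}" | "a \<in> {u, v}" "b \<notin> {u, v}"
      | "a \<notin> {u, v}" "b \<in> {u, v}"
      by blast
    then show ?thesis
    proof cases
      case 1
      then show ?thesis using that edge_contract_other[OF assms(2), of a b] by (simp add: merge_def)
    next
      case 2
      have m: "?m a = z" "?m b = b" using 2 by (auto simp: merge_def)
      have "b \<in> verts T - {u, v}" using 2 that by auto
      note E = edge_contract[OF assms this]
      have "({z, b} \<in> black (contract T u v z) \<longrightarrow> {a, b} \<in> black T) \<and>
         ({z, b} \<notin> black (contract T u v z) \<union> red (contract T u v z) \<longrightarrow> {a, b} \<notin> black T \<union> red T)"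
        using 2 E unfolding insert_commute[of z b] by (auto simp: adjacent_def)
      then show ?thesis unfolding m .
    next
      case 3
      have m: "?m a = a" "?m b = z" using 3 by (auto simp: merge_def)
      have "a \<in> verts T - {u, v}" using 3 that by auto
      note E = edge_contract[OF assms this]
      have "({a, z} \<in> black (contract T u v z) \<longrightarrow> {b, a} \<in> black T) \<and>
         ({a, z} \<notin> black (contract T u v z) \<union> red (contract T u v z) \<longrightarrow> {b, a} \<notin> black T \<union> red T)"
        using 3 E by (auto simp: adjacent_def)
      then show ?thesis unfolding m by (simp add: insert_commute)
    qed
  qed
  moreover have "?m ` verts T \<subseteq> verts (contract T u v z)"
    by (auto simp: merge_def contract_def)
  ultimately show ?thesis by (auto simp: trigraph_hom_def)
qed

lemma trigraph_hom_comp: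
  assumes "trigraph_hom f R S" "trigraph_hom g S T"
  shows "trigraph_hom (g \<circ> f) R T"
proof -
  have "({g (f a), g (f b)} \<in> black T \<longrightarrow> {a, b} \<in> black R) \<and>
        ({g (f a), g (f b)} \<notin> black T \<union> red T \<longrightarrow> {a, b} \<notin> black R \<union> red R)"
    if "a \<in> verts R" "b \<in> verts R" "g (f a) \<noteq> g (f b)" for a b
  proof -
    have "f a \<noteq> f b" "f a \<in> verts S" "f b \<in> verts S"
      using that assms(1) by (auto simp: trigraph_hom_def)
    with assms that show ?thesis unfolding trigraph_hom_def by metis
  qed
  moreover
  have "(g \<circ> f) ` verts R \<subseteq> verts T" using assms unfolding trigraph_hom_def by fastforce
  ultimately show ?thesis by (simp add: trigraph_hom_def)
qed

text \<open>The image of a red edge can be neither black nor missing in \<open>T\<close>, since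
  either would fix the status of the pair in \<open>S\<close>. So it is red, and injectivity keeps
  the images apart.\<close>

lemma red_degree_hom:
  assumes "trigraph_hom h S T" "inj_on h (verts S)" "is_trigraph S" "is_trigraph T" "x \<in> verts S"
  shows "red_degree S x \<le> red_degree T (h x)"
  unfolding red_degree_def
proof (rule card_inj_on_le[where f = "\<lambda>e. h ` e"])
  show "inj_on ((`) h) {e \<in> red S. x \<in> e}"
    using assms(2,3) by (intro inj_onI) (auto simp: is_trigraph_def inj_on_image_eq_iff)
  show "finite {e \<in> red T. h x \<in> e}" using finite_edges[OF assms(4)] by simp
  show "(`) h ` {e \<in> red S. x \<in> e} \<subseteq> {e \<in> red T. h x \<in> e}"
  proof clarify
    fix e assume e: "e \<in> red S" "x \<in> e"
    with assms(3) have "e \<subseteq> verts S" "card e = 2" by (auto simp: is_trigraph_def)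
    then obtain a b where ab: "e = {a, b}" "a \<noteq> b" "a \<in> verts S" "b \<in> verts S"
      by (auto simp: card_2_iff)
    then have "h a \<noteq> h b" using assms(2) by (auto simp: inj_on_def)
    moreover have "{a, b} \<notin> black S" using e ab assms(3) by (auto simp: is_trigraph_def)
    ultimately have "{h a, h b} \<in> red T"
      using assms(1) ab e unfolding trigraph_hom_def by blast
    then show "h ` e \<in> red T \<and> h x \<in> h ` e" using ab e by auto
  qed
qed

text \<open>A contraction of \<open>T\<close> whose two vertices both come from \<open>S\<close> can
  be replayed in \<open>S\<close>. The new vertex of \<open>S\<close> keeps the name
  \<open>a\<close> and is now sent to \<open>z\<close>.\<close>

lemma trigraph_hom_contract_both:
  assumes "trigraph_hom h S T" "inj_on h (verts S)" "is_trigraph S" "is_trigraph T"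
    and "a \<in> verts S" "b \<in> verts S" "a \<noteq> b" "z \<notin> verts T - {h a, h b}"
  shows "trigraph_hom (h(a := z)) (contract S a b a) (contract T (h a) (h b) z)"
    and "inj_on (h(a := z)) (verts (contract S a b a))"
proof -
  let ?h = "h(a := z)" and ?S = "contract S a b a" and ?T = "contract T (h a) (h b) z"
  have V: "verts ?S = insert a (verts S - {a, b})" by (simp add: contract_def)
  have im: "h x \<in> verts T - {h a, h b}" if "x \<in> verts S - {a, b}" for x
    using that assms by (auto simp: trigraph_hom_def inj_on_def)
  have neq: "h a \<noteq> h b" using assms by (auto simp: inj_on_def)
  show inj: "inj_on ?h (verts ?S)"
  proof (rule inj_onI)
    fix x y assume "x \<in> verts ?S" "y \<in> verts ?S" "?h x = ?h y"
    then show "x = y"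
      using im assms(2,8) unfolding V
      by (cases "x = a"; cases "y = a") (auto simp: inj_on_def)
  qed
  have homD: "{h x, h y} \<in> black T \<longrightarrow> {x, y} \<in> black S"
    "{h x, h y} \<notin> black T \<union> red T \<longrightarrow> {x, y} \<notin> black S \<union> red S"
    if "x \<in> verts S" "y \<in> verts S" "h x \<noteq> h y" for x y
    using assms(1) that by (auto simp: trigraph_hom_def)
  have A: "({h x, z} \<in> black ?T \<longrightarrow> {x, a} \<in> black ?S) \<and>
      ({h x, z} \<notin> black ?T \<union> red ?T \<longrightarrow> {x, a} \<notin> black ?S \<union> red ?S)"
    if "x \<in> verts S - {a, b}" for x
  proof -
    have n: "a \<notin> verts S - {a, b}" by simp
    note ES = edge_contract[OF assms(3) n that]
    note ET = edge_contract[OF assms(4,8) im[OF that]]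
    have "h a \<noteq> h x" "h b \<noteq> h x" "x \<in> verts S" using im[OF that] that by auto
    with homD[of a x] homD[of b x] assms(5,6)
    show ?thesis unfolding ES ET adjacent_def by blast
  qed
  have "({?h x, ?h y} \<in> black ?T \<longrightarrow> {x, y} \<in> black ?S) \<and>
      ({?h x, ?h y} \<notin> black ?T \<union> red ?T \<longrightarrow> {x, y} \<notin> black ?S \<union> red ?S)"
    if xy: "x \<in> verts ?S" "y \<in> verts ?S" "?h x \<noteq> ?h y" for x y
  proof -
    consider "x = a" "y \<in> verts S - {a, b}" | "y = a" "x \<in> verts S - {a, b}"
      | "x \<in> verts S - {a, b}" "y \<in> verts S - {a, b}"
      using xy unfolding V by auto
    then show ?thesis
    proof cases
      case 1
      then have "y \<noteq> a" by auto
      then show ?thesis using A[OF 1(2)] 1 by (simp add: insert_commute)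
    next
      case 2
      then have "x \<noteq> a" by auto
      then show ?thesis using A[OF 2(2)] 2 by simp
    next
      case 3
      then have ne: "x \<noteq> a" "y \<noteq> a" by auto
      have n: "a \<notin> verts S - {a, b}" by simp
      have "h x \<noteq> h y" using xy ne by simp
      with homD[of x y] 3 show ?thesis
        using edge_contract_other[OF assms(8) im[OF 3(1)] im[OF 3(2)]]
          edge_contract_other[OF n 3] ne by auto
    qed
  qed
  moreover have "?h ` verts ?S \<subseteq> verts ?T"
    using im unfolding V by (auto simp: contract_def)
  ultimately show "trigraph_hom ?h ?S ?T" by (simp add: trigraph_hom_def)
qed

text \<open>A sequence for \<open>T\<close> restricts to \<open>S\<close>: a contraction with both
  vertices in the image of \<open>h\<close> is replayed, and any other leaves \<open>S\<close> alone
  and is absorbed into the map.\<close>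

lemma reducible_sub:
  assumes "reducible d T" "trigraph_hom h S T" "inj_on h (verts S)" "is_trigraph S" "is_trigraph T"
  shows "reducible d S"
  using assms
proof (induction arbitrary: S h rule: reducible.induct)
  case (small T)
  have sub: "h ` verts S \<subseteq> verts T" using small.prems by (simp add: trigraph_hom_def)
  have "card (verts S) \<le> card (verts T)"
    using small.prems sub by (intro card_inj_on_le[of h]) (auto simp: is_trigraph_def)
  moreover have "\<forall>x \<in> verts S. red_degree S x \<le> d"
    using red_degree_hom[OF small.prems] small.hyps sub by (meson image_subset_iff order_trans)
  ultimately show ?case using small.hyps by (auto intro: reducible.small)
next
  case (step T T')
  have sub: "h ` verts S \<subseteq> verts T" using step.prems by (simp add: trigraph_hom_def)
  have deg: "\<forall>x \<in> verts S. red_degree S x \<le> d"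
    using red_degree_hom[OF step.prems] step.hyps sub by (meson image_subset_iff order_trans)
  obtain u v z where uvz: "u \<in> verts T" "v \<in> verts T" "u \<noteq> v" "z \<notin> verts T - {u, v}"
    "T' = contract T u v z"
    using step.hyps by (auto simp: contraction_def)
  have tri: "is_trigraph T'" using step by (blast intro: is_trigraph_contraction)
  show ?case
  proof (cases "u \<in> h ` verts S \<and> v \<in> h ` verts S")
    case True
    then obtain a b where ab: "a \<in> verts S" "b \<in> verts S" "u = h a" "v = h b" by blast
    then have ne: "a \<noteq> b" using uvz by auto
    note C = trigraph_hom_contract_both[OF step.prems ab(1,2) ne uvz(4)[unfolded ab]]
    have con: "contraction S (contract S a b a)"
      using ab ne by (auto simp: contraction_def)
    have "reducible d (contract S a b a)"
      using step.IH[OF _ C(2) is_trigraph_contraction[OF step.prems(3) con] tri] C(1)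
      unfolding uvz(5) ab by blast
    then show ?thesis using con deg by (blast intro: reducible.step)
  next
    case False
    have "trigraph_hom (merge u v z \<circ> h) S T'"
      unfolding uvz(5) using step.prems(1)
      by (rule trigraph_hom_comp) (rule trigraph_hom_merge[OF step.prems(4) uvz(4)])
    \<comment> \<open>At most one of \<open>u\<close> and \<open>v\<close> is an image here, and
      \<open>z\<close> is no further vertex of \<open>T\<close>, so merging identifies no two
      images.\<close>
    moreover have "inj_on (merge u v z \<circ> h) (verts S)"
    proof (rule comp_inj_on[OF step.prems(2)])
      show "inj_on (merge u v z) (h ` verts S)"
        using False sub uvz(4) by (intro inj_onI) (auto simp: merge_def split: if_splits)
    qed
    ultimately show ?thesis using step.IH step.prems(3) tri by blast
  qed
qed

section \<open>Traces of neighbourhoods on a vertex set\<close>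

definition nbs :: "'a trigraph \<Rightarrow> 'a \<Rightarrow> 'a set" where
  "nbs G v = {w. {v, w} \<in> black G}"

lemma nbs_subset: "is_graph G \<Longrightarrow> nbs G v \<subseteq> verts G"
  using edge_verts[of G v] by (auto simp: is_graph_def nbs_def)

text \<open>The first factor counts the parts that can separate the two vertices of \<open>X\<close>
  merged first: their own two parts and at most \<open>d\<close> red neighbours of the union. The
  second bounds the traces shown by one part.\<close>

definition class_bound :: "nat \<Rightarrow> nat" where
  "class_bound d = (d + 2) * 2 ^ (d + 1)"

text \<open>A part \<open>f -` {q}\<close> is homogeneous to all but \<open>d\<close> other parts, so its vertices can only
  disagree on the at most \<open>d + 1\<close> vertices of \<open>X\<close> in these parts and in the part itself.\<close>

lemma card_traces_part:
  assumes G: "is_graph G" and T: "is_trigraph T" and f: "trigraph_hom f G T"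
    and X: "X \<subseteq> verts G" "inj_on f X" and q: "q \<in> verts T" "red_degree T q \<le> d"
  shows "card ((\<lambda>v. nbs G v \<inter> X) ` {v \<in> verts G. f v = q}) \<le> 2 ^ (d + 1)"
proof -
  define Q where "Q = insert q {r. {q, r} \<in> red T}"
  define Y where "Y = {x \<in> X. f x \<in> Q}"
  have finX: "finite X" using G X finite_subset by (auto simp: is_graph_def is_trigraph_def)
  have "inj_on (\<lambda>r. {q, r}) {r. {q, r} \<in> red T}"
    by (auto simp: inj_on_def doubleton_eq_iff)
  then have "card {r. {q, r} \<in> red T} = card ((\<lambda>r. {q, r}) ` {r. {q, r} \<in> red T})"
    by (rule card_image[symmetric])
  also have "\<dots> \<le> red_degree T q"
    unfolding red_degree_def using finite_edges[OF T] by (intro card_mono) auto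
  finally have cr: "card {r. {q, r} \<in> red T} \<le> d" using q by simp
  have fr: "finite {r. {q, r} \<in> red T}"
    by (rule finite_subset[of _ "verts T"]) (use T edge_verts[OF T] in \<open>auto simp: is_trigraph_def\<close>)
  have cQ: "card Q \<le> d + 1" "finite Q"
    unfolding Q_def using cr fr card_insert_le_m1[of "d+1" "{r. {q, r} \<in> red T}" q] by auto
  have "card Y \<le> card Q"
    by (rule card_inj_on_le[of f]) (use X cQ in \<open>auto simp: Y_def inj_on_def\<close>)
  then have cY: "card Y \<le> d + 1" "finite Y" using cQ finX by (auto simp: Y_def)
  have same: "w \<in> nbs G v' \<longleftrightarrow> w \<in> nbs G v"
    if "v \<in> verts G" "v' \<in> verts G" "f v = q" "f v' = q" "w \<in> X" "w \<notin> Y" for v v' w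
  proof -
    have w: "w \<in> verts G" "f w \<noteq> q" "{q, f w} \<notin> red T"
      using that X by (auto simp: Y_def Q_def)
    then show ?thesis
    proof (cases "{q, f w} \<in> black T")
      case True
      then show ?thesis
        using trigraph_hom_black[OF f, of v w] trigraph_hom_black[OF f, of v' w] that w
        by (simp add: nbs_def)
    next
      case False
      then have "{q, f w} \<notin> black T \<union> red T" using w by simp
      then show ?thesis
        using trigraph_hom_nonadjacent[OF f, of v w] trigraph_hom_nonadjacent[OF f, of v' w] that w
        by (simp add: nbs_def)
    qed
  qed
  show ?thesis
  proof -
    let ?A = "(\<lambda>v. nbs G v \<inter> X) ` {v \<in> verts G. f v = q}"
    have "card ?A \<le> card (Pow Y)"
    proof (rule card_inj_on_le[of "\<lambda>A. A \<inter> Y"])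
      show "inj_on (\<lambda>A. A \<inter> Y) ?A"
      proof (rule inj_onI)
        fix A B assume "A \<in> ?A" "B \<in> ?A" and eq: "A \<inter> Y = B \<inter> Y"
        then obtain v v' where v: "v \<in> verts G" "v' \<in> verts G" "f v = q" "f v' = q"
          "A = nbs G v \<inter> X" "B = nbs G v' \<inter> X" by auto
        show "A = B" using same[OF v(1-4)] eq v(5,6) by (auto simp: Y_def)
      qed
    qed (use cY in auto)
    also have "\<dots> \<le> 2 ^ (d + 1)" using cY by (simp add: card_Pow power_increasing del: power_Suc)
    finally show ?thesis .
  qed
qed

text \<open>The induction follows the sequence while \<open>f\<close> stays injective on
  \<open>X\<close>. A trigraph with one vertex does not allow this, so some contraction is the first
  to merge two vertices of \<open>X\<close>. The bound on traces per part comes from the trigraph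
  before that contraction, the bound on separating parts from the one after it.\<close>

lemma few_distinguishing_traces:
  assumes "reducible d T" "is_graph G" "is_trigraph T" "trigraph_hom f G T"
    and "X \<subseteq> verts G" "inj_on f X" "2 \<le> card X"
  shows "\<exists>x \<in> X. \<exists>x' \<in> X. x \<noteq> x' \<and>
    card ((\<lambda>v. nbs G v \<inter> X) ` {v \<in> verts G. (x \<in> nbs G v) \<noteq> (x' \<in> nbs G v)}) \<le> class_bound d"
  using assms
proof (induction arbitrary: f rule: reducible.induct)
  case (small T)
  have "card X \<le> card (verts T)"
    by (rule card_inj_on_le[of f]) (use small.prems in \<open>auto simp: trigraph_hom_def is_trigraph_def\<close>)
  with small show ?case by simp
next
  case (step T T')
  obtain u v z where uvz: "u \<in> verts T" "v \<in> verts T" "u \<noteq> v" "z \<notin> verts T - {u, v}"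
    "T' = contract T u v z"
    using step.hyps by (auto simp: contraction_def)
  have tri: "is_trigraph T'" using step by (blast intro: is_trigraph_contraction)
  define f' where "f' = merge u v z \<circ> f"
  have hom: "trigraph_hom f' G T'"
    unfolding uvz(5) f'_def using step.prems(3)
    by (rule trigraph_hom_comp) (rule trigraph_hom_merge[OF step.prems(2) uvz(4)])
  show ?case
  proof (cases "inj_on f' X")
    case True
    then show ?thesis using step.IH step.prems tri hom by blast
  next
    case False
    then obtain x x' where x: "x \<in> X" "x' \<in> X" "x \<noteq> x'" "f' x = f' x'"
      by (auto simp: inj_on_def)
    have xT: "f x \<in> verts T" "f x' \<in> verts T" "f x \<noteq> f x'"
    proof -
      have "x \<in> verts G" "x' \<in> verts G" using x step.prems(4) by auto
      then show "f x \<in> verts T" "f x' \<in> verts T"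
        using step.prems(3) by (auto simp: trigraph_hom_def)
      show "f x \<noteq> f x'" using x inj_onD[OF step.prems(5)] by auto
    qed
    have fx: "{f x, f x'} = {u, v}"
      using x(4) xT uvz by (auto simp: f'_def merge_def split: if_splits)
    have fz: "f' x = z" "f' x' = z" using fx by (auto simp: f'_def merge_def doubleton_eq_iff)
    \<comment> \<open>These are red neighbours after the contraction: a part joined to
      \<open>z\<close> in black or not at all sees \<open>x\<close> and \<open>x'\<close>
      alike.\<close>
    define R where "R = {r \<in> verts T - {u, v}. {z, r} \<in> red T'}"
    have finR: "finite R" using step.prems(2) by (auto simp: R_def is_trigraph_def)
    have "card R \<le> red_degree T' z"
      unfolding red_degree_def
    proof (rule card_inj_on_le[of "\<lambda>r. {z, r}"])
      show "inj_on (\<lambda>r. {z, r}) R" by (auto simp: inj_on_def doubleton_eq_iff)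
    qed (use finite_edges[OF tri] in \<open>auto simp: R_def\<close>)
    also have "\<dots> \<le> d"
    proof -
      have "z \<in> verts T'" by (simp add: uvz contract_def)
      moreover have "\<forall>x \<in> verts T'. red_degree T' x \<le> d"
        using step.hyps(3) by (cases rule: reducible.cases) auto
      ultimately show ?thesis by blast
    qed
    finally have cR: "card R \<le> d" .
    \<comment> \<open>The two merged parts are added because \<open>trigraph_hom\<close> is silent
      about pairs that \<open>f'\<close> sends to the same vertex.\<close>
    define P where "P = {u, v} \<union> R"
    have cP: "card P \<le> d + 2" "finite P" "P \<subseteq> verts T"
      using card_Un_le[of "{u, v}" R] cR finR uvz by (auto simp: P_def R_def)
    let ?tr = "\<lambda>v. nbs G v \<inter> X"
    let ?D = "{y \<in> verts G. (x \<in> nbs G y) \<noteq> (x' \<in> nbs G y)}"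
    have D: "f y \<in> P" if "y \<in> ?D" for y
    proof (rule ccontr)
      assume nP: "f y \<notin> P"
      have y: "y \<in> verts G" "f y \<in> verts T" using that step.prems by (auto simp: trigraph_hom_def)
      have fy: "f' y = f y" "f y \<noteq> z" "{z, f y} \<notin> red T'"
        using nP y uvz by (auto simp: f'_def merge_def P_def R_def)
      have xG: "x \<in> verts G" "x' \<in> verts G" using x step.prems by auto
      have "x \<in> nbs G y \<longleftrightarrow> x' \<in> nbs G y"
      proof (cases "{z, f y} \<in> black T'")
        case True
        then show ?thesis
          using trigraph_hom_black[OF hom, of y x] trigraph_hom_black[OF hom, of y x'] fz fy y xG
          by (simp add: nbs_def insert_commute)
      next
        case False
        then have "{f' y, f' x} \<notin> black T' \<union> red T'" "{f' y, f' x'} \<notin> black T' \<union> red T'"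
          using fz fy by (auto simp: insert_commute)
        moreover have "f' y \<noteq> f' x" "f' y \<noteq> f' x'" using fz fy by auto
        ultimately show ?thesis
          using trigraph_hom_nonadjacent[OF hom, of y x] trigraph_hom_nonadjacent[OF hom, of y x'] y xG
          by (simp add: nbs_def)
      qed
      with that show False by simp
    qed
    have fin: "finite (verts G)" using step.prems by (simp add: is_graph_def is_trigraph_def)
    have "card (?tr ` ?D) \<le> card (\<Union>q \<in> P. ?tr ` {y \<in> verts G. f y = q})"
      by (rule card_mono) (use cP fin D in auto)
    also have "\<dots> \<le> (\<Sum>q \<in> P. card (?tr ` {y \<in> verts G. f y = q}))"
      by (rule card_UN_le) (use cP in auto)
    also have "\<dots> \<le> (\<Sum>q \<in> P. 2 ^ (d + 1))"
    proof (rule sum_mono)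
      fix q assume "q \<in> P"
      then show "card (?tr ` {y \<in> verts G. f y = q}) \<le> 2 ^ (d + 1)"
        using cP step.hyps(1) by (intro card_traces_part[OF step.prems(1-5)]) auto
    qed
    also have "\<dots> = card P * 2 ^ (d + 1)" by simp
    also have "\<dots> \<le> class_bound d"
      unfolding class_bound_def by (rule mult_right_mono) (use cP in auto)
    finally show ?thesis using x by blast
  qed
qed

lemma trigraph_hom_id: "trigraph_hom id T T"
  by (auto simp: trigraph_hom_def)

text \<open>Two traces on \<open>X\<close> that agree on \<open>X - {x}\<close> differ in \<open>x\<close> only, so one of
  them separates \<open>x\<close> from \<open>x'\<close>.\<close>

lemma card_traces:
  assumes "is_graph G" "reducible d G" "X \<subseteq> verts G"
  shows "card ((\<lambda>v. nbs G v \<inter> X) ` verts G) \<le> class_bound d * card X + 1"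
proof -
  have fin: "finite (verts G)" using assms by (simp add: is_graph_def is_trigraph_def)
  have "finite X" using assms(3) fin finite_subset by blast
  then show ?thesis using assms(3)
  proof (induction "card X" arbitrary: X)
    case 0
    then have "(\<lambda>v. nbs G v \<inter> X) ` verts G \<subseteq> {{}}" by auto
    from card_mono[OF _ this] show ?case by simp
  next
    case (Suc n)
    show ?case
    proof (cases "n = 0")
      case True
      have "card ((\<lambda>v. nbs G v \<inter> X) ` verts G) \<le> card (Pow X)"
        using Suc.prems by (intro card_mono) auto
      also have "\<dots> = 2" using True Suc.hyps(2)[symmetric] Suc.prems(1) by (simp add: card_Pow)
      also have "2 \<le> class_bound d * card X + 1"
        using True Suc.hyps(2)[symmetric] by (simp add: class_bound_def Suc_le_eq)
      finally show ?thesis .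
    next
      case False
      then have "2 \<le> card X" using Suc.hyps(2) by simp
      then obtain x x' where x: "x \<in> X" "x' \<in> X" "x \<noteq> x'"
        "card ((\<lambda>v. nbs G v \<inter> X) ` {v \<in> verts G. (x \<in> nbs G v) \<noteq> (x' \<in> nbs G v)}) \<le> class_bound d"
        using few_distinguishing_traces[OF assms(2,1) _ trigraph_hom_id Suc.prems(2) inj_on_id] assms(1)
        unfolding is_graph_def by blast
      let ?V = "(\<lambda>v. nbs G v \<inter> X) ` verts G"
      let ?D = "(\<lambda>v. nbs G v \<inter> X) ` {v \<in> verts G. (x \<in> nbs G v) \<noteq> (x' \<in> nbs G v)}"
      let ?W = "(\<lambda>v. nbs G v \<inter> (X - {x})) ` verts G"
      have "card (?V - ?D) \<le> card ?W"
      proof (rule card_inj_on_le[of "\<lambda>A. A - {x}"])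
        show "inj_on (\<lambda>A. A - {x}) (?V - ?D)"
        proof (rule inj_onI)
          fix A B assume AB: "A \<in> ?V - ?D" "B \<in> ?V - ?D" "A - {x} = B - {x}"
          have "(x \<in> A) = (x' \<in> A)" "(x \<in> B) = (x' \<in> B)" using AB x(1,2) by auto
          moreover have "(x' \<in> A) = (x' \<in> B)" using AB(3) x(3) by blast
          ultimately show "A = B" using AB(3) by blast
        qed
        show "(\<lambda>A. A - {x}) ` (?V - ?D) \<subseteq> ?W" by auto
      qed (use fin in auto)
      moreover have "card ?W \<le> class_bound d * card (X - {x}) + 1"
        by (rule Suc.hyps(1)) (use Suc.prems Suc.hyps(2)[symmetric] x(1) in auto)
      moreover have "card ?V \<le> card (?V - ?D) + card ?D"
      proof -
        have "card ?V = card ((?V - ?D) \<union> ?D)" by (rule arg_cong[of _ _ card]) auto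
        also have "\<dots> \<le> card (?V - ?D) + card ?D" by (rule card_Un_le)
        finally show ?thesis .
      qed
      moreover have "class_bound d * card X = class_bound d * card (X - {x}) + class_bound d"
        unfolding card_Suc_Diff1[OF Suc.prems(1) x(1), symmetric] by (rule trans[OF mult_Suc_right add.commute])
      ultimately show ?thesis using x(4) by linarith
    qed
  qed
qed


section \<open>Deleting twins\<close>

definition map_graph :: "('a \<Rightarrow> 'b) \<Rightarrow> 'a trigraph \<Rightarrow> 'b trigraph" where
  "map_graph h G =
     \<lparr> verts = h ` verts G, black = (\<lambda>e. h ` e) ` black G, red = (\<lambda>e. h ` e) ` red G \<rparr>"

lemma map_graph_simps [simp]:
  "verts (map_graph h G) = h ` verts G"
  "black (map_graph h G) = (\<lambda>e. h ` e) ` black G"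
  "red (map_graph h G) = (\<lambda>e. h ` e) ` red G"
  by (simp_all add: map_graph_def)

lemma induced_simps [simp]:
  "verts (induced G S) = S"
  "black (induced G S) = {e \<in> black G. e \<subseteq> S}"
  "red (induced G S) = {e \<in> red G. e \<subseteq> S}"
  by (simp_all add: induced_def)

lemma is_graphD:
  assumes "is_graph G"
  shows "finite (verts G)" "finite (black G)" "red G = {}" "e \<in> black G \<Longrightarrow> e \<subseteq> verts G"
    "e \<in> black G \<Longrightarrow> card e = 2"
  using assms finite_edges[of G] by (auto simp: is_graph_def is_trigraph_def)

lemma graph_edgeE:
  assumes "is_graph G" "e \<in> black G"
  obtains x y where "e = {x, y}" "x \<noteq> y" "x \<in> verts G" "y \<in> verts G"
proof -
  have "card e = 2" "e \<subseteq> verts G" using is_graphD[OF assms(1)] assms(2) by auto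
  then show thesis using that unfolding card_2_iff by blast
qed

lemma is_graph_map_graph:
  assumes "is_graph G" "inj_on h (verts G)"
  shows "is_graph (map_graph h G)"
proof -
  have "h ` e \<subseteq> h ` verts G \<and> card (h ` e) = 2" if "e \<in> black G" for e
    using is_graphD[OF assms(1)] that assms(2)
    by (simp add: card_image image_mono inj_on_subset)
  then show ?thesis
    using is_graphD[OF assms(1)] by (auto simp: is_graph_def is_trigraph_def)
qed

lemma is_graph_induced: "is_graph G \<Longrightarrow> S \<subseteq> verts G \<Longrightarrow> is_graph (induced G S)"
  by (auto simp: is_graph_def is_trigraph_def intro: finite_subset)

lemma map_graph_edge_iff:
  assumes "is_graph G" "inj_on h (verts G)" "x \<in> verts G" "y \<in> verts G"
  shows "{h x, h y} \<in> black (map_graph h G) \<longleftrightarrow> {x, y} \<in> black G"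
proof -
  have "h ` {x, y} = h ` e \<longleftrightarrow> {x, y} = e" if "e \<in> black G" for e
    using assms is_graphD(4)[OF assms(1) that] by (intro inj_on_image_eq_iff) auto
  then show ?thesis by auto
qed

lemma vertex_cover_map_graph:
  assumes "vertex_cover G S"
  shows "vertex_cover (map_graph h G) (h ` S)"
  using assms unfolding vertex_cover_def by fastforce

lemma connected_vertex_cover_map_graph:
  assumes "connected_vertex_cover G S"
  shows "connected_vertex_cover (map_graph h G) (h ` S)"
proof -
  let ?E = "{(a, b). {a, b} \<in> black (induced G S)}"
  let ?E' = "{(a, b). {a, b} \<in> black (induced (map_graph h G) (h ` S))}"
  have "(h x, h y) \<in> ?E'\<^sup>*" if "(x, y) \<in> ?E\<^sup>*" for x y
    using that
  proof (induction rule: rtrancl_induct)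
    case base
    show ?case by simp
  next
    case (step y z)
    then have "{y, z} \<in> black G" "y \<in> S" "z \<in> S" by auto
    moreover from this(1) have "h ` {y, z} \<in> (\<lambda>e. h ` e) ` black G" by (rule imageI)
    ultimately have "(h y, h z) \<in> ?E'" by simp
    with step.IH show ?case by (rule rtrancl_into_rtrancl)
  qed
  with assms vertex_cover_map_graph[of G S h] show ?thesis
    by (auto simp: connected_vertex_cover_def connected_graph_def)
qed

text \<open>The assignment is pulled back along the inverse of \<open>h\<close>. Asking for an
  inequality between the capacities allows a vertex to be exchanged for a twin of larger
  capacity.\<close>

lemma capacitated_vertex_cover_map_graph:
  assumes "is_graph G" "capacitated_vertex_cover G c X" "inj_on h (verts G)"
    and "\<And>x. x \<in> X \<Longrightarrow> c x \<le> c' (h x)"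
  shows "capacitated_vertex_cover (map_graph h G) c' (h ` X)"
proof -
  obtain \<rho> where X: "vertex_cover G X"
    and \<rho>: "\<And>e. e \<in> black G \<Longrightarrow> \<rho> e \<in> e \<inter> X"
      "\<And>x. x \<in> X \<Longrightarrow> card {e \<in> black G. \<rho> e = x} \<le> c x"
    using assms(2) unfolding capacitated_vertex_cover_def by blast
  define g where "g = inv_into (verts G) h"
  define \<rho>' where "\<rho>' e = h (\<rho> (g ` e))" for e
  have g: "g (h x) = x" if "x \<in> verts G" for x
    using that assms(3) by (simp add: g_def)
  have ge: "g ` h ` e = e" if "e \<in> black G" for e
    using g is_graphD(4)[OF assms(1) that] by (force simp: image_image)
  have "\<rho>' e' \<in> e' \<inter> h ` X" if "e' \<in> black (map_graph h G)" for e'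
    using that \<rho>(1) by (auto simp: \<rho>'_def ge)
  moreover have "card {e' \<in> black (map_graph h G). \<rho>' e' = y} \<le> c' y" if y: "y \<in> h ` X" for y
  proof -
    obtain x where x: "x \<in> X" "y = h x" using y by blast
    have XV: "X \<subseteq> verts G" using X by (simp add: vertex_cover_def)
    have "{e' \<in> black (map_graph h G). \<rho>' e' = y} \<subseteq> (\<lambda>e. h ` e) ` {e \<in> black G. \<rho> e = x}"
    proof clarify
      fix e' assume e': "e' \<in> black (map_graph h G)" "y = \<rho>' e'"
      then obtain e where e: "e \<in> black G" "e' = h ` e" by auto
      then have "h (\<rho> e) = h x" using e' x by (simp add: \<rho>'_def ge)
      then have "\<rho> e = x"
        using \<rho>(1)[OF e(1)] XV x(1) assms(3) by (auto simp: inj_on_def)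
      with e show "e' \<in> (\<lambda>e. h ` e) ` {e \<in> black G. \<rho> e = x}" by blast
    qed
    moreover have fin: "finite {e \<in> black G. \<rho> e = x}" using is_graphD(2)[OF assms(1)] by simp
    ultimately have "card {e' \<in> black (map_graph h G). \<rho>' e' = y} \<le> card {e \<in> black G. \<rho> e = x}"
      by (rule surj_card_le[rotated])
    also have "\<dots> \<le> c' y" using \<rho>(2)[OF x(1)] assms(4)[OF x(1)] x(2) by simp
    finally show ?thesis .
  qed
  ultimately show ?thesis
    using vertex_cover_map_graph[OF X] unfolding capacitated_vertex_cover_def by blast
qed

text \<open>Twins are non-adjacent, since otherwise \<open>v\<close> would be its own neighbour. So
  exchanging them is an automorphism, and exchange arguments for covers reduce to transport along
  it.\<close>

lemma map_graph_transpose_twins: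
  assumes "is_graph G" "u \<in> verts G" "v \<in> verts G" "nbs G u = nbs G v"
  shows "map_graph (Transposition.transpose u v) G = G"
proof -
  let ?t = "Transposition.transpose u v"
  have uv: "{u, v} \<notin> black G"
  proof
    assume "{u, v} \<in> black G"
    then have "v \<in> nbs G u" by (simp add: nbs_def)
    then have "v \<in> nbs G v" unfolding assms(4) .
    then have "{v, v} \<in> black G" unfolding nbs_def mem_Collect_eq .
    then show False using is_graphD(5)[OF assms(1), of "{v, v}"] by simp
  qed
  have sub: "?t ` e \<in> black G" if e: "e \<in> black G" for e
  proof -
    have uvx: "{u, x} \<in> black G \<longleftrightarrow> {v, x} \<in> black G" for x
      using assms(4) by (auto simp: nbs_def)
    have first: "{?t x, y} \<in> black G" if "{x, y} \<in> black G" "y \<noteq> u" "y \<noteq> v" for x y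
    proof -
      have "?t y = y" using that by simp
      moreover have "?t x = v" if "x = u" using that by simp
      moreover have "?t x = u" if "x = v" using that by simp
      moreover have "?t x = x" if "x \<noteq> u" "x \<noteq> v" using that by simp
      ultimately show ?thesis using that(1) uvx[of y] by metis
    qed
    obtain x y where xy: "e = {x, y}" "x \<noteq> y" by (rule graph_edgeE[OF assms(1) e])
    consider "y \<noteq> u" "y \<noteq> v" | "x \<noteq> u" "x \<noteq> v" | "{x, y} = {u, v}"
      using xy(2) by blast
    then have "{?t x, ?t y} \<in> black G"
    proof cases
      case 1
      then show ?thesis using first[of x y] e xy(1) by simp
    next
      case 2
      then show ?thesis using first[of y x] e xy(1) by (simp add: insert_commute)
    next
      case 3
      then show ?thesis using e xy(1) uv by simp
    qed
    then show ?thesis by (simp add: xy(1))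
  qed
  \<comment> \<open>The transposition is an involution, so mapping edges to edges already makes it
    onto the edge set.\<close>
  have inv: "?t ` ?t ` e = e" for e by (simp add: image_image)
  have "(\<lambda>e. ?t ` e) ` black G = black G"
  proof
    show "(\<lambda>e. ?t ` e) ` black G \<subseteq> black G" using sub by blast
    show "black G \<subseteq> (\<lambda>e. ?t ` e) ` black G"
    proof
      fix e assume "e \<in> black G"
      then have "?t ` ?t ` e \<in> (\<lambda>e. ?t ` e) ` black G" using sub by blast
      then show "e \<in> (\<lambda>e. ?t ` e) ` black G" by (simp only: inv)
    qed
  qed
  moreover have "?t ` verts G = verts G" using assms by simp
  moreover have "red G = {}" by (rule is_graphD[OF assms(1)])
  ultimately show ?thesis by (simp add: map_graph_def)
qed

section \<open>Twin classes and exchange of twins\<close>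

text \<open>Capacity, with ties broken in favour of the smaller number, orders each twin class
  linearly. The cardinality of this set is the rank of \<open>v\<close> in its class, counted from
  0.\<close>

definition better_twins :: "nat trigraph \<Rightarrow> (nat \<Rightarrow> nat) \<Rightarrow> nat \<Rightarrow> nat set" where
  "better_twins G c v =
     {u \<in> verts G. nbs G u = nbs G v \<and> (c v < c u \<or> c u = c v \<and> u < v)}"

definition kept :: "nat trigraph \<Rightarrow> (nat \<Rightarrow> nat) \<Rightarrow> nat \<Rightarrow> nat set" where
  "kept G c k = {v \<in> verts G. card (better_twins G c v) \<le> k}"

lemma better_twins_psubset:
  "u \<in> better_twins G c v \<Longrightarrow> better_twins G c u \<subset> better_twins G c v"
  by (auto simp: better_twins_def)

lemma finite_better_twins: "is_graph G \<Longrightarrow> finite (better_twins G c v)"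
  by (auto simp: better_twins_def is_graph_def is_trigraph_def)

lemma kept_subset: "kept G c k \<subseteq> verts G"
  by (auto simp: kept_def)

text \<open>A deleted vertex has more than \<open>k\<close> better twins, so one of them is outside
  \<open>X\<close>. If that one is deleted as well, the argument repeats with its strictly smaller
  set of better twins.\<close>

lemma kept_twin_avoiding:
  assumes "is_graph G" "v \<in> verts G - kept G c k" "finite X" "card X \<le> k"
  shows "\<exists>u \<in> kept G c k - X. nbs G u = nbs G v \<and> c v \<le> c u"
  using assms(2)
proof (induction "card (better_twins G c v)" arbitrary: v rule: less_induct)
  case less
  have "card X < card (better_twins G c v)" using less.prems assms(4) by (auto simp: kept_def)
  then have "\<not> better_twins G c v \<subseteq> X" using assms(3) card_mono leD by blast
  then obtain u where u: "u \<in> better_twins G c v" "u \<notin> X" by blast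
  then have tw: "u \<in> verts G" "nbs G u = nbs G v" "c v \<le> c u" by (auto simp: better_twins_def)
  show ?case
  proof (cases "u \<in> kept G c k")
    case True
    with u tw show ?thesis by blast
  next
    case False
    have "card (better_twins G c u) < card (better_twins G c v)"
      using better_twins_psubset[OF u(1)] finite_better_twins[OF assms(1)] by (rule psubset_card_mono[rotated])
    then obtain w where "w \<in> kept G c k - X" "nbs G w = nbs G u" "c u \<le> c w"
      using less.hyps[of u] False tw(1) by blast
    with tw show ?thesis by auto
  qed
qed

text \<open>Within a twin class the sets of better twins form a strict chain, so a kept vertex is
  determined by its neighbourhood and the number of its better twins.\<close>

lemma card_kept:
  assumes "is_graph G"
  shows "card (kept G c k) \<le> card (nbs G ` verts G) * (k + 1)"
proof -
  let ?f = "\<lambda>v. (nbs G v, card (better_twins G c v))"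
  have "inj_on ?f (kept G c k)"
  proof (rule inj_onI, rule ccontr)
    fix u v assume uv: "u \<in> kept G c k" "v \<in> kept G c k" "?f u = ?f v" "u \<noteq> v"
    then have "u \<in> better_twins G c v \<or> v \<in> better_twins G c u"
      by (auto simp: better_twins_def kept_def)
    then have "card (better_twins G c u) \<noteq> card (better_twins G c v)"
      using better_twins_psubset finite_better_twins[OF assms] psubset_card_mono
      by (metis nless_le)
    with uv show False by simp
  qed
  moreover have "?f ` kept G c k \<subseteq> (nbs G ` verts G) \<times> {..k}" by (auto simp: kept_def)
  moreover have "finite ((nbs G ` verts G) \<times> {..k})" using is_graphD(1)[OF assms] by simp
  ultimately have "card (kept G c k) \<le> card ((nbs G ` verts G) \<times> {..k})"
    by (rule card_inj_on_le)
  then show ?thesis by (simp add: card_cartesian_product)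
qed

text \<open>A vertex outside \<open>S\<close> has all its neighbours in \<open>S\<close>, so its
  neighbourhood equals its trace and \<open>card_traces\<close> applies. The vertices of
  \<open>S\<close> add at most \<open>k\<close> further classes, and each class keeps at most
  \<open>k + 1\<close> vertices.\<close>

lemma card_kept_vertex_cover:
  assumes G: "is_graph G" and d: "twin_width G \<le> d" and S: "vertex_cover G S" "card S \<le> k"
  shows "card (kept G c k) \<le> (class_bound d + 1) * (k + 1)\<^sup>2"
proof -
  have tri: "is_trigraph G" using G by (simp add: is_graph_def)
  have SV: "S \<subseteq> verts G" using S by (simp add: vertex_cover_def)
  have finV: "finite (verts G)" by (rule is_graphD[OF G])
  have sub: "nbs G v \<inter> S = nbs G v" if "v \<notin> S" for v
    using that S(1) by (auto simp: vertex_cover_def nbs_def)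
  have "nbs G ` verts G \<subseteq> nbs G ` S \<union> (\<lambda>v. nbs G v \<inter> S) ` verts G"
  proof
    fix N assume "N \<in> nbs G ` verts G"
    then obtain v where v: "v \<in> verts G" "N = nbs G v" by blast
    show "N \<in> nbs G ` S \<union> (\<lambda>v. nbs G v \<inter> S) ` verts G"
    proof (cases "v \<in> S")
      case False
      then have "N = nbs G v \<inter> S" using v sub by simp
      with v show ?thesis by blast
    qed (use v in blast)
  qed
  moreover have fS: "finite S" using SV finV finite_subset by blast
  ultimately have "card (nbs G ` verts G) \<le> card (nbs G ` S \<union> (\<lambda>v. nbs G v \<inter> S) ` verts G)"
    using finV by (intro card_mono) auto
  also have "\<dots> \<le> card (nbs G ` S) + card ((\<lambda>v. nbs G v \<inter> S) ` verts G)"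
    by (rule card_Un_le)
  also have "\<dots> \<le> card S + (class_bound d * card S + 1)"
    using card_traces[OF G _ SV, of d] twin_width_le_iff[OF tri] d fS
    by (intro add_mono card_image_le) auto
  also have "\<dots> \<le> k + (class_bound d * k + 1)" using S(2) by (intro add_mono mult_left_mono) auto
  also have "\<dots> \<le> (class_bound d + 1) * (k + 1)" by (simp add: algebra_simps)
  finally have "card (nbs G ` verts G) * (k + 1) \<le> (class_bound d + 1) * (k + 1) * (k + 1)"
    by (rule mult_right_mono) simp
  with card_kept[OF G, of c k] show ?thesis
    unfolding power2_eq_square mult.assoc by (rule order_trans)
qed

text \<open>The exchange argument common to both problems: a deleted vertex of the cover is replaced
  by a kept twin outside the cover, which lowers the number of deleted vertices in it.
  \<open>P\<close> stands for being a cover of the required kind with at most \<open>k\<close>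
  vertices.\<close>

lemma cover_within_kept:
  assumes G: "is_graph G" and k: "\<And>X. P X \<Longrightarrow> X \<subseteq> verts G \<and> card X \<le> k"
    and swap: "\<And>X u v. P X \<Longrightarrow> v \<in> X \<Longrightarrow> u \<in> verts G - X \<Longrightarrow> nbs G u = nbs G v \<Longrightarrow> c v \<le> c u \<Longrightarrow>
      P (Transposition.transpose u v ` X)"
    and X: "P X"
  shows "\<exists>X. P X \<and> X \<subseteq> kept G c k"
  using X
proof (induction "card (X - kept G c k)" arbitrary: X rule: less_induct)
  case less
  show ?case
  proof (cases "X \<subseteq> kept G c k")
    case True
    with less.prems show ?thesis by blast
  next
    case False
    then obtain v where v: "v \<in> X" "v \<notin> kept G c k" by blast
    have X: "X \<subseteq> verts G" "card X \<le> k" using k[OF less.prems] by auto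
    have fin: "finite X" using X(1) is_graphD(1)[OF G] finite_subset by blast
    have "v \<in> verts G - kept G c k" using v X by blast
    from kept_twin_avoiding[OF G this fin X(2)] obtain u where
      u: "u \<in> kept G c k - X" "nbs G u = nbs G v" "c v \<le> c u" by blast
    let ?X = "Transposition.transpose u v ` X"
    have P: "P ?X" using swap[OF less.prems v(1) _ u(2,3)] u(1) kept_subset by blast
    have "x \<in> insert u (X - {v})" if x: "x \<in> ?X" for x
    proof -
      obtain y where y: "y \<in> X" "x = Transposition.transpose u v y" using x by blast
      then have "y \<noteq> u" using u(1) by blast
      show ?thesis
      proof (cases "y = v")
        case True
        then have "x = u" using y(2) by simp
        then show ?thesis by simp
      next
        case False
        then have "x = y" using y(2) \<open>y \<noteq> u\<close> by (simp add: Transposition.transpose_def)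
        then show ?thesis using False y(1) by simp
      qed
    qed
    then have "?X \<subseteq> insert u (X - {v})" by (rule subsetI)
    moreover have "Y - kept G c k \<subseteq> (X - kept G c k) - {v}" if "Y \<subseteq> insert u (X - {v})" for Y
      using that u(1) by blast
    ultimately have sub: "?X - kept G c k \<subseteq> (X - kept G c k) - {v}" by blast
    have "card (?X - kept G c k) \<le> card (X - kept G c k - {v})"
      using sub by (rule card_mono[rotated]) (simp add: fin)
    also have "\<dots> < card (X - kept G c k)"
      by (rule card_Diff1_less) (simp_all add: fin v)
    finally have "card (?X - kept G c k) < card (X - kept G c k)" .
    then show ?thesis using P by (rule less.hyps)
  qed
qed

text \<open>A cover of at most \<open>k\<close> vertices misses a kept twin \<open>u\<close> of
  every deleted vertex \<open>v\<close>. The edges at \<open>u\<close> then force the common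
  neighbourhood into \<open>X\<close>, and this covers the edges at \<open>v\<close> too.\<close>

lemma kept_cover:
  assumes G: "is_graph G" and X: "vertex_cover (induced G (kept G c k)) X" "card X \<le> k"
  shows "vertex_cover G X"
    and "v \<in> verts G - kept G c k \<Longrightarrow> nbs G v \<subseteq> X"
    and "v \<in> verts G - kept G c k \<Longrightarrow> \<exists>u \<in> kept G c k - X. nbs G u = nbs G v"
proof -
  let ?K = "kept G c k"
  have XK: "X \<subseteq> ?K" using X(1) by (simp add: vertex_cover_def)
  have fin: "finite X" using XK kept_subset[of G c k] is_graphD(1)[OF G] by (meson finite_subset)
  have twin: "\<exists>u \<in> ?K - X. nbs G u = nbs G v" if "v \<in> verts G - ?K" for v
    using kept_twin_avoiding[OF G that fin X(2)] by blast
  then show "v \<in> verts G - kept G c k \<Longrightarrow> \<exists>u \<in> kept G c k - X. nbs G u = nbs G v" .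
  have cov: "x \<in> X \<or> y \<in> X" if "{x, y} \<in> black G" "x \<in> ?K" "y \<in> ?K" for x y
    using X(1) that by (auto simp: vertex_cover_def)
  have nbs: "nbs G v \<subseteq> X" if v: "v \<in> verts G - ?K" for v
  proof
    fix w assume w: "w \<in> nbs G v"
    obtain u where u: "u \<in> ?K - X" "nbs G u = nbs G v" using twin[OF v] by blast
    have uw: "{u, w} \<in> black G" using w u by (auto simp: nbs_def)
    show "w \<in> X"
    proof (cases "w \<in> ?K")
      case True
      then show ?thesis using cov[OF uw] u by blast
    next
      case False
      \<comment> \<open>This case is contradictory: a deleted \<open>w\<close> would have a kept
        twin \<open>w'\<close> outside \<open>X\<close>, and the kept edge between \<open>u\<close>
        and \<open>w'\<close> would be uncovered.\<close>
      then have "w \<in> verts G - ?K" using w nbs_subset[OF G] by blast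
      then obtain w' where w': "w' \<in> ?K - X" "nbs G w' = nbs G w" using twin by blast
      then have "{u, w'} \<in> black G" using uw by (auto simp: nbs_def insert_commute)
      then show ?thesis using cov[of u w'] u w' by blast
    qed
  qed
  then show "v \<in> verts G - kept G c k \<Longrightarrow> nbs G v \<subseteq> X" .
  have "e \<inter> X \<noteq> {}" if e: "e \<in> black G" for e
  proof -
    obtain x y where xy: "e = {x, y}" "x \<in> verts G" "y \<in> verts G"
      by (rule graph_edgeE[OF G e])
    have "y \<in> nbs G x" "x \<in> nbs G y"
      using e unfolding xy(1) nbs_def by (simp_all add: insert_commute)
    then have "x \<in> X \<or> y \<in> X" using cov[of x y] nbs[of x] nbs[of y] e xy by blast
    then show ?thesis using xy(1) by blast
  qed
  moreover have "X \<subseteq> verts G" using XK kept_subset by blast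
  ultimately show "vertex_cover G X" by (simp add: vertex_cover_def)
qed

lemma inj_on_transpose: "inj_on (Transposition.transpose u v) A"
  by (rule inj_on_subset[of _ UNIV]) auto

lemma vertex_cover_card:
  assumes "is_graph G" "vertex_cover G X"
  shows "finite X" "card (Transposition.transpose u v ` X) = card X"
  using assms is_graphD(1)[OF assms(1)]
  by (auto simp: vertex_cover_def card_image inj_on_transpose intro: finite_subset)

text \<open>Connectivity concerns only the graph induced by the cover, and this graph is the same in
  \<open>G\<close> and in the kernel once the cover consists of kept vertices.\<close>

lemma connected_kernel:
  assumes G: "is_graph G"
  shows "(\<exists>S. connected_vertex_cover (induced G (kept G c k)) S \<and> card S \<le> k) \<longleftrightarrow>
    (\<exists>S. connected_vertex_cover G S \<and> card S \<le> k)"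
proof -
  let ?K = "kept G c k"
  have ind: "induced (induced G ?K) S = induced G S" if "S \<subseteq> ?K" for S
    using that by (auto simp: induced_def)
  show ?thesis
  proof
    assume "\<exists>S. connected_vertex_cover (induced G ?K) S \<and> card S \<le> k"
    then obtain S where S: "vertex_cover (induced G ?K) S" "card S \<le> k"
      "connected_graph (induced (induced G ?K) S)"
      by (auto simp: connected_vertex_cover_def)
    moreover from S have "S \<subseteq> ?K" by (simp add: vertex_cover_def)
    ultimately show "\<exists>S. connected_vertex_cover G S \<and> card S \<le> k"
      using kept_cover(1)[OF G S(1,2)] ind by (auto simp: connected_vertex_cover_def)
  next
    assume "\<exists>S. connected_vertex_cover G S \<and> card S \<le> k"
    then obtain S where S: "connected_vertex_cover G S \<and> card S \<le> k" by blast
    have "\<exists>S. (connected_vertex_cover G S \<and> card S \<le> k) \<and> S \<subseteq> ?K"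
    proof (rule cover_within_kept[where P = "\<lambda>S. connected_vertex_cover G S \<and> card S \<le> k", OF G _ _ S])
      fix X assume "connected_vertex_cover G X \<and> card X \<le> k"
      then show "X \<subseteq> verts G \<and> card X \<le> k"
        by (simp add: connected_vertex_cover_def vertex_cover_def)
    next
      fix X u v
      assume X: "connected_vertex_cover G X \<and> card X \<le> k" and uv: "v \<in> X" "u \<in> verts G - X"
        "nbs G u = nbs G v"
      have VC: "vertex_cover G X" using X by (simp add: connected_vertex_cover_def)
      then have v: "v \<in> verts G" using uv by (auto simp: vertex_cover_def)
      have "connected_vertex_cover (map_graph (Transposition.transpose u v) G)
          (Transposition.transpose u v ` X)"
        using X connected_vertex_cover_map_graph by blast
      then show "connected_vertex_cover G (Transposition.transpose u v ` X) \<and>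
          card (Transposition.transpose u v ` X) \<le> k"
        using map_graph_transpose_twins[OF G _ v uv(3)] uv vertex_cover_card[OF G VC] X by auto
    qed
    then obtain S where S: "connected_vertex_cover G S" "card S \<le> k" "S \<subseteq> ?K" by blast
    have "vertex_cover (induced G ?K) S"
      using S by (auto simp: connected_vertex_cover_def vertex_cover_def)
    then show "\<exists>S. connected_vertex_cover (induced G ?K) S \<and> card S \<le> k"
      using S ind[OF S(3)] by (auto simp: connected_vertex_cover_def)
  qed
qed

text \<open>The edges at deleted vertices have to be assigned to their other ends.\<close>

definition reduced_capacity ::
    "nat trigraph \<Rightarrow> (nat \<Rightarrow> nat) \<Rightarrow> nat \<Rightarrow> nat \<Rightarrow> nat" where
  "reduced_capacity G c k w =
     min (c w - card (nbs G w - kept G c k)) (card (kept G c k))"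

lemma card_edges_at:
  assumes "is_graph G"
  shows "card {e \<in> black G. w \<in> e \<and> Q e} = card {x \<in> nbs G w. Q {w, x}}"
proof -
  have "{e \<in> black G. w \<in> e \<and> Q e} = (\<lambda>x. {w, x}) ` {x \<in> nbs G w. Q {w, x}}"
  proof
    show "{e \<in> black G. w \<in> e \<and> Q e} \<subseteq> (\<lambda>x. {w, x}) ` {x \<in> nbs G w. Q {w, x}}"
    proof clarify
      fix e assume e: "e \<in> black G" "w \<in> e" "Q e"
      obtain x y where xy: "e = {x, y}" by (rule graph_edgeE[OF assms e(1)])
      then obtain z where "e = {w, z}" using e(2) by auto
      then show "e \<in> (\<lambda>x. {w, x}) ` {x \<in> nbs G w. Q {w, x}}" using e by (auto simp: nbs_def)
    qed
  qed (auto simp: nbs_def)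
  moreover have "inj_on (\<lambda>x. {w, x}) A" for A by (auto simp: inj_on_def doubleton_eq_iff)
  ultimately show ?thesis by (simp add: card_image)
qed

text \<open>Kept edges retain their assignment and the other edges go to their end in
  \<open>X\<close>, which adds one edge at \<open>x\<close> per deleted neighbour of
  \<open>x\<close>.\<close>

lemma capacitated_kernel_backward:
  assumes G: "is_graph G" and k: "card X \<le> k"
    and X: "capacitated_vertex_cover (induced G (kept G c k)) (reduced_capacity G c k) X"
  shows "capacitated_vertex_cover G c X"
proof -
  let ?K = "kept G c k" and ?c = "reduced_capacity G c k"
  obtain \<rho> where VC: "vertex_cover (induced G ?K) X"
    and \<rho>: "\<And>e. e \<in> black G \<Longrightarrow> e \<subseteq> ?K \<Longrightarrow> \<rho> e \<in> e \<inter> X"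
      "\<And>x. x \<in> X \<Longrightarrow> card {e \<in> black G. e \<subseteq> ?K \<and> \<rho> e = x} \<le> ?c x"
    using X unfolding capacitated_vertex_cover_def by (auto simp: conj_assoc)
  note kc = kept_cover[OF G VC k]
  have XK: "X \<subseteq> ?K" using VC by (simp add: vertex_cover_def)
  \<comment> \<open>An edge with a deleted end has exactly one end in \<open>X\<close>, because
    \<open>X\<close> covers it and consists of kept vertices; so the choice is forced.\<close>
  define \<rho>' where "\<rho>' e = (if e \<subseteq> ?K then \<rho> e else SOME x. x \<in> e \<inter> X)" for e
  have "(SOME x. x \<in> e \<inter> X) \<in> e \<inter> X" if "e \<in> black G" for e
  proof -
    have "e \<inter> X \<noteq> {}" using that kc(1) by (simp add: vertex_cover_def)
    then have "\<exists>x. x \<in> e \<inter> X" by blast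
    then show ?thesis by (rule someI_ex)
  qed
  then have \<rho>': "\<rho>' e \<in> e \<inter> X" if "e \<in> black G" for e
    using that \<rho>(1) by (auto simp: \<rho>'_def)
  have "card {e \<in> black G. \<rho>' e = x} \<le> c x" if x: "x \<in> X" for x
  proof -
    let ?D = "nbs G x - ?K"
    have finG: "finite (black G)" by (rule is_graphD[OF G])
    have "{e \<in> black G. \<rho>' e = x} \<subseteq>
        {e \<in> black G. e \<subseteq> ?K \<and> \<rho> e = x} \<union> {e \<in> black G. x \<in> e \<and> \<not> e \<subseteq> ?K}"
    proof clarify
      fix e assume e: "e \<in> black G" "x = \<rho>' e" "\<not> (\<rho>' e \<in> e \<and> \<not> e \<subseteq> ?K)"
      with \<rho>'[OF e(1)] have "e \<subseteq> ?K" by blast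
      then show "e \<subseteq> ?K \<and> \<rho> e = \<rho>' e" by (simp add: \<rho>'_def)
    qed
    then have "card {e \<in> black G. \<rho>' e = x} \<le>
        card ({e \<in> black G. e \<subseteq> ?K \<and> \<rho> e = x} \<union> {e \<in> black G. x \<in> e \<and> \<not> e \<subseteq> ?K})"
      using finG by (intro card_mono) auto
    also have "\<dots> \<le> card {e \<in> black G. e \<subseteq> ?K \<and> \<rho> e = x} +
        card {e \<in> black G. x \<in> e \<and> \<not> e \<subseteq> ?K}"
      by (rule card_Un_le)
    \<comment> \<open>Since \<open>x\<close> itself is kept, such an edge is not inside the kept set
      precisely because its other end is deleted.\<close>
    also have "card {e \<in> black G. x \<in> e \<and> \<not> e \<subseteq> ?K} = card ?D"
      unfolding card_edges_at[OF G] using x XK by (intro arg_cong[of _ _ card]) auto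
    finally have le: "card {e \<in> black G. \<rho>' e = x} \<le>
        card {e \<in> black G. e \<subseteq> ?K \<and> \<rho> e = x} + card ?D" .
    show ?thesis
    \<comment> \<open>The subtraction in \<open>reduced_capacity\<close> might have been truncated.
      If \<open>x\<close> has a deleted neighbour, that neighbour has a kept twin \<open>u\<close>
      outside \<open>X\<close>, and the edge between \<open>u\<close> and \<open>x\<close> must be
      assigned to \<open>x\<close>. So the reduced capacity is positive and the subtraction is
      exact.\<close>
    proof (cases "?D = {}")
      case True
      have "card ?D = 0" unfolding True by simp
      then show ?thesis using le \<rho>(2)[OF x] unfolding reduced_capacity_def by linarith
    next
      case False
      then obtain v where v: "v \<in> nbs G x" "v \<notin> ?K" by blast
      then have "v \<in> verts G - ?K" using nbs_subset[OF G] by blast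
      then obtain u where u: "u \<in> ?K - X" "nbs G u = nbs G v" using kc(3) by blast
      then have ux: "{u, x} \<in> black G" using v by (auto simp: nbs_def insert_commute)
      then have "{u, x} \<subseteq> ?K" using u x XK by blast
      with \<rho>(1)[OF ux this] u have "{u, x} \<in> {e \<in> black G. e \<subseteq> ?K \<and> \<rho> e = x}"
        using ux by auto
      then have "{e \<in> black G. e \<subseteq> ?K \<and> \<rho> e = x} \<noteq> {}" by blast
      then have "0 < card {e \<in> black G. e \<subseteq> ?K \<and> \<rho> e = x}"
        using finG by (simp only: card_gt_0_iff) simp
      then show ?thesis using le \<rho>(2)[OF x] unfolding reduced_capacity_def by linarith
    qed
  qed
  then show ?thesis using kc(1) \<rho>' by (auto simp: capacitated_vertex_cover_def)
qed

text \<open>As \<open>X\<close> consists of kept vertices, an edge from \<open>x\<close> to a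
  deleted vertex can only be assigned to \<open>x\<close>. These edges use up what
  \<open>reduced_capacity\<close> subtracts, and the remainder serves the kept edges.\<close>

lemma capacitated_kernel_forward:
  assumes G: "is_graph G" and X: "capacitated_vertex_cover G c X" "X \<subseteq> kept G c k"
  shows "capacitated_vertex_cover (induced G (kept G c k)) (reduced_capacity G c k) X"
proof -
  let ?K = "kept G c k"
  obtain \<rho> where VC: "vertex_cover G X"
    and \<rho>: "\<And>e. e \<in> black G \<Longrightarrow> \<rho> e \<in> e \<inter> X"
      "\<And>x. x \<in> X \<Longrightarrow> card {e \<in> black G. \<rho> e = x} \<le> c x"
    using X(1) unfolding capacitated_vertex_cover_def by blast
  have finG: "finite (black G)" "finite (verts G)" by (rule is_graphD[OF G])+
  have finK: "finite ?K" by (rule finite_subset[OF kept_subset finG(2)])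
  have "card {e \<in> black G. e \<subseteq> ?K \<and> \<rho> e = x} \<le> reduced_capacity G c k x" if x: "x \<in> X" for x
  proof -
    have *: "{e \<in> black G. x \<in> e \<and> \<not> e \<subseteq> ?K} \<subseteq> {e \<in> black G. \<rho> e = x}"
    proof
      fix e assume "e \<in> {e \<in> black G. x \<in> e \<and> \<not> e \<subseteq> ?K}"
      then have e: "e \<in> black G" "x \<in> e" "\<not> e \<subseteq> ?K" by blast+
      then obtain y where y: "y \<in> e" "y \<notin> ?K" by blast
      obtain a b where "e = {a, b}" by (rule graph_edgeE[OF G e(1)])
      then have "e = {x, y}" using e y x X(2) by auto
      then have "\<rho> e = x" using \<rho>(1)[OF e(1)] y X(2) by auto
      with e show "e \<in> {e \<in> black G. \<rho> e = x}" by simp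
    qed
    have "card {e \<in> black G. e \<subseteq> ?K \<and> \<rho> e = x} + card {e \<in> black G. x \<in> e \<and> \<not> e \<subseteq> ?K} =
        card ({e \<in> black G. e \<subseteq> ?K \<and> \<rho> e = x} \<union> {e \<in> black G. x \<in> e \<and> \<not> e \<subseteq> ?K})"
      using finG by (intro card_Un_disjoint[symmetric]) auto
    also have "\<dots> \<le> card {e \<in> black G. \<rho> e = x}"
      using finG * by (intro card_mono) auto
    also have "\<dots> \<le> c x" by (rule \<rho>(2)[OF x])
    also have "card {e \<in> black G. x \<in> e \<and> \<not> e \<subseteq> ?K} = card (nbs G x - ?K)"
      unfolding card_edges_at[OF G] using x X(2) by (intro arg_cong[of _ _ card]) auto
    finally have 1: "card {e \<in> black G. e \<subseteq> ?K \<and> \<rho> e = x} \<le> c x - card (nbs G x - ?K)" by simp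
    \<comment> \<open>The cut-off loses nothing: the kept edges assigned to \<open>x\<close> have
      distinct other ends among the kept vertices.\<close>
    have "card {e \<in> black G. e \<subseteq> ?K \<and> \<rho> e = x} \<le> card {e \<in> black G. x \<in> e \<and> e \<subseteq> ?K}"
      using finG \<rho>(1) by (intro card_mono) auto
    also have "\<dots> \<le> card ?K"
      unfolding card_edges_at[OF G] using finK by (intro card_mono) auto
    finally show ?thesis using 1 by (simp add: reduced_capacity_def)
  qed
  moreover have "vertex_cover (induced G ?K) X"
    using VC X(2) by (auto simp: vertex_cover_def)
  ultimately show ?thesis
    unfolding capacitated_vertex_cover_def using \<rho>(1)
    by (intro conjI exI[of _ \<rho>]) (auto simp: conj_assoc)
qed

lemma capacitated_kernel:
  assumes G: "is_graph G"
  shows "(\<exists>X. capacitated_vertex_cover (induced G (kept G c k)) (reduced_capacity G c k) X \<and>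
      card X \<le> k) \<longleftrightarrow> (\<exists>X. capacitated_vertex_cover G c X \<and> card X \<le> k)"
proof
  assume "\<exists>X. capacitated_vertex_cover (induced G (kept G c k)) (reduced_capacity G c k) X \<and>
      card X \<le> k"
  then show "\<exists>X. capacitated_vertex_cover G c X \<and> card X \<le> k"
    using capacitated_kernel_backward[OF G] by blast
next
  assume "\<exists>X. capacitated_vertex_cover G c X \<and> card X \<le> k"
  then obtain X where X: "capacitated_vertex_cover G c X \<and> card X \<le> k" by blast
  have "\<exists>X. (capacitated_vertex_cover G c X \<and> card X \<le> k) \<and> X \<subseteq> kept G c k"
  proof (rule cover_within_kept[where P = "\<lambda>X. capacitated_vertex_cover G c X \<and> card X \<le> k", OF G _ _ X])
    fix X assume "capacitated_vertex_cover G c X \<and> card X \<le> k"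
    then show "X \<subseteq> verts G \<and> card X \<le> k"
      by (simp add: capacitated_vertex_cover_def vertex_cover_def)
  next
    fix X :: "nat set" and u v :: nat
    let ?t = "Transposition.transpose u v"
    assume X: "capacitated_vertex_cover G c X \<and> card X \<le> k" and uv: "v \<in> X" "u \<in> verts G - X"
      "nbs G u = nbs G v" "c v \<le> c u"
    have VC: "vertex_cover G X" using X by (simp add: capacitated_vertex_cover_def)
    then have v: "v \<in> verts G" using uv by (auto simp: vertex_cover_def)
    \<comment> \<open>\<open>u\<close> is not in \<open>X\<close>, so \<open>v\<close> is the only
      vertex of \<open>X\<close> that moves, and it moves to a twin of at least its
      capacity.\<close>
    have "c x \<le> c (?t x)" if "x \<in> X" for x
      using that uv by (auto simp: Transposition.transpose_def)
    then have "capacitated_vertex_cover (map_graph ?t G) c (?t ` X)"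
      using capacitated_vertex_cover_map_graph[OF G _ inj_on_transpose] X by blast
    then show "capacitated_vertex_cover G c (?t ` X) \<and> card (?t ` X) \<le> k"
      using map_graph_transpose_twins[OF G _ v uv(3)] uv vertex_cover_card[OF G VC] X by auto
  qed
  then show "\<exists>X. capacitated_vertex_cover (induced G (kept G c k)) (reduced_capacity G c k) X \<and>
      card X \<le> k"
    using capacitated_kernel_forward[OF G] by blast
qed


section \<open>Running times of programs with bounded memory\<close>

lemma bits_le_iff:
  assumes "0 < b"
  shows "bits n \<le> b \<longleftrightarrow> n < 2 ^ b"
proof (cases "n = 0")
  case True
  then show ?thesis using assms by (simp add: bits_def)
next
  case False
  show ?thesis
  proof
    assume "bits n \<le> b"
    then have "2 ^ Suc (floor_log n) \<le> (2 ^ b :: nat)"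
      unfolding bits_def by (rule power_increasing) simp
    then show "n < 2 ^ b" using floor_log_exp2_gt[of n] by simp
  next
    assume "n < 2 ^ b"
    moreover have "2 ^ floor_log n \<le> n" using False by (intro floor_log_exp2_le) simp
    ultimately have "2 ^ floor_log n < (2 ^ b :: nat)" by (rule le_less_trans[rotated])
    then have "floor_log n < b" by (rule power_less_imp_less_exp[rotated]) simp
    then show "bits n \<le> b" by (simp add: bits_def)
  qed
qed

lemma bits_pos: "0 < bits n"
  by (simp add: bits_def)

lemma less_two_power_bits: "n < 2 ^ bits n"
  using bits_le_iff[OF bits_pos] by blast

lemma bits_mono: "m \<le> n \<Longrightarrow> bits m \<le> bits n"
  using bits_le_iff[OF bits_pos, of m n] less_two_power_bits[of n] by simp

lemma bits_le_Suc: "bits n \<le> Suc n"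
proof -
  have "n < 2 ^ Suc n" by (rule less_le_trans[OF less_exp]) simp
  then show ?thesis by (simp only: bits_le_iff zero_less_Suc)
qed

lemma bits_add: "bits (m + n) \<le> bits m + bits n"
proof -
  have "Suc m \<le> 2 ^ bits m" "Suc n \<le> 2 ^ bits n"
    using less_two_power_bits[of m] less_two_power_bits[of n] by auto
  then have "Suc m * Suc n \<le> 2 ^ (bits m + bits n)" unfolding power_add by (rule mult_le_mono)
  then have "m + n < 2 ^ (bits m + bits n)" by simp
  then show ?thesis using bits_le_iff[of "bits m + bits n"] bits_pos[of m] by simp
qed

lemma bits_power: "0 < w \<Longrightarrow> bits (m ^ w) \<le> w * bits m"
proof -
  assume w: "0 < w"
  have "m ^ w < (2 ^ bits m) ^ w" using w by (intro power_strict_mono less_two_power_bits) auto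
  then show ?thesis using bits_le_iff[of "w * bits m"] w bits_pos[of m]
    by (simp add: power_mult[symmetric] mult.commute)
qed

text \<open>An exponent: if all cells are at most \<open>M\<close>, the value of \<open>e\<close> is
  at most \<open>M ^ weight e\<close>. Sums are treated like products, because two numbers that are
  at least 2 have a product no smaller than their sum. The length of the value is then at most
  \<open>weight e\<close> times that of \<open>M\<close>.\<close>

primrec weight :: "expr \<Rightarrow> nat" where
  "weight (Const c) = Suc c"
| "weight (Read a e) = 1"
| "weight (Plus e1 e2) = weight e1 + weight e2"
| "weight (Monus e1 e2) = weight e1"
| "weight (Times e1 e2) = weight e1 + weight e2"

primrec expr_cost :: "expr \<Rightarrow> nat" where
  "expr_cost (Const c) = Suc c"
| "expr_cost (Read a e) = expr_cost e + 1"
| "expr_cost (Plus e1 e2) = expr_cost e1 + expr_cost e2 + weight (Plus e1 e2)"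
| "expr_cost (Monus e1 e2) = expr_cost e1 + expr_cost e2 + weight (Monus e1 e2)"
| "expr_cost (Times e1 e2) = expr_cost e1 + expr_cost e2 + weight (Times e1 e2)"

definition bounded :: "nat \<Rightarrow> memory \<Rightarrow> bool" where
  "bounded M s \<longleftrightarrow> (\<forall>a i. s a i \<le> M)"

lemma weight_pos: "0 < weight e"
  by (induction e) auto

lemma add_le_power_add:
  fixes M :: nat
  assumes "2 \<le> M" "x \<le> M ^ v" "y \<le> M ^ w" "0 < v" "0 < w"
  shows "x + y \<le> M ^ (v + w)"
proof -
  have ge: "2 \<le> M ^ u" if "0 < u" for u
    using assms(1) that self_le_power[of M u] by linarith
  have "x + y \<le> M ^ v + M ^ w" using assms by simp
  also have "\<dots> \<le> M ^ v * M ^ w"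
  proof -
    obtain a b where "M ^ v = 2 + a" "M ^ w = 2 + b"
      using ge[OF assms(4)] ge[OF assms(5)] le_Suc_ex by blast
    then show ?thesis by simp
  qed
  finally show ?thesis by (simp add: power_add)
qed

lemma val_le:
  assumes "bounded M s" "2 \<le> M"
  shows "val s e \<le> M ^ weight e"
proof (induction e)
  case (Const c)
  have "c \<le> 2 ^ Suc c" using less_exp[of "Suc c"] by linarith
  also have "\<dots> \<le> M ^ Suc c" using assms(2) by (rule power_mono) simp
  finally show ?case by simp
next
  case (Plus e1 e2)
  then show ?case using add_le_power_add[OF assms(2) _ _ weight_pos weight_pos] by simp
next
  case (Times e1 e2)
  then show ?case by (simp add: power_add mult_le_mono)
qed (use assms in \<open>auto simp: bounded_def\<close>)

lemma cost_le:
  assumes "bounded M s" "2 \<le> M"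
  shows "cost s e \<le> expr_cost e * bits M"
proof (induction e)
  case (Const c)
  have "bits c \<le> Suc c * 1" using bits_le_Suc by simp
  also have "\<dots> \<le> Suc c * bits M" using bits_pos[of M] by (intro mult_left_mono) auto
  finally show ?case by simp
next
  case (Read a e)
  have "bits (val s (Read a e)) \<le> bits M" using assms by (intro bits_mono) (simp add: bounded_def)
  with Read show ?case by simp
next
  case (Plus e1 e2)
  have "bits (val s (Plus e1 e2)) \<le> weight (Plus e1 e2) * bits M"
    using bits_mono[OF val_le[OF assms]] bits_power[OF weight_pos] by (rule order_trans)
  with Plus show ?case by (simp add: algebra_simps)
next
  case (Monus e1 e2)
  have "bits (val s (Monus e1 e2)) \<le> weight (Monus e1 e2) * bits M"
    using bits_mono[OF val_le[OF assms]] bits_power[OF weight_pos] by (rule order_trans)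
  with Monus show ?case by (simp add: algebra_simps)
next
  case (Times e1 e2)
  have "bits (val s (Times e1 e2)) \<le> weight (Times e1 e2) * bits M"
    using bits_mono[OF val_le[OF assms]] bits_power[OF weight_pos] by (rule order_trans)
  with Times show ?case by (simp add: algebra_simps)
qed

text \<open>The cost of one pass through the program text, in units of \<open>bits M\<close>. Both
  branches of a conditional are charged, and a loop is charged once; its iterations are paid for by
  the factor \<open>B ^ j\<close> in \<open>runs\<close>.\<close>

primrec prog_cost :: "prog \<Rightarrow> nat" where
  "prog_cost Skip = 1"
| "prog_cost (Write a e1 e2) = expr_cost e1 + expr_cost e2"
| "prog_cost (Seq p1 p2) = prog_cost p1 + prog_cost p2"
| "prog_cost (Cond e p1 p2) = expr_cost e + prog_cost p1 + prog_cost p2"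
| "prog_cost (While e p) = expr_cost e + prog_cost p"

abbreviation var :: "nat \<Rightarrow> expr" where
  "var v \<equiv> Read v (Const 0)"

abbreviation assign :: "nat \<Rightarrow> expr \<Rightarrow> prog" where
  "assign v e \<equiv> Write v (Const 0) e"

text \<open>The bound \<open>e\<close> is evaluated anew at every test, so loop invariants have to
  record that its value is unchanged.\<close>

definition For :: "nat \<Rightarrow> expr \<Rightarrow> prog \<Rightarrow> prog" where
  "For v e p = Seq (assign v (Const 0))
     (While (Monus e (var v)) (Seq p (assign v (Plus (var v) (Const 1)))))"

definition Sum_Loop :: "nat \<Rightarrow> nat \<Rightarrow> expr \<Rightarrow> expr \<Rightarrow> prog" where
  "Sum_Loop r v e e' = Seq (assign r (Const 0)) (For v e (assign r (Plus (var r) e')))"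

text \<open>\<open>M\<close> bounds all memory cells during the run and \<open>B\<close> exceeds
  every iteration count. With both fixed, a time bound can be read off the program text.\<close>

locale bounded_run =
  fixes M B :: nat
  assumes M: "2 \<le> M" and B: "1 \<le> B"
begin

text \<open>Here \<open>j\<close> is the nesting depth of loops, each of which makes fewer than \<open>B\<close> iterations.\<close>

definition runs :: "nat \<Rightarrow> prog \<Rightarrow> memory \<Rightarrow> (memory \<Rightarrow> bool) \<Rightarrow> bool" where
  "runs j p s Q \<longleftrightarrow>
     (\<exists>t s'. exec p s t s' \<and> t \<le> prog_cost p * B ^ j * bits M \<and> bounded M s' \<and> Q s')"

lemma runs_mono: "runs j p s Q \<Longrightarrow> (\<And>s'. bounded M s' \<Longrightarrow> Q s' \<Longrightarrow> R s') \<Longrightarrow> runs j p s R"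
  unfolding runs_def by blast

lemma le_mult_Bj: "x * y \<le> x * B ^ j * y"
  using B by simp

lemma runs_Write:
  assumes "bounded M s" "val s e2 \<le> M" "Q (s(a := (s a)(val s e1 := val s e2)))"
  shows "runs j (Write a e1 e2) s Q"
proof -
  have "cost s e1 + cost s e2 \<le> prog_cost (Write a e1 e2) * bits M"
    using cost_le[OF assms(1) M] by (simp add: add_mult_distrib add_mono)
  also have "\<dots> \<le> prog_cost (Write a e1 e2) * B ^ j * bits M" by (rule le_mult_Bj)
  finally have "cost s e1 + cost s e2 \<le> prog_cost (Write a e1 e2) * B ^ j * bits M" .
  moreover have "bounded M (s(a := (s a)(val s e1 := val s e2)))"
    using assms by (simp add: bounded_def)
  ultimately show ?thesis using assms(3) exec.Write unfolding runs_def by blast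
qed

lemma runs_Seq:
  assumes "runs j p1 s R" "\<And>s'. bounded M s' \<Longrightarrow> R s' \<Longrightarrow> runs j p2 s' Q"
  shows "runs j (Seq p1 p2) s Q"
proof -
  obtain t1 s1 where 1: "exec p1 s t1 s1" "t1 \<le> prog_cost p1 * B ^ j * bits M" "bounded M s1" "R s1"
    using assms(1) unfolding runs_def by blast
  obtain t2 s2 where 2: "exec p2 s1 t2 s2" "t2 \<le> prog_cost p2 * B ^ j * bits M" "bounded M s2" "Q s2"
    using assms(2)[OF 1(3,4)] unfolding runs_def by blast
  have "t1 + t2 \<le> prog_cost (Seq p1 p2) * B ^ j * bits M"
    using add_mono[OF 1(2) 2(2)] by (simp add: algebra_simps)
  with exec.Seq[OF 1(1) 2(1)] 2 show ?thesis unfolding runs_def by blast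
qed

lemma runs_Seq_Write:
  assumes "bounded M s" "val s e2 \<le> M"
    and "bounded M (s(a := (s a)(val s e1 := val s e2))) \<Longrightarrow>
      runs j p (s(a := (s a)(val s e1 := val s e2))) Q"
  shows "runs j (Seq (Write a e1 e2) p) s Q"
  by (rule runs_Seq[where R = "\<lambda>s'. s' = s(a := (s a)(val s e1 := val s e2))"])
    (use assms runs_Write in auto)

lemma runs_Cond:
  assumes "bounded M s" "val s e \<noteq> 0 \<Longrightarrow> runs j p1 s Q" "val s e = 0 \<Longrightarrow> runs j p2 s Q"
  shows "runs j (Cond e p1 p2) s Q"
proof -
  have c: "cost s e \<le> expr_cost e * B ^ j * bits M"
    using cost_le[OF assms(1) M] le_mult_Bj by (rule order_trans)
  show ?thesis
  proof (cases "val s e = 0")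
    case True
    then obtain t s' where s': "exec p2 s t s'" "t \<le> prog_cost p2 * B ^ j * bits M" "bounded M s'" "Q s'"
      using assms(3) unfolding runs_def by blast
    have "cost s e + t \<le> prog_cost (Cond e p1 p2) * B ^ j * bits M"
      using add_mono[OF c s'(2)] by (simp add: algebra_simps)
    with exec.CondFalse[OF True s'(1)] s' show ?thesis unfolding runs_def by blast
  next
    case False
    then obtain t s' where s': "exec p1 s t s'" "t \<le> prog_cost p1 * B ^ j * bits M" "bounded M s'" "Q s'"
      using assms(2) unfolding runs_def by blast
    have "cost s e + t \<le> prog_cost (Cond e p1 p2) * B ^ j * bits M"
      using add_mono[OF c s'(2)] by (simp add: algebra_simps)
    with exec.CondTrue[OF False s'(1)] s' show ?thesis unfolding runs_def by blast
  qed
qed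

text \<open>Induction on the remaining iterations. The postcondition of the body speaks of the
  memory with the counter already advanced, so the increment is handled once, here. Tests are
  counted separately because there is one more of them than passes.\<close>

lemma exec_For_loop:
  assumes n: "n \<le> M"
    and inv: "\<And>i s. bounded M s \<Longrightarrow> i \<le> n \<Longrightarrow> I i s \<Longrightarrow> s v 0 = i \<and> val s e = n"
    and body: "\<And>i s. bounded M s \<Longrightarrow> i < n \<Longrightarrow> I i s \<Longrightarrow>
      runs j p s (\<lambda>s'. s' v 0 = i \<and> I (Suc i) (s'(v := (s' v)(0 := Suc i))))"
    and s: "bounded M s" "i \<le> n" "I i s"
  shows "\<exists>t s'. exec (While (Monus e (var v)) (Seq p (assign v (Plus (var v) (Const 1))))) s t s' \<and>
    t \<le> (n - i) * (prog_cost (Seq p (assign v (Plus (var v) (Const 1)))) * B ^ j * bits M) +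
      Suc (n - i) * (expr_cost (Monus e (var v)) * bits M) \<and>
    bounded M s' \<and> I n s'"
  using s
proof (induction "n - i" arbitrary: i s)
  case 0
  let ?c = "Monus e (var v)"
  have "i = n" using 0 by simp
  then have v0: "val s ?c = 0" using inv[of s i] 0 by simp
  have "cost s ?c \<le> expr_cost ?c * bits M" by (rule cost_le[OF 0(2) M])
  then show ?case using exec.WhileFalse[OF v0] 0 \<open>i = n\<close> by force
next
  case (Suc m)
  let ?c = "Monus e (var v)" and ?p = "Seq p (assign v (Plus (var v) (Const 1)))"
  have i: "i < n" using Suc.hyps(2) by simp
  have nz: "val s ?c \<noteq> 0" using inv[of s i] Suc.prems i by simp
  have "runs j ?p s (I (Suc i))"
  proof (rule runs_Seq[OF body[OF Suc.prems(1) i Suc.prems(3)]])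
    fix s' assume s': "bounded M s'" "s' v 0 = i \<and> I (Suc i) (s'(v := (s' v)(0 := Suc i)))"
    show "runs j (assign v (Plus (var v) (Const 1))) s' (I (Suc i))"
      by (rule runs_Write) (use s' i n in auto)
  qed
  then obtain t1 s1 where 1: "exec ?p s t1 s1" "t1 \<le> prog_cost ?p * B ^ j * bits M"
    "bounded M s1" "I (Suc i) s1"
    unfolding runs_def by blast
  obtain t2 s2 where 2: "exec (While ?c ?p) s1 t2 s2"
    "t2 \<le> (n - Suc i) * (prog_cost ?p * B ^ j * bits M) + Suc (n - Suc i) * (expr_cost ?c * bits M)"
    "bounded M s2" "I n s2"
    using Suc.hyps(1)[of "Suc i" s1] Suc.hyps(2) 1(3,4) i by force
  have c: "cost s ?c \<le> expr_cost ?c * bits M" by (rule cost_le[OF Suc.prems(1) M])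
  have m: "n - i = Suc (n - Suc i)" using i by simp
  have "cost s ?c + t1 + t2 \<le>
      (n - i) * (prog_cost ?p * B ^ j * bits M) + Suc (n - i) * (expr_cost ?c * bits M)"
    unfolding m using c 1(2) 2(2)[unfolded mult_Suc] unfolding mult_Suc by linarith
  with exec.WhileTrue[OF nz 1(1) 2(1)] 2(3,4) show ?case by blast
qed

lemma runs_For:
  assumes s: "bounded M s" and n: "n < B" "n \<le> M"
    and init: "I 0 (s(v := (s v)(0 := 0)))"
    and inv: "\<And>i s. bounded M s \<Longrightarrow> i \<le> n \<Longrightarrow> I i s \<Longrightarrow> s v 0 = i \<and> val s e = n"
    and body: "\<And>i s. bounded M s \<Longrightarrow> i < n \<Longrightarrow> I i s \<Longrightarrow>
      runs j p s (\<lambda>s'. s' v 0 = i \<and> I (Suc i) (s'(v := (s' v)(0 := Suc i))))"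
    and post: "\<And>s. bounded M s \<Longrightarrow> I n s \<Longrightarrow> Q s"
  shows "runs (Suc j) (For v e p) s Q"
proof -
  let ?c = "Monus e (var v)" and ?p = "Seq p (assign v (Plus (var v) (Const 1)))"
  let ?s = "s(v := (s v)(0 := 0))"
  have bs: "bounded M ?s" using s by (simp add: bounded_def)
  obtain t s' where s': "exec (While ?c ?p) ?s t s'"
    "t \<le> n * (prog_cost ?p * B ^ j * bits M) + Suc n * (expr_cost ?c * bits M)"
    "bounded M s'" "I n s'"
    using exec_For_loop[where I = I, OF n(2) inv body bs le0 init, unfolded minus_nat.diff_0] by blast
  have w: "exec (assign v (Const 0)) s (cost s (Const 0) + cost s (Const 0)) ?s"
    using exec.Write[of v "Const 0" "Const 0" s] by simp
  have 0: "cost s (Const 0) + cost s (Const 0) \<le> prog_cost (assign v (Const 0)) * B ^ Suc j * bits M"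
  proof -
    have "cost s (Const 0) + cost s (Const 0) \<le> prog_cost (assign v (Const 0)) * bits M"
      using cost_le[OF s M, of "Const 0"] by simp
    also have "\<dots> \<le> prog_cost (assign v (Const 0)) * B ^ Suc j * bits M" by (rule le_mult_Bj)
    finally show ?thesis .
  qed
  have "n * (prog_cost ?p * B ^ j * bits M) \<le> B * (prog_cost ?p * B ^ j * bits M)"
    using n(1) by (intro mult_right_mono) auto
  \<comment> \<open>The strict bound \<open>n < B\<close> makes room for the final, failing
    test.\<close>
  moreover have "Suc n * (expr_cost ?c * bits M) \<le> B * (expr_cost ?c * B ^ j * bits M)"
    using n(1) by (intro mult_le_mono le_mult_Bj) auto
  ultimately have "t \<le> B * (prog_cost ?p * B ^ j * bits M) + B * (expr_cost ?c * B ^ j * bits M)"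
    using s'(2) by linarith
  then have "t \<le> prog_cost (While ?c ?p) * B ^ Suc j * bits M"
    by (simp only: prog_cost.simps power_Suc) (simp only: algebra_simps)
  with 0 have "cost s (Const 0) + cost s (Const 0) + t \<le> prog_cost (For v e p) * B ^ Suc j * bits M"
    unfolding For_def prog_cost.simps(3)[of "assign v (Const 0)"] add_mult_distrib by (rule add_mono)
  with exec.Seq[OF w s'(1)] s'(3,4) post show ?thesis unfolding runs_def For_def by blast
qed

text \<open>The summand may be evaluated in any memory that agrees with \<open>s\<close> outside the
  two work arrays. Partial sums never exceed the total, so a single bound on the total keeps all
  writes below \<open>M\<close>.\<close>

lemma runs_Sum_Loop:
  assumes s: "bounded M s" and n: "n < B" "n \<le> M" and rv: "r \<noteq> v"
    and e: "\<And>s'. (\<And>a. a \<noteq> r \<Longrightarrow> a \<noteq> v \<Longrightarrow> s' a = s a) \<Longrightarrow> val s' e = n"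
    and e': "\<And>i s'. i < n \<Longrightarrow> (\<And>a. a \<noteq> r \<Longrightarrow> a \<noteq> v \<Longrightarrow> s' a = s a) \<Longrightarrow> s' v 0 = i \<Longrightarrow> val s' e' = g i"
    and g: "(\<Sum>i<n. g i) \<le> M"
    and post: "\<And>s'. bounded M s' \<Longrightarrow> (\<And>a. a \<noteq> r \<Longrightarrow> a \<noteq> v \<Longrightarrow> s' a = s a) \<Longrightarrow> s' r 0 = (\<Sum>i<n. g i) \<Longrightarrow> Q s'"
  shows "runs (Suc j) (Sum_Loop r v e e') s Q"
  unfolding Sum_Loop_def
proof (rule runs_Seq_Write[OF s])
  let ?I = "\<lambda>i s'. (\<forall>a. a \<noteq> r \<longrightarrow> a \<noteq> v \<longrightarrow> s' a = s a) \<and> s' v 0 = i \<and> s' r 0 = (\<Sum>x<i. g x)"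
  let ?s = "s(r := (s r)(val s (Const 0) := val s (Const 0)))"
  assume b: "bounded M ?s"
  show "runs (Suc j) (For v e (assign r (Plus (var r) e'))) ?s Q"
  proof (rule runs_For[where I = ?I and n = n, OF b n])
    show "?I 0 (?s(v := (?s v)(0 := 0)))" using rv by simp
  next
    fix i s' assume "?I i s'"
    then show "s' v 0 = i \<and> val s' e = n" using e by blast
  next
    fix i s' assume *: "bounded M s'" "i < n" "?I i s'"
    have v: "val s' e' = g i" using e' * by blast
    have "(\<Sum>x<Suc i. g x) \<le> (\<Sum>x<n. g x)" using *(2) by (intro sum_mono2) auto
    then have le: "s' r 0 + g i \<le> M" using * g by simp
    show "runs j (assign r (Plus (var r) e')) s'
        (\<lambda>s''. s'' v 0 = i \<and> ?I (Suc i) (s''(v := (s'' v)(0 := Suc i))))"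
      by (rule runs_Write[OF *(1)]) (use v le rv *(3) in auto)
  next
    fix s' assume "bounded M s'" "?I n s'"
    then show "Q s'" using post by blast
  qed
qed simp

end


section \<open>The kernelization program\<close>

text \<open>Cell 0 of the input array holds the length of the input, so the parameter is in cell 1,
  the number of vertices \<open>n\<close> in cell 2, the matrix starts in cell 3, and the capacities
  follow its \<open>n * n\<close> entries.\<close>

abbreviation size_expr :: expr where
  "size_expr \<equiv> Read 0 (Const 2)"

abbreviation parameter_expr :: expr where
  "parameter_expr \<equiv> Read 0 (Const 1)"

definition adj_expr :: "expr \<Rightarrow> expr \<Rightarrow> expr" where
  "adj_expr x y = Read 0 (Plus (Const 3) (Plus (Times x size_expr) y))"

definition cap_expr :: "expr \<Rightarrow> expr" where
  "cap_expr x = Read 0 (Plus (Const 3) (Plus (Times size_expr size_expr) x))"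

lemma val_adj_expr [simp]:
  "val s (adj_expr x y) = s 0 (3 + (val s x * s 0 2 + val s y))"
  by (simp add: adj_expr_def)

lemma val_cap_expr [simp]: "val s (cap_expr x) = s 0 (3 + (s 0 2 * s 0 2 + val s x))"
  by (simp add: cap_expr_def)

definition positive :: "expr \<Rightarrow> expr" where
  "positive e = Monus (Const 1) (Monus (Const 1) e)"

lemma val_positive [simp]: "val s (positive e) = of_bool (0 < val s e)"
  by (simp add: positive_def)

text \<open>Arrays 2 to 4 hold loop counters and 5 and 6 intermediate results. Array 7 holds the number of
  kept vertices, array 8 lists them, and array 9 marks the deleted vertices.\<close>

definition diff_expr :: expr where
  "diff_expr =
     Plus (Monus (adj_expr (var 2) (var 4)) (adj_expr (var 3) (var 4)))
       (Monus (adj_expr (var 3) (var 4)) (adj_expr (var 2) (var 4)))"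

text \<open>Cell 0 of array 6 counts the positions in which two rows differ, so the first factor
  tests for twins. In the second, 1 is added to the capacity of the vertex with the smaller number,
  which turns the comparison with tie-breaking into one strict inequality.\<close>

definition better_expr :: expr where
  "better_expr =
     Times (Monus (Const 1) (var 6))
       (positive (Monus (Plus (cap_expr (var 3)) (positive (Monus (var 2) (var 3)))) (cap_expr (var 2))))"

definition rank_prog :: prog where
  "rank_prog =
     Seq (assign 5 (Const 0))
       (For 3 size_expr (Seq (Sum_Loop 6 4 size_expr diff_expr) (assign 5 (Plus (var 5) better_expr))))"

text \<open>The vertex is always entered in the list, but the length grows only if it is kept; a
  deleted vertex is overwritten by the next entry or left beyond the end.\<close>

definition mark_prog :: prog where
  "mark_prog =
     Seq (Write 9 (var 2) (positive (Monus (var 5) parameter_expr)))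
      (Seq (Write 8 (var 7) (var 2))
        (assign 7 (Plus (var 7) (Monus (Const 1) (Read 9 (var 2))))))"

definition select_prog :: prog where
  "select_prog = Seq (assign 7 (Const 0)) (For 2 size_expr (Seq rank_prog mark_prog))"

text \<open>The single edge with \<open>k = 0\<close>: two vertices in cell 2, and ones in the
  off-diagonal cells 4 and 5 of the matrix. All zeros, including the \<open>2 * b\<close>
  capacities, are already in place because array 1 is untouched so far.\<close>

definition no_prog :: "nat \<Rightarrow> prog" where
  "no_prog b = Seq (Write 1 (Const 0) (Const (6 + 2 * b))) (Seq (Write 1 (Const 2) (Const 2))
     (Seq (Write 1 (Const 4) (Const 1)) (Write 1 (Const 5) (Const 1))))"

definition matrix_prog :: prog where
  "matrix_prog =
     For 2 (var 7)
       (For 3 (var 7)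
         (Write 1 (Plus (Const 3) (Plus (Times (var 2) (var 7)) (var 3)))
           (adj_expr (Read 8 (var 2)) (Read 8 (var 3)))))"

text \<open>The flag is a factor of the loop bound, so \<open>b = 0\<close> writes nothing. The sum
  counts the deleted neighbours, and \<open>x - (x - m)\<close> computes the minimum of
  \<open>x\<close> and \<open>m\<close>.\<close>

definition capacity_prog :: "nat \<Rightarrow> prog" where
  "capacity_prog b =
     For 2 (Times (Const b) (var 7))
       (Seq (Sum_Loop 5 3 size_expr (Times (adj_expr (Read 8 (var 2)) (var 3)) (Read 9 (var 3))))
       (Seq (assign 6 (Monus (cap_expr (Read 8 (var 2))) (var 5)))
         (Write 1 (Plus (Const 3) (Plus (Times (var 7) (var 7)) (var 2)))
           (Monus (var 6) (Monus (var 6) (var 7))))))"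

definition yes_prog :: "nat \<Rightarrow> prog" where
  "yes_prog b =
     Seq (Write 1 (Const 0) (Plus (Const 2) (Plus (Times (var 7) (var 7)) (Times (Const b) (var 7)))))
    (Seq (Write 1 (Const 1) parameter_expr)
    (Seq (Write 1 (Const 2) (var 7))
    (Seq matrix_prog (capacity_prog b))))"

text \<open>The flag \<open>b\<close> tells whether the instances carry capacities. If not, the capacities are read
  from memory beyond the input, where all cells are 0.\<close>

definition kernel_prog :: "nat \<Rightarrow> nat \<Rightarrow> prog" where
  "kernel_prog C b =
     Seq select_prog
      (Cond (Monus (var 7) (Times (Const C) (Times (Plus parameter_expr (Const 1))
               (Plus parameter_expr (Const 1)))))
        (no_prog b) (yes_prog b))"

section \<open>Correctness and cost of the program\<close>

text \<open>Separates the program from the encoding: \<open>f\<close> is the input array, from which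
  only the parameter, the size, the matrix \<open>A\<close> and the capacities \<open>c\<close> are
  read. The bound \<open>M_ge\<close> leaves room for the length of the output and for the length 8
  of the no-instance with capacities.\<close>

locale kernel_run = bounded_run +
  fixes f :: "nat \<Rightarrow> nat" and k n b :: nat and A :: "nat \<Rightarrow> nat \<Rightarrow> nat" and c :: "nat \<Rightarrow> nat"
  assumes parameter: "f (Suc 0) = k" and size: "f 2 = n"
    and adj: "i < n \<Longrightarrow> j < n \<Longrightarrow> f (3 + (i * n + j)) = A i j"
    and cap: "i < n \<Longrightarrow> f (3 + (n * n + i)) = c i"
    and A_le: "A i j \<le> 1" and n_less: "n < B" and M_ge: "n * n + n + 8 \<le> M" and f_le: "f i \<le> M"
    and b: "b \<le> 1"
begin

definition diff :: "nat \<Rightarrow> nat \<Rightarrow> nat" where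
  "diff i j = (\<Sum>w<n. (A i w - A j w) + (A j w - A i w))"

definition rank :: "nat \<Rightarrow> nat" where
  "rank i = (\<Sum>j<n. (1 - diff i j) * of_bool (0 < c j + of_bool (0 < i - j) - c i))"

definition keep_list :: "nat \<Rightarrow> nat list" where
  "keep_list i = filter (\<lambda>x. rank x \<le> k) [0..<i]"

definition selected :: "nat \<Rightarrow> memory \<Rightarrow> bool" where
  "selected i s \<longleftrightarrow> s 7 0 = length (keep_list i) \<and>
     (\<forall>a < length (keep_list i). s 8 a = keep_list i ! a) \<and>
     (\<forall>x < i. s 9 x = of_bool (k < rank x))"

lemma n_le: "n \<le> M" using M_ge by simp

lemma sum_le_n:
  assumes "\<And>x. x < n \<Longrightarrow> g x \<le> (1::nat)" "i \<le> n"
  shows "sum g {..<i} \<le> n"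
proof -
  have "sum g {..<i} \<le> (\<Sum>x<i. 1)" using assms by (intro sum_mono) auto
  then show ?thesis using assms(2) by simp
qed

lemma diff_le: "diff i j \<le> n"
  unfolding diff_def
proof (rule sum_le_n)
  fix x show "A i x - A j x + (A j x - A i x) \<le> 1" using A_le[of i x] A_le[of j x] by linarith
qed simp

lemma rank_part_le:
  "i' \<le> n \<Longrightarrow> (\<Sum>j<i'. (1 - diff i j) * of_bool (0 < c j + of_bool (0 < i - j) - c i)) \<le> n"
  by (rule sum_le_n) auto

lemma keep_list_Suc: "keep_list (Suc i) = keep_list i @ (if rank i \<le> k then [i] else [])"
  by (simp add: keep_list_def)

lemma length_keep_list: "length (keep_list i) \<le> i"
  unfolding keep_list_def by (rule order_trans[OF length_filter_le]) simp

lemma keep_list_less: "a < length (keep_list i) \<Longrightarrow> keep_list i ! a < i"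
  using nth_mem[of a "keep_list i"] by (auto simp: keep_list_def)

lemma selected_Suc:
  assumes "selected i s" "s' 9 = (s 9)(i := of_bool (k < rank i))" "s' 8 = (s 8)(s 7 0 := i)"
    "s' 7 0 = s 7 0 + (1 - of_bool (k < rank i))"
  shows "selected (Suc i) s'"
  using assms unfolding selected_def
  by (auto simp: keep_list_Suc nth_append less_Suc_eq)

lemma runs_rank:
  assumes s: "bounded M s" "s 0 = f" "s 2 0 = i" "i < n"
  shows "runs (Suc (Suc d)) rank_prog s
    (\<lambda>s'. (\<forall>a. a \<notin> {3, 4, 5, 6} \<longrightarrow> s' a = s a) \<and> s' 5 0 = rank i)"
  unfolding rank_prog_def
proof (rule runs_Seq_Write[OF s(1)])
  let ?s = "s(5 := (s 5)(val s (Const 0) := val s (Const 0)))"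
  let ?g = "\<lambda>j. (1 - diff i j) * of_bool (0 < c j + of_bool (0 < i - j) - c i)"
  let ?I = "\<lambda>j s'. (\<forall>a. a \<notin> {3, 4, 5, 6} \<longrightarrow> s' a = s a) \<and> s' 3 0 = j \<and> s' 5 0 = sum ?g {..<j}"
  let ?body = "Seq (Sum_Loop 6 4 size_expr diff_expr) (assign 5 (Plus (var 5) better_expr))"
  assume b: "bounded M ?s"
  show "runs (Suc (Suc d)) (For 3 size_expr ?body) ?s
      (\<lambda>s'. (\<forall>a. a \<notin> {3, 4, 5, 6} \<longrightarrow> s' a = s a) \<and> s' 5 0 = rank i)"
  proof (rule runs_For[where I = ?I and n = n, OF b n_less n_le])
    show "?I 0 (?s(3 := (?s 3)(0 := 0)))" by simp
  next
    fix j s' assume "?I j s'"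
    then show "s' 3 0 = j \<and> val s' size_expr = n" using s by (simp add: size)
  next
    fix j s2 assume b2: "bounded M s2" and j: "j < n" and I2: "?I j s2"
    have s2: "s2 0 = f" "s2 2 0 = i" "s2 3 0 = j" "s2 5 0 = sum ?g {..<j}"
      using I2 s by auto
    show "runs (Suc d) ?body s2 (\<lambda>s'. s' 3 0 = j \<and> ?I (Suc j) (s'(3 := (s' 3)(0 := Suc j))))"
    proof (rule runs_Seq)
      show "runs (Suc d) (Sum_Loop 6 4 size_expr diff_expr) s2
          (\<lambda>s'. (\<forall>a. a \<noteq> 6 \<longrightarrow> a \<noteq> 4 \<longrightarrow> s' a = s2 a) \<and> s' 6 0 = diff i j)"
      proof (rule runs_Sum_Loop[where g = "\<lambda>w. A i w - A j w + (A j w - A i w)", OF b2 n_less n_le])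
        fix w s' assume w: "w < n" and fr: "\<And>a. a \<noteq> 6 \<Longrightarrow> a \<noteq> 4 \<Longrightarrow> s' a = s2 a"
          and "s' 4 0 = w"
        then show "val s' diff_expr = A i w - A j w + (A j w - A i w)"
          using fr[of 0] fr[of 2] fr[of 3] s2 adj[OF s(4) w] adj[OF j w] size
          by (simp add: diff_expr_def)
      qed (use diff_le[of i j] n_le s2 size in \<open>auto simp: diff_def\<close>)
    next
      fix s3 assume b3: "bounded M s3"
        and s3: "(\<forall>a. a \<noteq> 6 \<longrightarrow> a \<noteq> 4 \<longrightarrow> s3 a = s2 a) \<and> s3 6 0 = diff i j"
      have v: "val s3 (Plus (var 5) better_expr) = sum ?g {..<Suc j}"
        using s3 s2 cap[OF s(4)] cap[OF j] size by (simp add: better_expr_def)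
      also have "\<dots> \<le> M" using rank_part_le[of "Suc j" i] j n_le by simp
      finally have le: "val s3 (Plus (var 5) better_expr) \<le> M" .
      show "runs (Suc d) (assign 5 (Plus (var 5) better_expr)) s3
          (\<lambda>s'. s' 3 0 = j \<and> ?I (Suc j) (s'(3 := (s' 3)(0 := Suc j))))"
        by (rule runs_Write[OF b3 le], unfold v) (use s3 s2 I2 in auto)
    qed
  next
    fix s' assume "?I n s'"
    then show "(\<forall>a. a \<notin> {3, 4, 5, 6} \<longrightarrow> s' a = s a) \<and> s' 5 0 = rank i"
      by (simp add: rank_def)
  qed
qed simp

lemma runs_mark:
  assumes s: "bounded M s" "s 0 = f" "s 1 = (\<lambda>_. 0)" "s 2 0 = i" "s 5 0 = rank i" "selected i s"
    and i: "i < n"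
  shows "runs d mark_prog s
    (\<lambda>s'. s' 0 = f \<and> s' 1 = (\<lambda>_. 0) \<and> s' 2 0 = i \<and> selected (Suc i) s')" (is "runs d _ _ ?Q")
  unfolding mark_prog_def
proof (rule runs_Seq_Write[OF s(1)])
  show "val s (positive (Monus (var 5) parameter_expr)) \<le> M" using M by simp
next
  let ?s1 = "s(9 := (s 9)(i := of_bool (k < rank i)))"
  have m: "s 7 0 \<le> i" using s(6) length_keep_list by (simp add: selected_def)
  have s1: "s(9 := (s 9)(val s (var 2) := val s (positive (Monus (var 5) parameter_expr)))) = ?s1"
    using s parameter by simp
  assume "bounded M (s(9 := (s 9)(val s (var 2) := val s (positive (Monus (var 5) parameter_expr)))))"
  then have b1: "bounded M ?s1" by (simp only: s1)
  show "runs d (Seq (Write 8 (var 7) (var 2))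
      (assign 7 (Plus (var 7) (Monus (Const 1) (Read 9 (var 2))))))
      (s(9 := (s 9)(val s (var 2) := val s (positive (Monus (var 5) parameter_expr))))) ?Q"
    unfolding s1
  proof (rule runs_Seq_Write[OF b1])
    show "val ?s1 (var 2) \<le> M" using s i n_le by simp
    assume b2: "bounded M (?s1(8 := (?s1 8)(val ?s1 (var 7) := val ?s1 (var 2))))"
    show "runs d (assign 7 (Plus (var 7) (Monus (Const 1) (Read 9 (var 2)))))
        (?s1(8 := (?s1 8)(val ?s1 (var 7) := val ?s1 (var 2)))) ?Q"
    proof (rule runs_Write[OF b2], goal_cases)
      case 1
      show ?case using s m i n_le by simp
    next
      case 2
      show ?case using s by (simp add: selected_Suc)
    qed
  qed
qed

lemma runs_select:
  assumes s: "bounded M s" "s 0 = f" "s 1 = (\<lambda>_. 0)"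
  shows "runs (Suc (Suc (Suc d))) select_prog s (\<lambda>s'. s' 0 = f \<and> s' 1 = (\<lambda>_. 0) \<and> selected n s')"
  unfolding select_prog_def
proof (rule runs_Seq_Write[OF s(1)])
  let ?s = "s(7 := (s 7)(val s (Const 0) := val s (Const 0)))"
  let ?I = "\<lambda>i s'. s' 0 = f \<and> s' 1 = (\<lambda>_. 0) \<and> s' 2 0 = i \<and> selected i s'"
  assume b: "bounded M ?s"
  show "runs (Suc (Suc (Suc d))) (For 2 size_expr (Seq rank_prog mark_prog)) ?s
     (\<lambda>s'. s' 0 = f \<and> s' 1 = (\<lambda>_. 0) \<and> selected n s')"
  proof (rule runs_For[where I = ?I and n = n, OF b n_less n_le])
    show "?I 0 (?s(2 := (?s 2)(0 := 0)))" using s by (simp add: selected_def keep_list_def)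
  next
    fix i s' assume "?I i s'"
    then show "s' 2 0 = i \<and> val s' size_expr = n" by (simp add: size)
  next
    fix i s1 assume b1: "bounded M s1" and i: "i < n" and I1: "?I i s1"
    show "runs (Suc (Suc d)) (Seq rank_prog mark_prog) s1
      (\<lambda>s'. s' 2 0 = i \<and> ?I (Suc i) (s'(2 := (s' 2)(0 := Suc i))))"
    proof (rule runs_Seq[OF runs_rank[OF b1]])
      fix s2 assume b2: "bounded M s2"
        and s2: "(\<forall>a. a \<notin> {3, 4, 5, 6} \<longrightarrow> s2 a = s1 a) \<and> s2 5 0 = rank i"
      have "s2 0 = f" "s2 1 = (\<lambda>_. 0)" "s2 2 0 = i" "s2 5 0 = rank i" "selected i s2"
        using s2 I1 by (auto simp: selected_def)
      from runs_mark[OF b2 this i]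
      show "runs (Suc (Suc d)) mark_prog s2
          (\<lambda>s'. s' 2 0 = i \<and> ?I (Suc i) (s'(2 := (s' 2)(0 := Suc i))))"
        by (rule runs_mono) (simp add: selected_def)
    qed (use I1 i in auto)
  next
    fix s' assume "?I n s'"
    then show "s' 0 = f \<and> s' 1 = (\<lambda>_. 0) \<and> selected n s'" by simp
  qed
qed simp

abbreviation kept_list :: "nat list" where
  "kept_list \<equiv> keep_list n"

abbreviation m :: nat where
  "m \<equiv> length kept_list"

text \<open>Matrix and capacities of the output are numbered consecutively, so that one invariant
  \<open>written P\<close> serves the loops for both.\<close>

definition entry :: "nat \<Rightarrow> nat" where
  "entry p = (if p < m * m then A (kept_list ! (p div m)) (kept_list ! (p mod m))
     else min (c (kept_list ! (p - m * m)) -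
         (\<Sum>j<n. A (kept_list ! (p - m * m)) j * of_bool (k < rank j))) m)"

definition kernel_output :: "nat list" where
  "kernel_output = k # m # map entry [0..<m * m + b * m]"

definition written :: "nat \<Rightarrow> memory \<Rightarrow> bool" where
  "written P s \<longleftrightarrow> s 0 = f \<and> selected n s \<and> s 1 0 = 2 + (m * m + b * m) \<and> s 1 (Suc 0) = k \<and>
     s 1 2 = m \<and> (\<forall>p < P. s 1 (3 + p) = entry p)"

lemma writtenD:
  assumes "written P s"
  shows "s 0 = f" "s 7 0 = m" "\<And>a. a < m \<Longrightarrow> s 8 a = kept_list ! a"
    "\<And>x. x < n \<Longrightarrow> s 9 x = of_bool (k < rank x)"
  using assms by (auto simp: written_def selected_def)

lemma m_le: "m \<le> n" by (rule length_keep_list)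

lemma written_frame:
  "written P s \<Longrightarrow> s' 0 = s 0 \<Longrightarrow> s' 1 = s 1 \<Longrightarrow> s' 7 = s 7 \<Longrightarrow> s' 8 = s 8 \<Longrightarrow> s' 9 = s 9 \<Longrightarrow>
    written P s'"
  by (simp add: written_def selected_def)

lemma written_Suc:
  assumes "written P s" "s' 0 = s 0" "s' 7 = s 7" "s' 8 = s 8" "s' 9 = s 9"
    "s' 1 = (s 1)(3 + P := entry P)"
  shows "written (Suc P) s'"
  using assms by (auto simp: written_def selected_def less_Suc_eq)

lemma runs_matrix:
  assumes s: "bounded M s" "written 0 s"
  shows "runs (Suc (Suc d)) matrix_prog s (written (m * m))"
  unfolding matrix_prog_def
proof (rule runs_For[where I = "\<lambda>i s. written (i * m) s \<and> s 2 0 = i" and n = m, OF s(1)])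
  show "m < B" "m \<le> M" using m_le n_less n_le by auto
  show "written (0 * m) (s(2 := (s 2)(0 := 0))) \<and> (s(2 := (s 2)(0 := 0))) 2 0 = 0"
    using s(2) written_frame[of 0 s "s(2 := (s 2)(0 := 0))"] by simp
next
  fix i s assume "written (i * m) s \<and> s 2 0 = i"
  then show "s 2 0 = i \<and> val s (var 7) = m" using writtenD(2)[of "i * m" s] by simp
next
  fix i s assume b1: "bounded M s" and i: "i < m" and I1: "written (i * m) s \<and> s 2 0 = i"
  let ?J = "\<lambda>j s. written (i * m + j) s \<and> s 2 0 = i \<and> s 3 0 = j"
  show "runs (Suc d) (For 3 (var 7)
         (Write 1 (Plus (Const 3) (Plus (Times (var 2) (var 7)) (var 3)))
           (adj_expr (Read 8 (var 2)) (Read 8 (var 3))))) s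
      (\<lambda>s'. s' 2 0 = i \<and> written (Suc i * m) (s'(2 := (s' 2)(0 := Suc i))) \<and>
         (s'(2 := (s' 2)(0 := Suc i))) 2 0 = Suc i)"
  proof (rule runs_For[where I = ?J and n = m, OF b1])
    show "m < B" "m \<le> M" using m_le n_less n_le by auto
    show "?J 0 (s(3 := (s 3)(0 := 0)))"
      using I1 written_frame[of "i * m" s "s(3 := (s 3)(0 := 0))"] by simp
  next
    fix j s assume "?J j s"
    then show "s 3 0 = j \<and> val s (var 7) = m" using writtenD(2)[of "i * m + j" s] by simp
  next
    fix j s assume b2: "bounded M s" and j: "j < m" and J: "?J j s"
    have W: "written (i * m + j) s" using J by simp
    note D = writtenD[OF W]
    have m0: "m \<noteq> 0" using j by linarith
    have idx: "(i * m + j) div m = i" "(i * m + j) mod m = j"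
      using j div_mult_self3[OF m0, of i j] by simp_all
    have "i * m + j < Suc i * m" using j by simp
    also have "\<dots> \<le> m * m" using i by (intro mult_right_mono) auto
    finally have lt: "i * m + j < m * m" .
    have kl: "kept_list ! i < n" "kept_list ! j < n" using i j keep_list_less by auto
    have addr: "val s (Plus (Const 3) (Plus (Times (var 2) (var 7)) (var 3))) = 3 + (i * m + j)"
      using J D by simp
    have v: "val s (adj_expr (Read 8 (var 2)) (Read 8 (var 3))) = entry (i * m + j)"
      using J D(1) D(3)[OF i] D(3)[OF j] adj[OF kl] size lt idx by (simp add: entry_def)
    have le: "entry (i * m + j) \<le> M"
      unfolding entry_def idx using lt A_le[of "kept_list ! i" "kept_list ! j"] M by simp
    show "runs d (Write 1 (Plus (Const 3) (Plus (Times (var 2) (var 7)) (var 3)))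
           (adj_expr (Read 8 (var 2)) (Read 8 (var 3)))) s
        (\<lambda>s'. s' 3 0 = j \<and> ?J (Suc j) (s'(3 := (s' 3)(0 := Suc j))))"
    proof (rule runs_Write[OF b2], unfold addr v)
      let ?s = "s(1 := (s 1)(3 + (i * m + j) := entry (i * m + j)))"
      have "written (Suc (i * m + j)) (?s(3 := (?s 3)(0 := Suc j)))"
        by (rule written_Suc[OF W]) auto
      then show "?s 3 0 = j \<and> ?J (Suc j) (?s(3 := (?s 3)(0 := Suc j)))" using J by simp
    qed (rule le)
  next
    fix s' assume J: "?J m s'"
    have "written (i * m + m) (s'(2 := (s' 2)(0 := Suc i)))"
      by (rule written_frame[OF conjunct1[OF J]]) simp_all
    then show "s' 2 0 = i \<and> written (Suc i * m) (s'(2 := (s' 2)(0 := Suc i))) \<and>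
         (s'(2 := (s' 2)(0 := Suc i))) 2 0 = Suc i"
      using J by (simp add: add.commute)
  qed
next
  fix s assume "written (m * m) s \<and> s 2 0 = m"
  then show "written (m * m) s" ..
qed

lemma runs_capacity:
  assumes s: "bounded M s" "written (m * m) s"
  shows "runs (Suc (Suc d)) (capacity_prog b) s (written (m * m + b * m))"
  unfolding capacity_prog_def
proof (rule runs_For[where I = "\<lambda>i s. written (m * m + i) s \<and> s 2 0 = i" and n = "b * m", OF s(1)])
  have bm: "b * m \<le> m" using b by (cases b) auto
  show "b * m < B" "b * m \<le> M" using bm m_le n_less n_le by linarith+
  show "written (m * m + 0) (s(2 := (s 2)(0 := 0))) \<and> (s(2 := (s 2)(0 := 0))) 2 0 = 0"
    using s(2) written_frame[of "m * m" s "s(2 := (s 2)(0 := 0))"] by simp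
next
  fix i s assume "written (m * m + i) s \<and> s 2 0 = i"
  then show "s 2 0 = i \<and> val s (Times (Const b) (var 7)) = b * m"
    using writtenD(2)[of "m * m + i" s] by simp
next
  fix i s assume b1: "bounded M s" and i': "i < b * m" and I1: "written (m * m + i) s \<and> s 2 0 = i"
  have i: "i < m" using i' b by (cases b) auto
  have W: "written (m * m + i) s" using I1 by simp
  note D = writtenD[OF W]
  have kl: "kept_list ! i < n" using i keep_list_less by auto
  let ?g = "\<lambda>j. A (kept_list ! i) j * of_bool (k < rank j)"
  have gn: "sum ?g {..<n} \<le> n" by (rule sum_le_n) (use A_le in auto)
  show "runs (Suc d) (Seq (Sum_Loop 5 3 size_expr (Times (adj_expr (Read 8 (var 2)) (var 3)) (Read 9 (var 3))))
       (Seq (assign 6 (Monus (cap_expr (Read 8 (var 2))) (var 5)))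
         (Write 1 (Plus (Const 3) (Plus (Times (var 7) (var 7)) (var 2)))
           (Monus (var 6) (Monus (var 6) (var 7)))))) s
      (\<lambda>s'. s' 2 0 = i \<and> written (m * m + Suc i) (s'(2 := (s' 2)(0 := Suc i))) \<and>
         (s'(2 := (s' 2)(0 := Suc i))) 2 0 = Suc i)" (is "runs _ _ _ ?Q")
  proof (rule runs_Seq)
    show "runs (Suc d) (Sum_Loop 5 3 size_expr (Times (adj_expr (Read 8 (var 2)) (var 3)) (Read 9 (var 3)))) s
        (\<lambda>s'. (\<forall>a. a \<noteq> 5 \<longrightarrow> a \<noteq> 3 \<longrightarrow> s' a = s a) \<and> s' 5 0 = sum ?g {..<n})"
    proof (rule runs_Sum_Loop[where g = ?g, OF b1 n_less n_le])
      fix w s' assume w: "w < n" and fr: "\<And>a. a \<noteq> 5 \<Longrightarrow> a \<noteq> 3 \<Longrightarrow> s' a = s a"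
        and "s' 3 0 = w"
      then show "val s' (Times (adj_expr (Read 8 (var 2)) (var 3)) (Read 9 (var 3))) = ?g w"
        using fr[of 0] fr[of 2] fr[of 8] fr[of 9] I1 D(1) D(3)[OF i] D(4)[OF w] adj[OF kl w] size
        by simp
    qed (use gn n_le D size in auto)
  next
    fix s2 assume b2: "bounded M s2"
      and s2: "(\<forall>a. a \<noteq> 5 \<longrightarrow> a \<noteq> 3 \<longrightarrow> s2 a = s a) \<and> s2 5 0 = sum ?g {..<n}"
    have s2': "s2 0 = f" "s2 2 0 = i" "s2 7 0 = m" "s2 8 i = kept_list ! i" "s2 5 0 = sum ?g {..<n}"
      using s2 I1 D(1-2) D(3)[OF i] by auto
    have W2: "written (m * m + i) s2" by (rule written_frame[OF W]) (use s2 in auto)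
    let ?x = "c (kept_list ! i) - sum ?g {..<n}"
    have v: "val s2 (Monus (cap_expr (Read 8 (var 2))) (var 5)) = ?x"
      using s2' size cap[OF kl] by simp
    show "runs (Suc d) (Seq (assign 6 (Monus (cap_expr (Read 8 (var 2))) (var 5)))
         (Write 1 (Plus (Const 3) (Plus (Times (var 7) (var 7)) (var 2)))
           (Monus (var 6) (Monus (var 6) (var 7))))) s2 ?Q"
    proof (rule runs_Seq_Write[OF b2], unfold v)
      show "?x \<le> M" using f_le[of "3 + (n * n + kept_list ! i)"] cap[OF kl] by simp
      let ?s3 = "s2(6 := (s2 6)(val s2 (Const 0) := ?x))"
      assume b3: "bounded M ?s3"
      have e: "val ?s3 (Monus (var 6) (Monus (var 6) (var 7))) = entry (m * m + i)"
        using s2' by (simp add: entry_def min_def)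
      have addr: "val ?s3 (Plus (Const 3) (Plus (Times (var 7) (var 7)) (var 2))) = 3 + (m * m + i)"
        using s2' by simp
      show "runs (Suc d) (Write 1 (Plus (Const 3) (Plus (Times (var 7) (var 7)) (var 2)))
           (Monus (var 6) (Monus (var 6) (var 7)))) ?s3 ?Q"
      proof (rule runs_Write[OF b3], unfold e addr)
        show "entry (m * m + i) \<le> M" using m_le n_le by (simp add: entry_def)
        let ?s4 = "?s3(1 := (?s3 1)(3 + (m * m + i) := entry (m * m + i)))"
        have "written (Suc (m * m + i)) (?s4(2 := (?s4 2)(0 := Suc i)))"
          by (rule written_Suc[OF W2]) auto
        then show "?s4 2 0 = i \<and> written (m * m + Suc i) (?s4(2 := (?s4 2)(0 := Suc i))) \<and>
           (?s4(2 := (?s4 2)(0 := Suc i))) 2 0 = Suc i"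
          using s2' by simp
      qed
    qed
  qed
next
  fix s assume "written (m * m + b * m) s \<and> s 2 0 = b * m"
  then show "written (m * m + b * m) s" ..
qed

lemma array_holds_kernel_output:
  assumes "written (m * m + b * m) s"
  shows "array_holds (s 1) kernel_output"
  unfolding array_holds_def
proof (intro conjI allI impI)
  show "s 1 0 = length kernel_output" using assms by (simp add: written_def kernel_output_def)
next
  fix i assume i: "i < length kernel_output"
  consider "i = 0" | "i = Suc 0" | p where "i = Suc (Suc p)" by (metis not0_implies_Suc)
  then show "s 1 (Suc i) = kernel_output ! i"
  proof cases
    case 3
    then have p: "p < m * m + b * m" using i by (simp add: kernel_output_def)
    then have "s 1 (3 + p) = entry p" using assms by (simp add: written_def)
    then show ?thesis using 3 p by (simp add: kernel_output_def numeral_3_eq_3)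
  qed (use assms in \<open>simp_all add: written_def kernel_output_def numeral_2_eq_2\<close>)
qed

lemma runs_yes:
  assumes s: "bounded M s" "s 0 = f" "selected n s"
  shows "runs (Suc (Suc d)) (yes_prog b) s (\<lambda>s'. array_holds (s' 1) kernel_output)"
proof -
  let ?l = "2 + (m * m + b * m)"
  have "m * m \<le> n * n" using m_le by (rule mult_le_mono[OF _ m_le])
  moreover have "b * m \<le> n" using b m_le by (cases b) auto
  ultimately have l: "?l \<le> M" using M_ge by linarith
  have m7: "s 7 0 = m" using s(3) by (simp add: selected_def)
  have k: "k \<le> M" using f_le[of "Suc 0"] parameter by simp
  let ?s1 = "s(1 := (s 1)(0 := ?l))"
  let ?s2 = "?s1(1 := (?s1 1)(Suc 0 := k))"
  let ?s3 = "?s2(1 := (?s2 1)(2 := m))"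
  have W: "written 0 ?s3" using s m7 by (simp add: written_def selected_def)
  have "runs (Suc (Suc d)) (Seq matrix_prog (capacity_prog b)) ?s3 (\<lambda>s'. array_holds (s' 1) kernel_output)"
    if b3: "bounded M ?s3"
  proof (rule runs_Seq[OF runs_matrix[OF b3 W]])
    fix s' assume "bounded M s'" "written (m * m) s'"
    from runs_capacity[OF this]
    show "runs (Suc (Suc d)) (capacity_prog b) s' (\<lambda>s'. array_holds (s' 1) kernel_output)"
      by (rule runs_mono) (rule array_holds_kernel_output)
  qed
  then have "runs (Suc (Suc d)) (Seq (Write 1 (Const 2) (var 7)) (Seq matrix_prog (capacity_prog b)))
      ?s2 (\<lambda>s'. array_holds (s' 1) kernel_output)" if b2: "bounded M ?s2"
    using m7 m_le n_le by (intro runs_Seq_Write[OF b2]) simp_all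
  then have "runs (Suc (Suc d)) (Seq (Write 1 (Const 1) parameter_expr)
      (Seq (Write 1 (Const 2) (var 7)) (Seq matrix_prog (capacity_prog b))))
      ?s1 (\<lambda>s'. array_holds (s' 1) kernel_output)" if b1: "bounded M ?s1"
    using s(2) parameter k by (intro runs_Seq_Write[OF b1]) simp_all
  then show ?thesis
    unfolding yes_prog_def using l m7 by (intro runs_Seq_Write[OF s(1)]) simp_all
qed

lemma runs_no:
  assumes s: "bounded M s" "s 1 = (\<lambda>_. 0)"
  shows "runs d (no_prog b) s (\<lambda>s'. array_holds (s' 1) ([0, 2, 0, 1, 1, 0] @ replicate (2 * b) 0))"
proof -
  let ?out = "[0, 2, 0, 1, 1, 0] @ replicate (2 * b) 0 :: nat list"
  have M8: "8 \<le> M" using M_ge by simp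
  let ?s1 = "s(1 := (s 1)(0 := 6 + 2 * b))"
  let ?s2 = "?s1(1 := (?s1 1)(2 := 2))"
  let ?s3 = "?s2(1 := (?s2 1)(4 := 1))"
  let ?s4 = "?s3(1 := (?s3 1)(5 := 1))"
  have "array_holds (?s4 1) ?out"
  proof -
    have "i < length ?out \<Longrightarrow> (?s4 1) (Suc i) = ?out ! i" for i
    proof -
      assume "i < length ?out"
      then consider "i \<in> {0, 1, 2, 3, 4, 5}" | "6 \<le> i" "i < 6 + 2 * b"
        by force
      then show "(?s4 1) (Suc i) = ?out ! i"
      proof cases
        case 2
        then have "(?s4 1) (Suc i) = 0" using s(2) by simp
        moreover have "?out ! i = replicate (2 * b) 0 ! (i - 6)"
          using 2 by (subst nth_append) simp
        ultimately show ?thesis using 2 by simp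
      qed (use s(2) in auto)
    qed
    moreover have "(?s4 1) 0 = length ?out" by simp
    ultimately show ?thesis unfolding array_holds_def by blast
  qed
  then have "runs d (Write 1 (Const 5) (Const 1)) ?s3 (\<lambda>s'. array_holds (s' 1) ?out)"
    if b3: "bounded M ?s3"
    using M8 by (intro runs_Write[OF b3]) simp_all
  then have "runs d (Seq (Write 1 (Const 4) (Const 1)) (Write 1 (Const 5) (Const 1))) ?s2
      (\<lambda>s'. array_holds (s' 1) ?out)" if b2: "bounded M ?s2"
    using M8 by (intro runs_Seq_Write[OF b2]) simp_all
  then have "runs d (Seq (Write 1 (Const 2) (Const 2)) (Seq (Write 1 (Const 4) (Const 1))
      (Write 1 (Const 5) (Const 1)))) ?s1 (\<lambda>s'. array_holds (s' 1) ?out)" if b1: "bounded M ?s1"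
    using M8 by (intro runs_Seq_Write[OF b1]) simp_all
  then show ?thesis
    unfolding no_prog_def using M8 b by (intro runs_Seq_Write[OF s(1)]) simp_all
qed

lemma runs_kernel_prog:
  assumes s: "bounded M s" "s 0 = f" "s 1 = (\<lambda>_. 0)"
  shows "runs (Suc (Suc (Suc d))) (kernel_prog C b) s
    (\<lambda>s'. array_holds (s' 1) (if C * ((k + 1) * (k + 1)) < m
       then [0, 2, 0, 1, 1, 0] @ replicate (2 * b) 0 else kernel_output))"
  unfolding kernel_prog_def
proof (rule runs_Seq[OF runs_select[OF s]])
  fix s1 assume b1: "bounded M s1" and s1: "s1 0 = f \<and> s1 1 = (\<lambda>_. 0) \<and> selected n s1"
  let ?e = "Monus (var 7) (Times (Const C) (Times (Plus parameter_expr (Const 1))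
               (Plus parameter_expr (Const 1))))"
  have v: "val s1 ?e = m - C * ((k + 1) * (k + 1))"
    using s1 parameter by (simp add: selected_def)
  show "runs (Suc (Suc (Suc d))) (Cond ?e (no_prog b) (yes_prog b)) s1
    (\<lambda>s'. array_holds (s' 1) (if C * ((k + 1) * (k + 1)) < m
       then [0, 2, 0, 1, 1, 0] @ replicate (2 * b) 0 else kernel_output))"
  proof (rule runs_Cond[OF b1], unfold v)
    assume "m - C * ((k + 1) * (k + 1)) \<noteq> 0"
    then have lt: "C * ((k + 1) * (k + 1)) < m" by simp
    show "runs (Suc (Suc (Suc d))) (no_prog b) s1 (\<lambda>s'. array_holds (s' 1)
      (if C * ((k + 1) * (k + 1)) < m then [0, 2, 0, 1, 1, 0] @ replicate (2 * b) 0 else kernel_output))"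
      unfolding if_P[OF lt] using s1 by (intro runs_no[OF b1]) simp
  next
    assume "m - C * ((k + 1) * (k + 1)) = 0"
    then have nlt: "\<not> C * ((k + 1) * (k + 1)) < m" by simp
    show "runs (Suc (Suc (Suc d))) (yes_prog b) s1 (\<lambda>s'. array_holds (s' 1)
      (if C * ((k + 1) * (k + 1)) < m then [0, 2, 0, 1, 1, 0] @ replicate (2 * b) 0 else kernel_output))"
      unfolding if_not_P[OF nlt] using s1 by (intro runs_yes[OF b1]) simp_all
  qed
qed

end


section \<open>The two kernels\<close>

lemma map_graph_inverse:
  assumes "is_graph H" "\<And>x. x \<in> verts H \<Longrightarrow> g (h x) = x"
  shows "map_graph g (map_graph h H) = H"
proof -
  have e: "g ` h ` e = e" if "e \<in> black H" for e
    using assms(2) is_graphD(4)[OF assms(1) that] by (force simp: image_image)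
  have "g ` h ` verts H = verts H" using assms(2) by (force simp: image_image)
  moreover have "(\<lambda>e. g ` e) ` (\<lambda>e. h ` e) ` black H = black H" using e by (force simp: image_image)
  moreover have "red H = {}" by (rule is_graphD[OF assms(1)])
  ultimately show ?thesis by (simp add: map_graph_def)
qed

lemma connected_map_graph_iff:
  assumes G: "is_graph H" "inj_on h (verts H)"
  shows "(\<exists>S. connected_vertex_cover (map_graph h H) S \<and> card S \<le> k) \<longleftrightarrow>
    (\<exists>S. connected_vertex_cover H S \<and> card S \<le> k)"
proof -
  have *: "\<exists>S. connected_vertex_cover (map_graph g H') S \<and> card S \<le> k"
    if H': "is_graph H'" and ex: "\<exists>S. connected_vertex_cover H' S \<and> card S \<le> k"
    for g :: "'c \<Rightarrow> 'd" and H'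
  proof -
    obtain S where S: "connected_vertex_cover H' S" "card S \<le> k" using ex by blast
    then have "finite S"
      using is_graphD(1)[OF H']
      by (auto simp: connected_vertex_cover_def vertex_cover_def intro: finite_subset)
    then have "card (g ` S) \<le> k" using card_image_le[of S g] S(2) by simp
    with connected_vertex_cover_map_graph[OF S(1)] show ?thesis by blast
  qed
  have inv: "map_graph (inv_into (verts H) h) (map_graph h H) = H"
    using G by (intro map_graph_inverse) auto
  show ?thesis
    using *[OF G(1), of h] *[OF is_graph_map_graph[OF G], of "inv_into (verts H) h"]
    unfolding inv by blast
qed

lemma capacitated_map_graph_iff:
  assumes G: "is_graph H" "inj_on h (verts H)" and c: "\<And>x. x \<in> verts H \<Longrightarrow> c' (h x) = c x"
  shows "(\<exists>S. capacitated_vertex_cover (map_graph h H) c' S \<and> card S \<le> k) \<longleftrightarrow>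
    (\<exists>S. capacitated_vertex_cover H c S \<and> card S \<le> k)"
proof -
  have *: "\<exists>S. capacitated_vertex_cover (map_graph g H') d' S \<and> card S \<le> k"
    if H': "is_graph H'" "inj_on g (verts H')" and d: "\<And>x. x \<in> verts H' \<Longrightarrow> d' (g x) = d x"
      and ex: "\<exists>S. capacitated_vertex_cover H' d S \<and> card S \<le> k"
    for g :: "'c \<Rightarrow> 'd" and H' d d'
  proof -
    obtain S where S: "capacitated_vertex_cover H' d S" "card S \<le> k" using ex by blast
    then have sub: "S \<subseteq> verts H'" by (simp add: capacitated_vertex_cover_def vertex_cover_def)
    then have "finite S" using is_graphD(1)[OF H'(1)] by (rule finite_subset)
    then have "card (g ` S) \<le> k" using card_image_le[of S g] S(2) by simp
    moreover have "d x \<le> d' (g x)" if "x \<in> S" for x using d[of x] sub that by auto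
    ultimately show ?thesis
      using capacitated_vertex_cover_map_graph[OF H'(1) S(1) H'(2)] by blast
  qed
  have inv: "map_graph (inv_into (verts H) h) (map_graph h H) = H"
    using G by (intro map_graph_inverse) auto
  have inj: "inj_on (inv_into (verts H) h) (verts (map_graph h H))"
    by (simp add: inj_on_inv_into)
  have c': "c (inv_into (verts H) h x) = c' x" if "x \<in> verts (map_graph h H)" for x
    using that c G(2) by auto
  show ?thesis
    using *[of H h c' c, OF G c]
      *[of "map_graph h H" "inv_into (verts H) h" c c', OF is_graph_map_graph[OF G] inj c']
    unfolding inv by blast
qed

section \<open>The kernel with renumbered vertices\<close>

definition kept_vertices :: "nat trigraph \<Rightarrow> (nat \<Rightarrow> nat) \<Rightarrow> nat \<Rightarrow> nat list" where
  "kept_vertices G c k = filter (\<lambda>x. x \<in> kept G c k) [0..<card (verts G)]"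

text \<open>Instances have initial segments of the numbers as vertex sets, so each kept vertex is
  renamed to its position in the increasing list of kept vertices.\<close>

definition index :: "nat list \<Rightarrow> nat \<Rightarrow> nat" where
  "index xs = inv_into {..<length xs} ((!) xs)"

definition kernel_graph :: "nat trigraph \<Rightarrow> (nat \<Rightarrow> nat) \<Rightarrow> nat \<Rightarrow> nat trigraph" where
  "kernel_graph G c k = map_graph (index (kept_vertices G c k)) (induced G (kept G c k))"

definition kernel_capacity :: "nat trigraph \<Rightarrow> (nat \<Rightarrow> nat) \<Rightarrow> nat \<Rightarrow> nat \<Rightarrow> nat" where
  "kernel_capacity G c k a = reduced_capacity G c k (kept_vertices G c k ! a)"

definition single_edge :: "nat trigraph" where
  "single_edge = \<lparr> verts = {..<2}, black = {{0, 1}}, red = {} \<rparr>"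

text \<open>\<open>C\<close> will be \<open>class_bound (nat d) + 1\<close>, the factor in
  \<open>card_kept_vertex_cover\<close>: beyond the threshold there is no vertex cover of size at
  most \<open>k\<close> of any kind.\<close>

definition vc_kernel :: "nat \<Rightarrow> (nat trigraph \<times> (nat \<Rightarrow> nat)) \<times> nat \<Rightarrow>
    (nat trigraph \<times> (nat \<Rightarrow> nat)) \<times> nat" where
  "vc_kernel C = (\<lambda>((G, c), k).
     if C * ((k + 1) * (k + 1)) < card (kept G c k) then ((single_edge, \<lambda>_. 0), 0)
     else ((kernel_graph G c k, kernel_capacity G c k), k))"

lemma index_nth:
  assumes "distinct xs" "i < length xs"
  shows "index xs (xs ! i) = i"
  unfolding index_def using assms by (intro inv_into_f_f) (auto simp: inj_on_nth)

lemma nth_index: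
  assumes "x \<in> set xs"
  shows "xs ! index xs x = x" "index xs x < length xs"
proof -
  have x: "x \<in> (!) xs ` {..<length xs}" using assms by (auto simp: in_set_conv_nth)
  show "xs ! index xs x = x" unfolding index_def by (rule f_inv_into_f[OF x])
  show "index xs x < length xs" using inv_into_into[OF x] by (simp add: index_def)
qed

locale numbered_graph =
  fixes G :: "nat trigraph" and n k :: nat and c :: "nat \<Rightarrow> nat"
  assumes graph: "is_graph G" and verts: "verts G = {..<n}"
begin

abbreviation "kl \<equiv> kept_vertices G c k"
abbreviation "K \<equiv> kept G c k"

lemma set_kl: "set kl = K"
  using verts kept_subset[of G c k] by (auto simp: kept_vertices_def)

lemma distinct_kl: "distinct kl"
  by (simp add: kept_vertices_def)

lemma length_kl: "length kl = card K"
  using distinct_card[OF distinct_kl] by (simp add: set_kl)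

lemma nth_kl: "a < card K \<Longrightarrow> kl ! a \<in> K"
  using nth_mem[of a kl] by (simp add: set_kl length_kl)

lemma nth_kl_less: "a < card K \<Longrightarrow> kl ! a < n"
  using nth_kl kept_subset[of G c k] verts by blast

lemma inj_index: "inj_on (index kl) K"
  by (rule inj_on_inverseI[of _ "(!) kl"]) (simp add: nth_index set_kl)

lemma graph_induced: "is_graph (induced G K)"
  by (rule is_graph_induced[OF graph kept_subset])

lemma is_graph_kernel_graph: "is_graph (kernel_graph G c k)"
  unfolding kernel_graph_def using graph_induced inj_index by (intro is_graph_map_graph) simp_all

lemma verts_kernel_graph: "verts (kernel_graph G c k) = {..<card K}"
proof
  show "verts (kernel_graph G c k) \<subseteq> {..<card K}"
    using nth_index(2)[of _ kl] by (auto simp: kernel_graph_def set_kl length_kl)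
  show "{..<card K} \<subseteq> verts (kernel_graph G c k)"
  proof
    fix a assume "a \<in> {..<card K}"
    then have "a = index kl (kl ! a)" "kl ! a \<in> K"
      using index_nth[OF distinct_kl, of a] nth_kl by (simp_all add: length_kl)
    then show "a \<in> verts (kernel_graph G c k)" by (auto simp: kernel_graph_def)
  qed
qed

lemma edge_kernel_graph:
  assumes "a < card K" "b < card K"
  shows "{a, b} \<in> black (kernel_graph G c k) \<longleftrightarrow> {kl ! a, kl ! b} \<in> black G"
proof -
  have "{index kl (kl ! a), index kl (kl ! b)} \<in> black (kernel_graph G c k) \<longleftrightarrow>
      {kl ! a, kl ! b} \<in> black (induced G K)"
    unfolding kernel_graph_def
    by (rule map_graph_edge_iff[OF graph_induced]) (use inj_index nth_kl assms in auto)
  moreover have "index kl (kl ! a) = a" "index kl (kl ! b) = b"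
    using index_nth[OF distinct_kl] assms by (simp_all add: length_kl)
  ultimately show ?thesis using nth_kl assms by simp
qed

text \<open>Looking up the list of kept vertices embeds the kernel into \<open>G\<close> as an
  induced subgraph, so \<open>reducible_sub\<close> applies.\<close>

lemma twin_width_kernel_graph: "twin_width (kernel_graph G c k) \<le> twin_width G"
proof -
  have tri: "is_trigraph G" "is_trigraph (kernel_graph G c k)"
    using graph is_graph_kernel_graph by (simp_all add: is_graph_def)
  have red: "red G = {}" "red (kernel_graph G c k) = {}"
    using graph is_graph_kernel_graph by (simp_all add: is_graph_def)
  have "reducible (twin_width G) (kernel_graph G c k)"
  proof (rule reducible_sub[OF _ _ _ tri(2,1)])
    show "reducible (twin_width G) G" using twin_width_le_iff[OF tri(1)] by blast
    show "trigraph_hom ((!) kl) (kernel_graph G c k) G"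
      using nth_kl_less edge_kernel_graph red by (auto simp: trigraph_hom_def verts_kernel_graph verts)
    show "inj_on ((!) kl) (verts (kernel_graph G c k))"
      using distinct_kl by (auto simp: verts_kernel_graph inj_on_nth length_kl)
  qed
  then show ?thesis using twin_width_le_iff[OF tri(2)] by blast
qed

lemma connected_kernel_graph:
  "(\<exists>S. connected_vertex_cover (kernel_graph G c k) S \<and> card S \<le> k) \<longleftrightarrow>
    (\<exists>S. connected_vertex_cover G S \<and> card S \<le> k)"
  unfolding kernel_graph_def
proof (rule trans[OF connected_map_graph_iff[OF graph_induced] connected_kernel[OF graph]])
  show "inj_on (index kl) (verts (induced G K))" using inj_index by simp
qed

lemma capacitated_kernel_graph:
  "(\<exists>S. capacitated_vertex_cover (kernel_graph G c k) (kernel_capacity G c k) S \<and> card S \<le> k) \<longleftrightarrow>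
    (\<exists>S. capacitated_vertex_cover G c S \<and> card S \<le> k)"
  unfolding kernel_graph_def
proof (rule trans[OF capacitated_map_graph_iff[OF graph_induced] capacitated_kernel[OF graph]])
  show "inj_on (index kl) (verts (induced G K))" using inj_index by simp
  show "kernel_capacity G c k (index kl x) = reduced_capacity G c k x"
    if "x \<in> verts (induced G K)" for x
    using that by (simp add: kernel_capacity_def nth_index set_kl)
qed

end

lemma single_edge_simps [simp]:
  "verts single_edge = {..<2}" "black single_edge = {{0, 1}}" "red single_edge = {}"
  by (simp_all add: single_edge_def)

lemma is_graph_single_edge: "is_graph single_edge"
  by (auto simp: is_graph_def is_trigraph_def)

lemma twin_width_single_edge: "twin_width single_edge = 0"
proof -
  have tri: "is_trigraph single_edge" using is_graph_single_edge by (simp add: is_graph_def)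
  let ?T = "contract single_edge 0 1 0"
  have v: "verts single_edge - {0, 1} = {}" by auto
  have T: "verts ?T = {0}" "red ?T = {}" unfolding contract_def by (auto simp: v)
  have "contraction single_edge ?T"
    unfolding contraction_def by (intro exI[of _ 0] exI[of _ 1]) (auto simp: contract_def)
  moreover have "reducible 0 ?T"
    by (rule reducible.small) (simp_all only: T red_degree_def, simp_all)
  ultimately have "reducible 0 single_edge"
    by (intro reducible.step[of single_edge 0 ?T]) (simp_all add: red_degree_def)
  then show ?thesis using twin_width_le_iff[OF tri] by blast
qed

lemma single_edge_cover: "vertex_cover single_edge S \<Longrightarrow> 0 < card S"
proof -
  assume S: "vertex_cover single_edge S"
  then have "finite S" "S \<noteq> {}" by (auto simp: vertex_cover_def intro: finite_subset)
  then show ?thesis by (simp add: card_gt_0_iff)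
qed

text \<open>A single instance already forces \<open>0 \<le> d\<close>. For negative \<open>d\<close>
  there are no instances, which justifies working with \<open>nat d\<close>, and for the others the
  single edge of twin-width 0 is an admissible output.\<close>

lemma input_graphsD:
  assumes "G \<in> input_graphs d"
  shows "numbered_graph G (card (verts G))" "twin_width G \<le> nat d" "0 \<le> d"
proof -
  obtain n where n: "is_graph G" "verts G = {..<n}" "int (twin_width G) \<le> d"
    using assms unfolding input_graphs_def by blast
  then have "card (verts G) = n" by simp
  with n(1,2) show "numbered_graph G (card (verts G))" by (simp only: numbered_graph_def)
  show "twin_width G \<le> nat d" "0 \<le> d" using n(3) by linarith+
qed

lemma single_edge_input: "0 \<le> d \<Longrightarrow> single_edge \<in> input_graphs d"
  using is_graph_single_edge twin_width_single_edge by (auto simp: input_graphs_def)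

lemma kernel_graph_input:
  assumes "G \<in> input_graphs d"
  shows "kernel_graph G c k \<in> input_graphs d"
proof -
  interpret numbered_graph G "card (verts G)" k c using input_graphsD(1)[OF assms] .
  show ?thesis
    using is_graph_kernel_graph verts_kernel_graph twin_width_kernel_graph assms
    by (auto simp: input_graphs_def)
qed

lemma kernel_bound_vertex_cover:
  assumes "G \<in> input_graphs d" "vertex_cover G S" "card S \<le> k"
  shows "card (kept G c k) \<le> (class_bound (nat d) + 1) * ((k + 1) * (k + 1))"
proof -
  interpret numbered_graph G "card (verts G)" k c using input_graphsD(1)[OF assms(1)] .
  show ?thesis
    using card_kept_vertex_cover[OF graph input_graphsD(2)[OF assms(1)] assms(2,3), of c]
    by (simp only: power2_eq_square)
qed

lemma kernel_cases:
  assumes "vc_kernel C ((G, c), k) = ((G', c'), k')"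
  obtains "C * ((k + 1) * (k + 1)) < card (kept G c k)" "G' = single_edge" "c' = (\<lambda>_. 0)" "k' = 0"
  | "card (kept G c k) \<le> C * ((k + 1) * (k + 1))" "G' = kernel_graph G c k"
    "c' = kernel_capacity G c k" "k' = k"
proof (cases "C * ((k + 1) * (k + 1)) < card (kept G c k)")
  case True
  moreover have "vc_kernel C ((G, c), k) = ((single_edge, \<lambda>_. 0), 0)"
    unfolding vc_kernel_def prod.case if_P[OF True] ..
  ultimately show thesis using assms that(1) by simp
next
  case False
  moreover have "vc_kernel C ((G, c), k) = ((kernel_graph G c k, kernel_capacity G c k), k)"
    unfolding vc_kernel_def prod.case if_not_P[OF False] ..
  ultimately show thesis using assms that(2) by simp
qed

text \<open>The summand 2 accounts for the single edge. The bounds on \<open>k'\<close> and on the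
  capacities are recorded because the encoding of the output has to be bounded in bits.\<close>

lemma kernel_correct:
  assumes G: "G \<in> input_graphs d"
    and K: "vc_kernel (class_bound (nat d) + 1) ((G, c), k) = ((G', c'), k')"
  shows "G' \<in> input_graphs d"
    and "(\<exists>S. connected_vertex_cover G' S \<and> card S \<le> k') \<longleftrightarrow>
      (\<exists>S. connected_vertex_cover G S \<and> card S \<le> k)"
    and "(\<exists>S. capacitated_vertex_cover G' c' S \<and> card S \<le> k') \<longleftrightarrow>
      (\<exists>S. capacitated_vertex_cover G c S \<and> card S \<le> k)"
    and "card (verts G') \<le> (class_bound (nat d) + 1) * ((k + 1) * (k + 1)) + 2"
    and "k' \<le> k" "\<And>a. c' a \<le> card (verts G')"
proof -
  interpret numbered_graph G "card (verts G)" k c using input_graphsD(1)[OF G] .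
  have "G' \<in> input_graphs d \<and>
    ((\<exists>S. connected_vertex_cover G' S \<and> card S \<le> k') \<longleftrightarrow>
      (\<exists>S. connected_vertex_cover G S \<and> card S \<le> k)) \<and>
    ((\<exists>S. capacitated_vertex_cover G' c' S \<and> card S \<le> k') \<longleftrightarrow>
      (\<exists>S. capacitated_vertex_cover G c S \<and> card S \<le> k)) \<and>
    card (verts G') \<le> (class_bound (nat d) + 1) * ((k + 1) * (k + 1)) + 2 \<and>
    k' \<le> k \<and> (\<forall>a. c' a \<le> card (verts G'))"
    using K
  proof (cases rule: kernel_cases)
    case 1
    have "\<not> (vertex_cover G S \<and> card S \<le> k)" for S
      using 1(1) kernel_bound_vertex_cover[OF G, of S k c] by auto
    then have "\<not> (\<exists>S. connected_vertex_cover G S \<and> card S \<le> k)"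
      "\<not> (\<exists>S. capacitated_vertex_cover G c S \<and> card S \<le> k)"
      unfolding connected_vertex_cover_def capacitated_vertex_cover_def by blast+
    moreover have "\<not> (vertex_cover single_edge S \<and> card S \<le> 0)" for S
      using single_edge_cover[of S] by auto
    then have "\<not> (\<exists>S. connected_vertex_cover single_edge S \<and> card S \<le> 0)"
      "\<not> (\<exists>S. capacitated_vertex_cover single_edge c' S \<and> card S \<le> 0)"
      unfolding connected_vertex_cover_def capacitated_vertex_cover_def by blast+
    ultimately show ?thesis
      using single_edge_input[OF input_graphsD(3)[OF G]] unfolding 1(2-4)
      by (simp only: simp_thms) simp
  next
    case 2
    then show ?thesis
      using kernel_graph_input[OF G] connected_kernel_graph capacitated_kernel_graph
      by (simp add: verts_kernel_graph kernel_capacity_def reduced_capacity_def)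
  qed
  then show "G' \<in> input_graphs d"
    and "(\<exists>S. connected_vertex_cover G' S \<and> card S \<le> k') \<longleftrightarrow>
      (\<exists>S. connected_vertex_cover G S \<and> card S \<le> k)"
    and "(\<exists>S. capacitated_vertex_cover G' c' S \<and> card S \<le> k') \<longleftrightarrow>
      (\<exists>S. capacitated_vertex_cover G c S \<and> card S \<le> k)"
    and "card (verts G') \<le> (class_bound (nat d) + 1) * ((k + 1) * (k + 1)) + 2"
    and "k' \<le> k" "\<And>a. c' a \<le> card (verts G')"
    by blast+
qed

section \<open>Encodings and their lengths\<close>

definition matrix :: "nat trigraph \<Rightarrow> nat \<Rightarrow> nat \<Rightarrow> nat" where
  "matrix G i j = of_bool ({i, j} \<in> black G)"

lemma concat_rows:
  "concat (map (\<lambda>i. map (g i) [0..<n]) [0..<m]) = map (\<lambda>p. g (p div n) (p mod n)) [0..<m * n]"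
proof (induction m)
  case (Suc m)
  have "[0..<Suc m * n] = [0..<m * n] @ map (\<lambda>j. j + m * n) [0..<n]"
    using upt_add_eq_append[of 0 "m * n" n] map_add_upt[of "m * n" n] by (simp add: add.commute)
  moreover have "map ((\<lambda>p. g (p div n) (p mod n)) \<circ> (\<lambda>j. j + m * n)) [0..<n] = map (g m) [0..<n]"
    by (rule map_cong) auto
  ultimately show ?case using Suc.IH by simp
qed simp

lemma encode_graph_eq:
  "encode_graph G = card (verts G) #
    map (\<lambda>p. matrix G (p div card (verts G)) (p mod card (verts G)))
      [0..<card (verts G) * card (verts G)]"
proof -
  have "(if {i, j} \<in> black G then 1 else 0) = matrix G i j" for i j by (simp add: matrix_def)
  then show ?thesis unfolding encode_graph_def Let_def by (simp add: concat_rows)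
qed

lemma encode_graph_single_edge: "encode_graph single_edge = [2, 0, 1, 1, 0]"
proof -
  have "[0..<2] = [0, 1]" by (simp add: numeral_2_eq_2)
  moreover have "{0, 0} \<noteq> {0, 1 :: nat}" "{1, 1} \<noteq> {0, 1 :: nat}" "{1, 0} = {0, 1 :: nat}"
    by auto
  ultimately show ?thesis by (simp add: encode_graph_def Let_def)
qed

text \<open>One encoding for both problems: \<open>b = 1\<close> lists the capacities and
  \<open>b = 0\<close> omits them, so that the program is analysed only once.\<close>

definition encode :: "nat \<Rightarrow> (nat trigraph \<times> (nat \<Rightarrow> nat)) \<times> nat \<Rightarrow> nat list" where
  "encode b = (\<lambda>((G, c), k). k # encode_graph G @ map c [0..<b * card (verts G)])"

lemma encode_capacitated_eq: "encode_capacitated = encode 1"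
  by (simp add: encode_capacitated_def encode_def fun_eq_iff)

lemma encode_connected_eq: "encode_connected (G, k) = encode 0 ((G, c), k)"
  by (simp add: encode_connected_def encode_def)

lemma length_encode:
  "length (encode b ((G, c), k)) = 2 + card (verts G) * card (verts G) + b * card (verts G)"
  by (simp add: encode_def encode_graph_eq)

lemma set_encode_le:
  assumes "x \<in> set (encode b ((G, c), k))" "\<And>a. c a \<le> card (verts G)"
  shows "x \<le> k + card (verts G) + 1"
  using assms(1) assms(2) by (auto simp: encode_def encode_graph_eq matrix_def le_SucI trans_le_add2)

lemma list_size_bits_le: "(\<And>x. x \<in> set xs \<Longrightarrow> x \<le> M) \<Longrightarrow> list_size_bits xs \<le> length xs * bits M"
proof (induction xs)
  case (Cons x xs)
  then have "bits x \<le> bits M" "list_size_bits xs \<le> length xs * bits M" by (auto intro: bits_mono)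
  then show ?case by (simp add: list_size_bits_def)
qed (simp add: list_size_bits_def)

lemma length_le_list_size_bits: "length xs \<le> list_size_bits xs"
  by (induction xs) (auto simp: list_size_bits_def bits_def)

lemma bits_sum_list: "bits (sum_list xs) \<le> Suc (list_size_bits xs)"
proof (induction xs)
  case (Cons x xs)
  then show ?case using bits_add[of x "sum_list xs"] by (simp add: list_size_bits_def)
qed (simp add: bits_def list_size_bits_def)

context numbered_graph
begin

abbreviation input_cells :: "nat \<Rightarrow> nat \<Rightarrow> nat" where
  "input_cells b \<equiv> input_memory (encode b ((G, c), k)) 0"

text \<open>The sum of all entries dominates each of them, while its length in bits is still linear
  in the size of the encoding. The other summands cover the cell that holds the length and the
  numbers written by the program.\<close>

abbreviation bound :: "nat \<Rightarrow> nat" where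
  "bound b \<equiv> sum_list (encode b ((G, c), k)) + length (encode b ((G, c), k)) + 8"

lemma card_verts: "card (verts G) = n"
  by (simp add: verts)

lemma input_cells_Suc:
  "i < length (encode b ((G, c), k)) \<Longrightarrow> input_cells b (Suc i) = encode b ((G, c), k) ! i"
  by (simp add: input_memory_def)

lemma bounded_input: "bounded (bound b) (input_memory (encode b ((G, c), k)))"
  unfolding bounded_def
proof (intro allI)
  fix a i
  let ?xs = "encode b ((G, c), k)"
  show "input_memory ?xs a i \<le> bound b"
  proof (cases "a = 0 \<and> i \<le> length ?xs")
    case True
    then have "(length ?xs # ?xs) ! i \<in> set (length ?xs # ?xs)" by (intro nth_mem) simp
    then have "(length ?xs # ?xs) ! i \<le> bound b" using member_le_sum_list[of _ ?xs] by force
    then show ?thesis using True by (simp add: input_memory_def)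
  qed (auto simp: input_memory_def)
qed

lemma kernel_run_input:
  assumes b: "b \<le> 1" and c0: "b = 0 \<Longrightarrow> c = (\<lambda>_. 0)"
  shows "kernel_run (bound b) (n + 1) (input_cells b) k n b (matrix G) c"
proof
  let ?xs = "encode b ((G, c), k)"
  have xs: "?xs = k # n # map (\<lambda>p. matrix G (p div n) (p mod n)) [0..<n * n] @ map c [0..<b * n]"
    by (simp add: encode_def encode_graph_eq card_verts)
  have len: "length ?xs = 2 + n * n + b * n" by (simp add: xs)
  show "2 \<le> bound b" "1 \<le> n + 1" "n < n + 1" "b \<le> 1" using b by auto
  show "input_cells b (Suc 0) = k" using input_cells_Suc[of 0 b] by (simp add: xs)
  show "input_cells b 2 = n" using input_cells_Suc[of 1 b] by (simp add: xs numeral_2_eq_2)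
  show "matrix G i j \<le> 1" for i j by (simp add: matrix_def)
  show "input_cells b i \<le> bound b" for i using bounded_input[of b] unfolding bounded_def by blast
  show "n * n + n + 8 \<le> bound b"
  proof -
    \<comment> \<open>\<open>n\<close> is itself an entry, and \<open>n * n\<close> is part of the
      length.\<close>
    have "n \<le> sum_list ?xs" by (simp add: xs)
    then show ?thesis unfolding len by linarith
  qed
  show "input_cells b (3 + (i * n + j)) = matrix G i j" if "i < n" "j < n" for i j
  proof -
    have "i * n + j < Suc i * n" using that by simp
    also have "\<dots> \<le> n * n" using that by (intro mult_right_mono) auto
    finally have lt: "i * n + j < n * n" .
    have n0: "n \<noteq> 0" using that by linarith
    have idx: "(i * n + j) div n = i" "(i * n + j) mod n = j"
      using that div_mult_self3[OF n0, of i j] by simp_all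
    have "input_cells b (Suc (2 + (i * n + j))) = ?xs ! (2 + (i * n + j))"
      using lt len by (intro input_cells_Suc) simp
    also have "\<dots> = matrix G ((i * n + j) div n) ((i * n + j) mod n)"
      using lt by (simp add: xs nth_append)
    also have "\<dots> = matrix G i j" unfolding idx ..
    finally show ?thesis by (simp add: numeral_3_eq_3 numeral_2_eq_2)
  qed
  show "input_cells b (3 + (n * n + i)) = c i" if "i < n" for i
  proof (cases "b = 0")
    case True
    then show ?thesis using c0 len by (simp add: input_memory_def)
  next
    case False
    then have b1: "b = 1" using b by simp
    have "input_cells b (Suc (2 + (n * n + i))) = ?xs ! (2 + (n * n + i))"
      using that len b1 by (intro input_cells_Suc) simp
    also have "\<dots> = c i" unfolding xs using that b1 by (simp add: nth_append)
    finally show ?thesis by (simp add: numeral_3_eq_3 numeral_2_eq_2)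
  qed
qed

lemma sum_of_bool_card: "(\<Sum>j<n. of_bool (P j)) = card {j. j < n \<and> P j}"
proof -
  have "{..<n} \<inter> {j. P j} = {j. j < n \<and> P j}" by auto
  then show ?thesis by simp
qed

text \<open>Matches the arithmetic of the program with the graph: two rows differ nowhere exactly
  for twins, the rank is the number of better twins, and the sum subtracted from a capacity counts
  deleted neighbours.\<close>

lemma kernel_program_output:
  assumes b: "b \<le> 1" and c0: "b = 0 \<Longrightarrow> c = (\<lambda>_. 0)"
    and s: "array_holds (s 1) (if C * ((k + 1) * (k + 1)) < length (kernel_run.keep_list k n (matrix G) c n)
       then [0, 2, 0, 1, 1, 0] @ replicate (2 * b) 0
       else kernel_run.kernel_output k n b (matrix G) c)"
  shows "array_holds (s 1) (encode b (vc_kernel C ((G, c), k)))"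
proof -
  interpret kernel_run "bound b" "n + 1" "input_cells b" k n b "matrix G" c
    by (rule kernel_run_input[OF b c0])
  have nb: "nbs G v \<subseteq> {..<n}" for v using nbs_subset[OF graph, of v] verts by simp
  have diff0: "diff i j = 0 \<longleftrightarrow> nbs G j = nbs G i" for i j
  proof -
    have "diff i j = 0 \<longleftrightarrow> (\<forall>w<n. matrix G i w = matrix G j w)"
      unfolding diff_def by (auto intro: antisym)
    also have "\<dots> \<longleftrightarrow> (\<forall>w<n. w \<in> nbs G i \<longleftrightarrow> w \<in> nbs G j)"
      by (auto simp: matrix_def nbs_def of_bool_def split: if_splits)
    also have "\<dots> \<longleftrightarrow> nbs G j = nbs G i" using nb[of i] nb[of j] by blast
    finally show ?thesis .
  qed
  have rank: "rank i = card (better_twins G c i)" for i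
  proof -
    have "(1 - diff i j) * of_bool (0 < c j + of_bool (0 < i - j) - c i) =
        of_bool (j \<in> better_twins G c i)" if "j < n" for j
    proof -
      have "j \<in> better_twins G c i \<longleftrightarrow> diff i j = 0 \<and> (c i < c j \<or> c j = c i \<and> j < i)"
        using that verts by (simp add: diff0 better_twins_def)
      moreover have "0 < c j + of_bool (0 < i - j) - c i \<longleftrightarrow> c i < c j \<or> c j = c i \<and> j < i"
        by (cases "j < i") auto
      ultimately show ?thesis by (cases "diff i j = 0") simp_all
    qed
    then have "rank i = (\<Sum>j<n. of_bool (j \<in> better_twins G c i))"
      unfolding rank_def by (intro sum.cong) auto
    also have "\<dots> = card {j. j < n \<and> j \<in> better_twins G c i}" by (rule sum_of_bool_card)
    also have "{j. j < n \<and> j \<in> better_twins G c i} = better_twins G c i"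
      using verts by (auto simp: better_twins_def)
    finally show ?thesis .
  qed
  have kl_eq: "kept_list = kl"
    unfolding keep_list_def kept_vertices_def card_verts
    by (rule filter_cong) (auto simp: kept_def rank verts)
  have m: "m = card K" unfolding kl_eq by (rule length_kl)
  have red: "(\<Sum>j<n. matrix G w j * of_bool (k < rank j)) = card (nbs G w - K)" for w
  proof -
    have "matrix G w j * of_bool (k < rank j) = of_bool (j \<in> nbs G w - K)" if "j < n" for j
      using that verts by (simp add: matrix_def nbs_def kept_def rank not_le)
    then have "(\<Sum>j<n. matrix G w j * of_bool (k < rank j)) = (\<Sum>j<n. of_bool (j \<in> nbs G w - K))"
      by (intro sum.cong) auto
    also have "\<dots> = card {j. j < n \<and> j \<in> nbs G w - K}" by (rule sum_of_bool_card)
    also have "{j. j < n \<and> j \<in> nbs G w - K} = nbs G w - K" using nb[of w] by auto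
    finally show ?thesis .
  qed
  show ?thesis
  proof (cases "C * ((k + 1) * (k + 1)) < card K")
    case True
    have "encode b (vc_kernel C ((G, c), k)) = [0, 2, 0, 1, 1, 0] @ replicate (2 * b) 0"
      using True by (simp add: vc_kernel_def encode_def encode_graph_single_edge map_replicate_const mult.commute)
    then show ?thesis using s True m by simp
  next
    case False
    have mm: "card (verts (kernel_graph G c k)) = card K" by (simp add: verts_kernel_graph)
    have e1: "entry p = matrix (kernel_graph G c k) (p div card K) (p mod card K)"
      if p: "p < card K * card K" for p
    proof -
      have "p div card K < card K" "p mod card K < card K"
        using p by (auto simp: less_mult_imp_div_less intro!: mod_less_divisor gr0I)
      then show ?thesis
        using p unfolding entry_def kl_eq length_kl by (simp add: matrix_def edge_kernel_graph)
    qed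
    have e2: "entry (card K * card K + a) = kernel_capacity G c k a" for a
      unfolding entry_def kl_eq length_kl red by (simp add: kernel_capacity_def reduced_capacity_def)
    have "[0..<card K * card K + b * card K] =
        [0..<card K * card K] @ map (\<lambda>a. a + card K * card K) [0..<b * card K]"
      using upt_add_eq_append[of 0 "card K * card K" "b * card K"]
        map_add_upt[of "card K * card K" "b * card K"] by (simp add: add.commute)
    then have "kernel_output = encode b (vc_kernel C ((G, c), k))"
      using False e1 e2
      by (simp add: kernel_output_def m vc_kernel_def encode_def encode_graph_eq mm add.commute)
    then show ?thesis using s False m by simp
  qed
qed

text \<open>Three nested loops over the vertices and a word length linear in \<open>N\<close> give
  degree 4, where \<open>n\<close> is at most \<open>N\<close> because the matrix is part of the
  input. The 100 pays for the output, which has at most \<open>10 * (N + 1)\<close> entries of at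
  most as many bits each.\<close>

lemma kernel_program_time:
  assumes b: "b \<le> 1" and c0: "b = 0 \<Longrightarrow> c = (\<lambda>_. 0)"
  defines "N \<equiv> list_size_bits (encode b ((G, c), k))"
  shows "\<exists>t. computes_in_time (kernel_prog C b) (encode b ((G, c), k)) (encode b (vc_kernel C ((G, c), k))) t \<and>
    t \<le> (10 * prog_cost (kernel_prog C b) + 100) * (N + 1) ^ 4"
proof -
  let ?xs = "encode b ((G, c), k)" and ?ys = "encode b (vc_kernel C ((G, c), k))"
  let ?p = "kernel_prog C b"
  interpret kernel_run "bound b" "n + 1" "input_cells b" k n b "matrix G" c
    by (rule kernel_run_input[OF b c0])
  have "runs 3 ?p (input_memory ?xs)
      (\<lambda>s'. array_holds (s' 1) (if C * ((k + 1) * (k + 1)) < m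
       then [0, 2, 0, 1, 1, 0] @ replicate (2 * b) 0 else kernel_output))"
    unfolding numeral_3_eq_3
    by (rule runs_kernel_prog[OF bounded_input]) (auto simp: input_memory_def)
  then obtain u s where s: "exec ?p (input_memory ?xs) u s" "array_holds (s 1) ?ys"
    and u: "u \<le> prog_cost ?p * (n + 1) ^ 3 * bits (bound b)"
    unfolding runs_def using kernel_program_output[OF b c0] by blast
  have len: "length ?xs = 2 + n * n + b * n" by (simp add: length_encode card_verts)
  have lenN: "length ?xs \<le> N" unfolding N_def by (rule length_le_list_size_bits)
  have nN: "n \<le> N" "n * n \<le> N"
  proof -
    have "n \<le> n * n" by simp
    then show "n \<le> N" "n * n \<le> N" using len lenN by linarith+
  qed
  have bitsM: "bits (bound b) \<le> 10 * (N + 1)"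
  proof -
    have "bits (bound b) \<le> bits (sum_list ?xs) + bits (length ?xs + 8)"
      using bits_add[of "sum_list ?xs" "length ?xs + 8"] by (simp only: add.assoc)
    also have "\<dots> \<le> Suc N + Suc (length ?xs + 8)"
      unfolding N_def by (intro add_mono bits_sum_list bits_le_Suc)
    also have "\<dots> \<le> 10 * (N + 1)" using lenN by simp
    finally show ?thesis .
  qed
  have "u \<le> prog_cost ?p * (N + 1) ^ 3 * (10 * (N + 1))"
    using u by (rule order_trans) (intro mult_le_mono order_refl power_mono bitsM; use nN in simp)
  then have u': "u \<le> 10 * prog_cost ?p * (N + 1) ^ 4" by (simp add: power_Suc numeral_eq_Suc algebra_simps)
  obtain G' c' k' where K: "vc_kernel C ((G, c), k) = ((G', c'), k')" by (metis surj_pair)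
  have n': "card (verts G') \<le> n + 2" "k' \<le> k" "\<And>a. c' a \<le> card (verts G')"
  proof -
    have le: "card (kept G c k) \<le> n" using card_mono[OF _ kept_subset, of G c k] verts by simp
    have "card (verts G') \<le> n + 2 \<and> k' \<le> k \<and> (\<forall>a. c' a \<le> card (verts G'))"
      by (rule kernel_cases[OF K])
        (use le in \<open>auto simp: verts_kernel_graph kernel_capacity_def reduced_capacity_def\<close>)
    then show "card (verts G') \<le> n + 2" "k' \<le> k" "\<And>a. c' a \<le> card (verts G')" by blast+
  qed
  have "list_size_bits ?ys \<le> length ?ys * bits (bound b)"
  proof (rule list_size_bits_le)
    fix x assume "x \<in> set ?ys"
    then have "x \<le> k' + card (verts G') + 1" unfolding K using n'(3) by (rule set_encode_le)
    also have "\<dots> \<le> bound b"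
    proof -
      have "k + n \<le> sum_list ?xs" by (simp add: encode_def encode_graph_eq card_verts)
      then show ?thesis using n'(1,2) by linarith
    qed
    finally show "x \<le> bound b" .
  qed
  also have "\<dots> \<le> (10 * (N + 1)) * (10 * (N + 1))"
  proof (rule mult_le_mono[OF _ bitsM])
    have "length ?ys \<le> 2 + (n + 2) * (n + 2) + 1 * (n + 2)"
      unfolding K length_encode using n'(1) b by (intro add_mono mult_le_mono) auto
    also have "\<dots> = 8 + n * n + 5 * n" by (simp add: algebra_simps)
    also have "\<dots> \<le> 10 * (N + 1)" using nN by simp
    finally show "length ?ys \<le> 10 * (N + 1)" .
  qed
  also have "\<dots> = 100 * (N + 1) ^ 2" by (simp add: power2_eq_square algebra_simps)
  also have "\<dots> \<le> 100 * (N + 1) ^ 4" by (intro mult_left_mono power_increasing) auto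
  finally have "u + list_size_bits ?ys \<le> (10 * prog_cost ?p + 100) * (N + 1) ^ 4"
    using u' by (simp only: add_mult_distrib)
  with s show ?thesis unfolding computes_in_time_def by blast
qed

end

section \<open>Size of the kernels in vertices and in bits\<close>

definition kernel_size :: "nat \<Rightarrow> nat \<Rightarrow> nat" where
  "kernel_size C k = C * ((k + 1) * (k + 1)) + 2"

lemma kernel_size_bigo: "(\<lambda>k. real (kernel_size C k)) \<in> O(\<lambda>k. real k ^ 2)"
  unfolding kernel_size_def by simp real_asymp

lemma encode_kernel_bound:
  assumes "card (verts G') \<le> P" "k' \<le> k" "\<And>a. c' a \<le> card (verts G')" "b \<le> 1"
  shows "list_size_bits (encode b ((G', c'), k')) \<le> (2 + P * P + P) * bits (k + P + 1)"
proof -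
  let ?ys = "encode b ((G', c'), k')"
  have "list_size_bits ?ys \<le> length ?ys * bits (k + P + 1)"
  proof (rule list_size_bits_le)
    fix x assume "x \<in> set ?ys"
    then have "x \<le> k' + card (verts G') + 1" using assms(3) by (rule set_encode_le)
    then show "x \<le> k + P + 1" using assms(1,2) by linarith
  qed
  also have "length ?ys \<le> 2 + P * P + 1 * P"
    unfolding length_encode using assms by (intro add_mono mult_le_mono) auto
  finally show ?thesis by (simp add: mult_le_mono)
qed

lemma poly_time_bound: "poly ([:a:] * [:1, 1:] ^ 4) (x :: nat) = a * (x + 1) ^ 4"
  by (simp add: poly_power add.commute)

lemma capacitated_kernelization:
  "kernelization (capacitated_instances d) Capacitated_Vertex_Cover encode_capacitated
    (vc_kernel (class_bound (nat d) + 1))" (is "kernelization ?I ?Y ?enc ?K")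
  unfolding kernelization_def
proof (intro conjI)
  let ?p = "kernel_prog (class_bound (nat d) + 1) 1"
  show "polynomial_time_on ?I ?enc ?K"
    unfolding polynomial_time_on_def encode_capacitated_eq
  proof (rule exI[of _ ?p], rule exI[of _ "[:10 * prog_cost ?p + 100:] * [:1, 1:] ^ 4"], rule ballI)
    fix x assume "x \<in> ?I"
    then obtain G c k where x: "x = ((G, c), k)" "G \<in> input_graphs d"
      by (auto simp: capacitated_instances_def)
    interpret numbered_graph G "card (verts G)" k c using input_graphsD(1)[OF x(2)] .
    show "\<exists>t. computes_in_time ?p (encode 1 x) (encode 1 (?K x)) t \<and>
        t \<le> poly ([:10 * prog_cost ?p + 100:] * [:1, 1:] ^ 4) (list_size_bits (encode 1 x))"
      unfolding x(1) poly_time_bound by (rule kernel_program_time) auto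
  qed
  show "\<forall>x\<in>?I. ?K x \<in> ?I \<and> (?K x \<in> ?Y \<longleftrightarrow> x \<in> ?Y)"
  proof
    fix x assume "x \<in> ?I"
    then obtain G c k where x: "x = ((G, c), k)" "G \<in> input_graphs d"
      by (auto simp: capacitated_instances_def)
    obtain G' c' k' where K: "?K ((G, c), k) = ((G', c'), k')" by (metis surj_pair)
    show "?K x \<in> ?I \<and> (?K x \<in> ?Y \<longleftrightarrow> x \<in> ?Y)"
      using kernel_correct(1,3)[OF x(2) K] unfolding x(1) K
      by (simp add: capacitated_instances_def Capacitated_Vertex_Cover_def)
  qed
  show "\<exists>h. \<forall>x\<in>?I. list_size_bits (?enc (?K x)) \<le> h (snd x)"
    unfolding encode_capacitated_eq
  proof (intro exI ballI)
    fix x assume "x \<in> ?I"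
    then obtain G c k where x: "x = ((G, c), k)" "G \<in> input_graphs d"
      by (auto simp: capacitated_instances_def)
    obtain G' c' k' where K: "?K ((G, c), k) = ((G', c'), k')" by (metis surj_pair)
    let ?P = "\<lambda>k. kernel_size (class_bound (nat d) + 1) k"
    show "list_size_bits (encode 1 (?K x)) \<le>
        (\<lambda>k. (2 + ?P k * ?P k + ?P k) * bits (k + ?P k + 1)) (snd x)"
      unfolding x(1) K snd_conv using kernel_correct(4-6)[OF x(2) K]
      by (intro encode_kernel_bound) (simp_all only: kernel_size_def order_refl)
  qed
qed

text \<open>With all capacities 0 the order within a twin class is that of the vertex numbers, and
  the resulting capacities are discarded.\<close>

definition connected_kernel_map :: "nat \<Rightarrow> nat trigraph \<times> nat \<Rightarrow> nat trigraph \<times> nat" where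
  "connected_kernel_map C = (\<lambda>(G, k). map_prod fst id (vc_kernel C ((G, \<lambda>_. 0), k)))"

lemma connected_kernel_map_eq:
  "vc_kernel C ((G, \<lambda>_. 0), k) = ((G', c'), k') \<Longrightarrow> connected_kernel_map C (G, k) = (G', k')"
  by (simp add: connected_kernel_map_def)

lemma connected_kernelization:
  "kernelization (connected_instances d) Connected_Vertex_Cover encode_connected
    (connected_kernel_map (class_bound (nat d) + 1))" (is "kernelization ?I ?Y ?enc ?K")
  unfolding kernelization_def
proof (intro conjI)
  let ?C = "class_bound (nat d) + 1"
  let ?p = "kernel_prog ?C 0"
  have enc: "?enc (?K (G, k)) = encode 0 (vc_kernel ?C ((G, \<lambda>_. 0), k))" for G k
  proof -
    obtain G' c' k' where K: "vc_kernel ?C ((G, \<lambda>_. 0), k) = ((G', c'), k')" by (metis surj_pair)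
    show ?thesis unfolding connected_kernel_map_eq[OF K] K by (rule encode_connected_eq)
  qed
  show "polynomial_time_on ?I ?enc ?K"
    unfolding polynomial_time_on_def
  proof (rule exI[of _ ?p], rule exI[of _ "[:10 * prog_cost ?p + 100:] * [:1, 1:] ^ 4"], rule ballI)
    fix x assume "x \<in> ?I"
    then obtain G k where x: "x = (G, k)" "G \<in> input_graphs d"
      by (auto simp: connected_instances_def)
    interpret numbered_graph G "card (verts G)" k "\<lambda>_. 0" using input_graphsD(1)[OF x(2)] .
    show "\<exists>t. computes_in_time ?p (?enc x) (?enc (?K x)) t \<and>
        t \<le> poly ([:10 * prog_cost ?p + 100:] * [:1, 1:] ^ 4) (list_size_bits (?enc x))"
      unfolding x(1) enc unfolding encode_connected_eq[of G k "\<lambda>_. 0"] poly_time_bound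
      by (rule kernel_program_time) auto
  qed
  show "\<forall>x\<in>?I. ?K x \<in> ?I \<and> (?K x \<in> ?Y \<longleftrightarrow> x \<in> ?Y)"
  proof
    fix x assume "x \<in> ?I"
    then obtain G k where x: "x = (G, k)" "G \<in> input_graphs d"
      by (auto simp: connected_instances_def)
    obtain G' c' k' where K: "vc_kernel ?C ((G, \<lambda>_. 0), k) = ((G', c'), k')" by (metis surj_pair)
    have "?K x = (G', k')" unfolding x(1) by (rule connected_kernel_map_eq[OF K])
    then show "?K x \<in> ?I \<and> (?K x \<in> ?Y \<longleftrightarrow> x \<in> ?Y)"
      using kernel_correct(1,2)[OF x(2) K] unfolding x(1)
      by (simp add: connected_instances_def Connected_Vertex_Cover_def)
  qed
  show "\<exists>h. \<forall>x\<in>?I. list_size_bits (?enc (?K x)) \<le> h (snd x)"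
  proof (intro exI ballI)
    fix x assume "x \<in> ?I"
    then obtain G k where x: "x = (G, k)" "G \<in> input_graphs d"
      by (auto simp: connected_instances_def)
    obtain G' c' k' where K: "vc_kernel ?C ((G, \<lambda>_. 0), k) = ((G', c'), k')" by (metis surj_pair)
    let ?P = "\<lambda>k. kernel_size ?C k"
    show "list_size_bits (?enc (?K x)) \<le>
        (\<lambda>k. (2 + ?P k * ?P k + ?P k) * bits (k + ?P k + 1)) (snd x)"
      unfolding x(1) enc K snd_conv using kernel_correct(4-6)[OF x(2) K]
      by (intro encode_kernel_bound) (simp_all only: kernel_size_def order_refl zero_le)
  qed
qed

theorem theorem2:
  fixes d :: int
  shows
    "(\<exists>K. \<exists>g :: nat \<Rightarrow> real.
        kernelization (connected_instances d) Connected_Vertex_Cover encode_connected K \<and>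
        g \<in> O(\<lambda>k. real k ^ 2) \<and>
        (\<forall>G k G' k'. (G, k) \<in> connected_instances d \<longrightarrow> K (G, k) = (G', k') \<longrightarrow>
           real (card (verts G')) \<le> g k)) \<and>
     (\<exists>K. \<exists>g :: nat \<Rightarrow> real.
        kernelization (capacitated_instances d) Capacitated_Vertex_Cover encode_capacitated K \<and>
        g \<in> O(\<lambda>k. real k ^ 2) \<and>
        (\<forall>G c k G' c' k'. ((G, c), k) \<in> capacitated_instances d \<longrightarrow>
           K ((G, c), k) = ((G', c'), k') \<longrightarrow>
           real (card (verts G')) \<le> g k))"
proof (intro conjI exI allI impI)
  let ?C = "class_bound (nat d) + 1"
  show "kernelization (connected_instances d) Connected_Vertex_Cover encode_connected
      (connected_kernel_map ?C)"
    by (rule connected_kernelization)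
  show "kernelization (capacitated_instances d) Capacitated_Vertex_Cover encode_capacitated (vc_kernel ?C)"
    by (rule capacitated_kernelization)
  show "(\<lambda>k. real (kernel_size ?C k)) \<in> O(\<lambda>k. real k ^ 2)"
    "(\<lambda>k. real (kernel_size ?C k)) \<in> O(\<lambda>k. real k ^ 2)"
    by (rule kernel_size_bigo)+
next
  fix G k G' k'
  assume *: "(G, k) \<in> connected_instances d" "connected_kernel_map (class_bound (nat d) + 1) (G, k) = (G', k')"
  obtain G'' c'' k'' where K: "vc_kernel (class_bound (nat d) + 1) ((G, \<lambda>_. 0), k) = ((G'', c''), k'')"
    by (metis surj_pair)
  then have "G'' = G'" using *(2) connected_kernel_map_eq[OF K] by simp
  with K *(1) show "real (card (verts G')) \<le> real (kernel_size (class_bound (nat d) + 1) k)"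
    using kernel_correct(4)[of G d _ k] by (simp only: connected_instances_def kernel_size_def of_nat_le_iff mem_Collect_eq prod.case)
next
  fix G c k G' c' k'
  assume "((G, c), k) \<in> capacitated_instances d"
    "vc_kernel (class_bound (nat d) + 1) ((G, c), k) = ((G', c'), k')"
  then show "real (card (verts G')) \<le> real (kernel_size (class_bound (nat d) + 1) k)"
    using kernel_correct(4)[of G d c k] by (simp only: capacitated_instances_def kernel_size_def of_nat_le_iff mem_Collect_eq prod.case)
qed

end
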